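(* Let $\Gamma$ be a simply-laced Dynkin diagram of finite type (type $A$, $D$ or $E$) and let $G$ be the corresponding finite Coxeter group. Any two reflections of $G$ are conjugate, so the parameters $\Upsilon$ of $B_G(\Upsilon)$ are given by $\mu_s=\mu$ and $\tau_s=\tau$ for all reflections $s$; by the rescaling isomorphism recalled in the context one can let $\mu=1$, so that $B_G(\Upsilon)$ can be denoted $B_G(\tau)$. Then $B_G(\Upsilon)$ is isomorphic to the generalized Brauer algebra $B_\Gamma(\tau)$ of simply-laced type introduced by Cohen, Gijsbers and Wales.
   Context: Rescaling: for $\lambda\in\mathbb{C}^\times$, if $\Upsilon'$ is obtained from $\Upsilon$ by replacing every $\mu_s$ by $\lambda\mu_s$ and every $\tau_s$ by $\lambda\tau_s$, then $B_G(\Upsilon')\cong B_G(\Upsilon)$; in the statement, $\tau$ in $B_\Gamma(\tau)$ is the value of the parameter after letting $\mu=1$. Let $I$ be the set of nodes of $\Gamma$; write $i\sim j$ if $i,j$ are joined by an edge and $i\nsim j$ otherwise ($i\neq j$). $B_\Gamma(\tau)$ is the unital $\mathbb{C}$-algebra with generators $s_i,e_i$ ($i\in I$) and relations: $s_i^2=1$; $s_is_js_i=s_js_is_j$ if $i\sim j$; $s_is_j=s_js_i$ if $i\nsim j$; $s_ie_i=e_is_i=e_i$; $e_i^2=\tau e_i$; $s_is_je_i=e_js_is_j$ and $e_is_je_i=e_i$ if $i\sim j$; $s_ie_j=e_js_i$ and $e_ie_j=e_je_i$ if $i\nsim j$. $G$ is the Coxeter group of $\Gamma$ in its (complexified) geometric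 representation, $R$ its set of reflections, $H_s$ the fixed hyperplane of $s\in R$; for $s,t\in R$ put $R(s,t)=\{r\in R:rtr=s\}$. $B_G(\Upsilon)$ is the unital associative $\mathbb{C}$-algebra generated by $\{\bar w\}_{w\in G}\cup\{e_s\}_{s\in R}$ with relations: (0) $\bar w_1\bar w_2=\bar w_3$ if $w_1w_2=w_3$ in $G$ (and $\bar1$ is the unit); (1) $\bar se_s=e_s\bar s=e_s$; (2) $e_s^2=\tau_se_s$; (3) $\bar we_t=e_s\bar w$ if $wtw^{-1}=s$; and for $s\ne t$: (4) $e_se_t=e_te_s$ if $\{r\in R:H_r\supset H_s\cap H_t\}=\{s,t\}$; (5) $e_se_t=\big(\sum_{r\in R(s,t)}\mu_r\bar r\big)e_t$ if $\{r\in R:H_r\supset H_s\cap H_t\}\neq\{s,t\}$ and $R(s,t)\ne\emptyset$; (6) $e_se_t=0$ if $\{r\in R:H_r\supset H_s\cap H_t\}\ne\{s,t\}$ and $R(s,t)=\emptyset$. *)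

theory Defs
  imports
    "HOL-Analysis.Analysis"
    "HOL-Library.Poly_Mapping"
    "HOL-Algebra.Generated_Groups"
    "HOL-Algebra.QuotRing"
    "HOL-Algebra.Module"
begin

section \<open>Unital complex algebras given by generators and relations\<close>

text \<open>Words form the free monoid, written additively so that \<open>'g list \<Rightarrow>\<^sub>0 complex\<close>, with the
  convolution product of \<open>Poly_Mapping\<close>, is the free unital associative algebra on \<open>'g\<close>.\<close>

instantiation list :: (type) monoid_add
begin
definition zero_list :: "'a list" where "zero_list = []"
definition plus_list :: "'a list \<Rightarrow> 'a list \<Rightarrow> 'a list" where "plus_list = (@)"
instance by standard (simp_all add: zero_list_def plus_list_def)
end

type_synonym 'g nc_poly = "'g list \<Rightarrow>\<^sub>0 complex"

definition gen :: "'g \<Rightarrow> 'g nc_poly"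
  where "gen x = Poly_Mapping.single [x] 1"

definition scal :: "complex \<Rightarrow> 'g nc_poly"
  where "scal c = Poly_Mapping.single [] c"

definition free_algebra :: "'g set \<Rightarrow> (complex, 'g nc_poly) module"
  where "free_algebra X =
    \<lparr>carrier = {p. \<forall>w\<in>Poly_Mapping.keys p. set w \<subseteq> X},
     mult = (*), one = 1, zero = 0, add = (+), smult = (\<lambda>c p. scal c * p)\<rparr>"

text \<open>\<^const>\<open>genideal\<close> is an intersection of ideals of a ring, so it is only meaningful because of
  this fact.\<close>

lemma ring_free_algebra: "ring (free_algebra X)"
proof (rule ringI)
  show "abelian_group (free_algebra X)"
  proof (rule abelian_groupI)
    fix p q assume "p \<in> carrier (free_algebra X)" "q \<in> carrier (free_algebra X)"
    then show "p \<oplus>\<^bsub>free_algebra X\<^esub> q \<in> carrier (free_algebra X)"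
      using Poly_Mapping.keys_add[of p q] by (auto simp: free_algebra_def)
  next
    fix p assume "p \<in> carrier (free_algebra X)"
    then show "\<exists>q\<in>carrier (free_algebra X). q \<oplus>\<^bsub>free_algebra X\<^esub> p = \<zero>\<^bsub>free_algebra X\<^esub>"
      by (intro bexI[of _ "- p"]) (auto simp: free_algebra_def)
  qed (auto simp: free_algebra_def algebra_simps)
  show "Group.monoid (free_algebra X)"
  proof (rule monoidI)
    fix p q assume *: "p \<in> carrier (free_algebra X)" "q \<in> carrier (free_algebra X)"
    show "p \<otimes>\<^bsub>free_algebra X\<^esub> q \<in> carrier (free_algebra X)"
      using * Poly_Mapping.keys_mult[of p q]
      by (fastforce simp: free_algebra_def plus_list_def)
  qed (auto simp: free_algebra_def zero_list_def algebra_simps)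
qed (auto simp: free_algebra_def algebra_simps)

text \<open>A relation \<open>a = b\<close> is encoded as the pair \<open>(a, b)\<close>.\<close>

definition relation_ideal :: "'g set \<Rightarrow> ('g nc_poly \<times> 'g nc_poly) set \<Rightarrow> 'g nc_poly set"
  where "relation_ideal X rels = Idl\<^bsub>free_algebra X\<^esub> {a - b |a b. (a, b) \<in> rels}"

definition presented_algebra ::
    "'g set \<Rightarrow> ('g nc_poly \<times> 'g nc_poly) set \<Rightarrow> (complex, 'g nc_poly set) module"
  where "presented_algebra X rels =
    (let F = free_algebra X; J = relation_ideal X rels
     in ring.extend (F Quot J)
          (module.fields (\<lambda>c A. \<Union>a\<in>A. J +>\<^bsub>F\<^esub> (c \<odot>\<^bsub>F\<^esub> a))))"

definition algebra_isomorphic ::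
    "(complex, 'a) module \<Rightarrow> (complex, 'b) module \<Rightarrow> bool"  (infix \<open>\<cong>\<^sub>a\<^sub>l\<^sub>g\<close> 50)
  where "A \<cong>\<^sub>a\<^sub>l\<^sub>g B \<longleftrightarrow>
    (\<exists>\<phi>\<in>ring_iso A B. \<forall>c. \<forall>x\<in>carrier A. \<phi> (c \<odot>\<^bsub>A\<^esub> x) = c \<odot>\<^bsub>B\<^esub> \<phi> x)"

section \<open>Simply-laced Dynkin diagrams\<close>

text \<open>Each edge is listed in one orientation; the vertices are \<open>0, \<dots>, n - 1\<close>. In types \<open>D\<close> and \<open>E\<close>
  the vertex \<open>n - 1\<close> is attached to the path \<open>0, \<dots>, n - 2\<close>.\<close>

definition edge_A :: "nat \<Rightarrow> nat \<Rightarrow> nat \<Rightarrow> bool"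
  where "edge_A n i j \<longleftrightarrow> j = i + 1 \<and> j < n"

definition edge_D :: "nat \<Rightarrow> nat \<Rightarrow> nat \<Rightarrow> bool"
  where "edge_D n i j \<longleftrightarrow> (j = i + 1 \<and> j < n - 1) \<or> (i = n - 3 \<and> j = n - 1)"

definition edge_E :: "nat \<Rightarrow> nat \<Rightarrow> nat \<Rightarrow> bool"
  where "edge_E n i j \<longleftrightarrow> (j = i + 1 \<and> j < n - 1) \<or> (i = 2 \<and> j = n - 1)"

definition simply_laced_Dynkin :: "('i::finite \<Rightarrow> 'i \<Rightarrow> bool) \<Rightarrow> bool"
  where "simply_laced_Dynkin adj \<longleftrightarrow>
    (\<exists>E v. (E = edge_A CARD('i)
            \<or> (CARD('i) \<ge> 4 \<and> E = edge_D CARD('i))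
            \<or> (CARD('i) \<in> {6, 7, 8} \<and> E = edge_E CARD('i)))
        \<and> bij_betw v {..<CARD('i)} (UNIV :: 'i set)
        \<and> (\<forall>i<CARD('i). \<forall>j<CARD('i). adj (v i) (v j) \<longleftrightarrow> E i j \<or> E j i))"

section \<open>The Coxeter group in its complexified geometric representation\<close>

text \<open>The group acts on \<open>complex^'i\<close>, whose standard basis consists of the simple roots.\<close>

definition coxeter_matrix :: "('i \<Rightarrow> 'i \<Rightarrow> bool) \<Rightarrow> 'i \<Rightarrow> 'i \<Rightarrow> nat"
  where "coxeter_matrix adj i j = (if i = j then 1 else if adj i j then 3 else 2)"

definition geom_form :: "('i::finite \<Rightarrow> 'i \<Rightarrow> bool) \<Rightarrow> complex^'i \<Rightarrow> complex^'i \<Rightarrow> complex"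
  where "geom_form adj u v =
    (\<Sum>i\<in>UNIV. \<Sum>j\<in>UNIV.
       u $ i * complex_of_real (- cos (pi / real (coxeter_matrix adj i j))) * v $ j)"

definition simple_reflection :: "('i::finite \<Rightarrow> 'i \<Rightarrow> bool) \<Rightarrow> 'i \<Rightarrow> complex^'i^'i"
  where "simple_reflection adj i =
    matrix (\<lambda>v. v - (2 * geom_form adj (axis i 1) v) *s axis i 1)"

definition GL :: "(complex^'i::finite^'i) monoid"
  where "GL = \<lparr>carrier = {A. invertible A}, mult = (**), one = mat 1\<rparr>"

definition coxeter_group :: "('i::finite \<Rightarrow> 'i \<Rightarrow> bool) \<Rightarrow> (complex^'i^'i) set"
  where "coxeter_group adj = generate GL (range (simple_reflection adj))"

definition fixed_space :: "complex^'i::finite^'i \<Rightarrow> (complex^'i) set"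
  where "fixed_space w = {v. w *v v = v}"

definition reflections :: "('i::finite \<Rightarrow> 'i \<Rightarrow> bool) \<Rightarrow> (complex^'i^'i) set"
  where "reflections adj =
    {s \<in> coxeter_group adj. vec.dim (fixed_space s) = CARD('i) - 1}"

text \<open>The set usually written \<open>R(s,t)\<close>.\<close>

definition transporters ::
    "('i::finite \<Rightarrow> 'i \<Rightarrow> bool) \<Rightarrow> complex^'i^'i \<Rightarrow> complex^'i^'i \<Rightarrow> (complex^'i^'i) set"
  where "transporters adj s t = {r \<in> reflections adj. r ** t ** r = s}"

definition reflections_containing ::
    "('i::finite \<Rightarrow> 'i \<Rightarrow> bool) \<Rightarrow> (complex^'i) set \<Rightarrow> (complex^'i^'i) set"
  where "reflections_containing adj L = {r \<in> reflections adj. L \<subseteq> fixed_space r}"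

section \<open>The two algebras\<close>

datatype 'a brauer_gen = GenS 'a | GenE 'a

abbreviation s_gen :: "'a \<Rightarrow> 'a brauer_gen nc_poly" where "s_gen x \<equiv> gen (GenS x)"
abbreviation e_gen :: "'a \<Rightarrow> 'a brauer_gen nc_poly" where "e_gen x \<equiv> gen (GenE x)"

inductive_set cgw_relations ::
    "('i \<Rightarrow> 'i \<Rightarrow> bool) \<Rightarrow> complex \<Rightarrow> ('i brauer_gen nc_poly \<times> 'i brauer_gen nc_poly) set"
  for adj :: "'i \<Rightarrow> 'i \<Rightarrow> bool" and \<tau> :: complex
where
  "(s_gen i * s_gen i, 1) \<in> cgw_relations adj \<tau>"
| "adj i j \<Longrightarrow>
    (s_gen i * s_gen j * s_gen i, s_gen j * s_gen i * s_gen j) \<in> cgw_relations adj \<tau>"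
| "i \<noteq> j \<Longrightarrow> \<not> adj i j \<Longrightarrow> (s_gen i * s_gen j, s_gen j * s_gen i) \<in> cgw_relations adj \<tau>"
| "(s_gen i * e_gen i, e_gen i) \<in> cgw_relations adj \<tau>"
| "(e_gen i * s_gen i, e_gen i) \<in> cgw_relations adj \<tau>"
| "(e_gen i * e_gen i, scal \<tau> * e_gen i) \<in> cgw_relations adj \<tau>"
| "adj i j \<Longrightarrow>
    (s_gen i * s_gen j * e_gen i, e_gen j * s_gen i * s_gen j) \<in> cgw_relations adj \<tau>"
| "adj i j \<Longrightarrow> (e_gen i * s_gen j * e_gen i, e_gen i) \<in> cgw_relations adj \<tau>"
| "i \<noteq> j \<Longrightarrow> \<not> adj i j \<Longrightarrow> (s_gen i * e_gen j, e_gen j * s_gen i) \<in> cgw_relations adj \<tau>"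
| "i \<noteq> j \<Longrightarrow> \<not> adj i j \<Longrightarrow> (e_gen i * e_gen j, e_gen j * e_gen i) \<in> cgw_relations adj \<tau>"

definition cgw_brauer_algebra ::
    "('i \<Rightarrow> 'i \<Rightarrow> bool) \<Rightarrow> complex \<Rightarrow> (complex, 'i brauer_gen nc_poly set) module"
  where "cgw_brauer_algebra adj \<tau> = presented_algebra UNIV (cgw_relations adj \<tau>)"

inductive_set group_brauer_relations ::
    "('i::finite \<Rightarrow> 'i \<Rightarrow> bool) \<Rightarrow> (complex^'i^'i \<Rightarrow> complex) \<Rightarrow> (complex^'i^'i \<Rightarrow> complex) \<Rightarrow>
      ((complex^'i^'i) brauer_gen nc_poly \<times> (complex^'i^'i) brauer_gen nc_poly) set"
  for adj :: "'i \<Rightarrow> 'i \<Rightarrow> bool" and \<mu> \<tau> :: "complex^'i^'i \<Rightarrow> complex"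
where
  "w1 \<in> coxeter_group adj \<Longrightarrow> w2 \<in> coxeter_group adj \<Longrightarrow> w3 \<in> coxeter_group adj \<Longrightarrow>
    w1 ** w2 = w3 \<Longrightarrow> (s_gen w1 * s_gen w2, s_gen w3) \<in> group_brauer_relations adj \<mu> \<tau>"
| "(s_gen (mat 1), 1) \<in> group_brauer_relations adj \<mu> \<tau>"
| "s \<in> reflections adj \<Longrightarrow> (s_gen s * e_gen s, e_gen s) \<in> group_brauer_relations adj \<mu> \<tau>"
| "s \<in> reflections adj \<Longrightarrow> (e_gen s * s_gen s, e_gen s) \<in> group_brauer_relations adj \<mu> \<tau>"
| "s \<in> reflections adj \<Longrightarrow>
    (e_gen s * e_gen s, scal (\<tau> s) * e_gen s) \<in> group_brauer_relations adj \<mu> \<tau>"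
| "w \<in> coxeter_group adj \<Longrightarrow> s \<in> reflections adj \<Longrightarrow> t \<in> reflections adj \<Longrightarrow>
    w ** t ** matrix_inv w = s \<Longrightarrow>
    (s_gen w * e_gen t, e_gen s * s_gen w) \<in> group_brauer_relations adj \<mu> \<tau>"
| "s \<in> reflections adj \<Longrightarrow> t \<in> reflections adj \<Longrightarrow> s \<noteq> t \<Longrightarrow>
    reflections_containing adj (fixed_space s \<inter> fixed_space t) = {s, t} \<Longrightarrow>
    (e_gen s * e_gen t, e_gen t * e_gen s) \<in> group_brauer_relations adj \<mu> \<tau>"
| "s \<in> reflections adj \<Longrightarrow> t \<in> reflections adj \<Longrightarrow> s \<noteq> t \<Longrightarrow>
    reflections_containing adj (fixed_space s \<inter> fixed_space t) \<noteq> {s, t} \<Longrightarrow>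
    transporters adj s t \<noteq> {} \<Longrightarrow>
    (e_gen s * e_gen t, (\<Sum>r\<in>transporters adj s t. scal (\<mu> r) * s_gen r) * e_gen t)
      \<in> group_brauer_relations adj \<mu> \<tau>"
| "s \<in> reflections adj \<Longrightarrow> t \<in> reflections adj \<Longrightarrow> s \<noteq> t \<Longrightarrow>
    reflections_containing adj (fixed_space s \<inter> fixed_space t) \<noteq> {s, t} \<Longrightarrow>
    transporters adj s t = {} \<Longrightarrow>
    (e_gen s * e_gen t, 0) \<in> group_brauer_relations adj \<mu> \<tau>"

definition group_brauer_algebra ::
    "('i::finite \<Rightarrow> 'i \<Rightarrow> bool) \<Rightarrow> (complex^'i^'i \<Rightarrow> complex) \<Rightarrow> (complex^'i^'i \<Rightarrow> complex) \<Rightarrow>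
      (complex, (complex^'i^'i) brauer_gen nc_poly set) module"
  where "group_brauer_algebra adj \<mu> \<tau> =
    presented_algebra (GenS ` coxeter_group adj \<union> GenE ` reflections adj)
      (group_brauer_relations adj \<mu> \<tau>)"

text \<open>Parameters are attached to conjugacy classes of reflections.\<close>

definition class_function :: "('i::finite \<Rightarrow> 'i \<Rightarrow> bool) \<Rightarrow> (complex^'i^'i \<Rightarrow> complex) \<Rightarrow> bool"
  where "class_function adj f \<longleftrightarrow>
    (\<forall>s\<in>reflections adj. \<forall>t\<in>reflections adj. \<forall>w\<in>coxeter_group adj.
       w ** t ** matrix_inv w = s \<longrightarrow> f s = f t)"

end

theory Submission
  imports Defs
begin

text \<open>The Weyl group acts on the root lattice, and its roots are the lattice vectors of square length
  \<open>2\<close>. In any algebra satisfying the relations of \<open>B\<^sub>\<Gamma>(\<tau>)\<close>, a word \<open>u\<close> in the simple reflections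
  with \<open>u \<alpha>\<^sub>i = \<alpha>\<^sub>j\<close> satisfies \<open>u s\<^sub>i = s\<^sub>j u\<close> and \<open>u e\<^sub>i = e\<^sub>j u\<close>; this is proved by induction on the length
  of \<open>u\<close>, simultaneously with an exchange property. Exchange shows that words acting trivially are
  trivial in the algebra, so the Weyl group maps to the algebra and \<open>e\<^sub>\<beta> = u e\<^sub>i u\<^sup>-\<^sup>1\<close> is well defined for
  \<open>\<beta> = u \<alpha>\<^sub>i\<close>. Two distinct reflections have a third one through the intersection of their
  hyperplanes iff their roots are not orthogonal, and then exactly one reflection swaps them up to
  sign. Induction on heights gives \<open>e\<^sub>\<beta> e\<^sub>\<gamma> = e\<^sub>\<gamma> e\<^sub>\<beta>\<close> for orthogonal roots, and \<open>e\<^sub>\<beta> s\<^sub>\<gamma> e\<^sub>\<beta> = e\<^sub>\<beta>\<close> for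
  non-orthogonal roots \<open>\<beta> \<noteq> \<plusminus>\<gamma>\<close>, from which relation (5) follows.\<close>

section \<open>Homomorphisms of presented algebras\<close>

text \<open>Elements of the quotient algebras are cosets, and computing with them directly would
  burden each step with carrier conditions. They are replaced by their left multiplications, plain
  functions on a type; applying these to the class of 1 recovers the congruence, because the regular
  representation is faithful. This abstraction also lets one exchange lemma serve both the lattice
  and the algebra, with the sign of the root \<open>act u (\<alpha> i)\<close> standing in for the
  length function of the group. The lattice is taken over the integers because signs of
  coefficients, heights and parity have no meaning in the complex representation; a matrix is
  determined by its action on the lattice. Dynkin type enters through positive definiteness, which
  bounds the inner product of two roots that are neither equal nor opposite by 1 in absolute value,
  and through connectedness, which makes all reflections conjugate. A reflection of the group is
  defined by the dimension of its fixed space, so it has to be shown that each of them comes from a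
  root.\<close>

lemma nc_poly_eq_sum_single:
  "p = (\<Sum>w\<in>Poly_Mapping.keys p. Poly_Mapping.single w (Poly_Mapping.lookup p w))"
  by (rule poly_mapping_eqI)
    (auto simp: lookup_sum lookup_single when_def in_keys_iff sum.delta' sum.delta)

lemma nc_poly_induct [case_names single add]:
  assumes "\<And>w c. P (Poly_Mapping.single w c)" and "\<And>p q. P p \<Longrightarrow> P q \<Longrightarrow> P (p + q)"
  shows "P (p :: 'g nc_poly)"
proof -
  have "P (\<Sum>w\<in>A. Poly_Mapping.single w (Poly_Mapping.lookup p w))" if "finite A" for A
    using that
  proof induction
    case empty
    then show ?case using assms(1)[of "[]" 0] by simp
  qed (simp add: assms)
  then show ?thesis
    by (subst nc_poly_eq_sum_single) simp
qed

lemma single_eq_scal_mult: "Poly_Mapping.single w c = scal c * Poly_Mapping.single w 1"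
  by (simp add: scal_def mult_single plus_list_def)

lemma single_eq_prod_list_gen: "Poly_Mapping.single w 1 = prod_list (map gen w)"
proof (induction w)
  case Nil
  then show ?case by (metis list.simps(8) prod_list.Nil single_one zero_list_def)
next
  case (Cons x w)
  have "Poly_Mapping.single (x # w) 1 = gen x * Poly_Mapping.single w 1"
    by (simp add: gen_def mult_single plus_list_def)
  then show ?case by (simp add: Cons)
qed

lemma scal_add: "scal (a + b) = scal a + scal b"
  by (simp add: scal_def single_add)

lemma scal_mult: "scal (a * b) = scal a * scal b"
  by (simp add: scal_def mult_single plus_list_def)

lemma scal_0 [simp]: "scal 0 = 0"
  by (simp add: scal_def)

lemma scal_1 [simp]: "scal 1 = 1"
  by (simp add: scal_def flip: zero_list_def)

lemma scal_comm: "scal c * p = p * scal c"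
  by (induction p rule: nc_poly_induct)
    (simp_all add: scal_def mult_single plus_list_def algebra_simps)

section \<open>Substitution homomorphisms of free algebras\<close>

definition subst :: "('g \<Rightarrow> 'h nc_poly) \<Rightarrow> 'g nc_poly \<Rightarrow> 'h nc_poly" where
  "subst f p = (\<Sum>w\<in>Poly_Mapping.keys p. scal (Poly_Mapping.lookup p w) * prod_list (map f w))"

lemma subst_eq_sum:
  assumes "finite A" "Poly_Mapping.keys p \<subseteq> A"
  shows "subst f p = (\<Sum>w\<in>A. scal (Poly_Mapping.lookup p w) * prod_list (map f w))"
  unfolding subst_def using assms by (intro sum.mono_neutral_left) (auto simp: in_keys_iff)

lemma subst_single: "subst f (Poly_Mapping.single w c) = scal c * prod_list (map f w)"
  by (simp add: subst_eq_sum[of "{w}"])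

lemma subst_add: "subst f (p + q) = subst f p + subst f q"
proof -
  let ?A = "Poly_Mapping.keys p \<union> Poly_Mapping.keys q"
  have "Poly_Mapping.keys (p + q) \<subseteq> ?A"
    by (rule Poly_Mapping.keys_add)
  then show ?thesis
    by (simp add: subst_eq_sum[of ?A] lookup_add scal_add distrib_right sum.distrib)
qed

lemma subst_0 [simp]: "subst f 0 = 0"
  by (simp add: subst_def)

lemma subst_uminus: "subst f (- p) = - subst f p"
  using subst_add[of f p "- p"] by (simp add: add_eq_0_iff)

lemma subst_diff: "subst f (p - q) = subst f p - subst f q"
  using subst_add[of f p "- q"] by (simp add: subst_uminus)

lemma subst_gen [simp]: "subst f (gen x) = f x"
  by (simp add: gen_def subst_single)

lemma subst_scal [simp]: "subst f (scal c) = scal c"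
  by (simp add: scal_def[of c] subst_single)

lemma subst_1 [simp]: "subst f 1 = 1"
  using subst_scal[of f 1] by simp

lemma subst_mult: "subst f (p * q) = subst f p * subst f q"
proof (induction p rule: nc_poly_induct)
  case (single w c)
  show ?case
  proof (induction q rule: nc_poly_induct)
    case (single v d)
    have "prod_list (map f w) * (scal d * x) = scal d * (prod_list (map f w) * x)" for x
      by (metis mult.assoc scal_comm)
    then show ?case
      by (simp add: mult_single subst_single plus_list_def scal_mult mult.assoc)
  qed (simp add: subst_add distrib_left)
qed (simp add: subst_add distrib_right)

lemma subst_sum: "subst f (sum g A) = (\<Sum>a\<in>A. subst f (g a))"
  by (induction A rule: infinite_finite_induct) (simp_all add: subst_add)

definition nc_span :: "'g set \<Rightarrow> 'g nc_poly set" where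
  "nc_span X = carrier (free_algebra X)"

lemma mem_nc_span: "p \<in> nc_span X \<longleftrightarrow> (\<forall>w\<in>Poly_Mapping.keys p. set w \<subseteq> X)"
  by (simp add: nc_span_def free_algebra_def)

lemma nc_span_UNIV [simp]: "nc_span UNIV = UNIV"
  by (auto simp: mem_nc_span)

lemma free_algebra_simps [simp]:
  "carrier (free_algebra X) = nc_span X"
  "p \<otimes>\<^bsub>free_algebra X\<^esub> q = p * q"
  "p \<oplus>\<^bsub>free_algebra X\<^esub> q = p + q"
  "\<one>\<^bsub>free_algebra X\<^esub> = 1"
  "\<zero>\<^bsub>free_algebra X\<^esub> = 0"
  "c \<odot>\<^bsub>free_algebra X\<^esub> p = scal c * p"
  by (simp_all add: nc_span_def) (simp_all add: free_algebra_def)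

lemma nc_span_closed:
  "0 \<in> nc_span X" "1 \<in> nc_span X" "scal c \<in> nc_span X"
  "p \<in> nc_span X \<Longrightarrow> q \<in> nc_span X \<Longrightarrow> p + q \<in> nc_span X"
  "p \<in> nc_span X \<Longrightarrow> q \<in> nc_span X \<Longrightarrow> p * q \<in> nc_span X"
  "p \<in> nc_span X \<Longrightarrow> - p \<in> nc_span X"
  "p \<in> nc_span X \<Longrightarrow> q \<in> nc_span X \<Longrightarrow> p - q \<in> nc_span X"
  "x \<in> X \<Longrightarrow> gen x \<in> nc_span X"
proof -
  interpret R: ring "free_algebra X" by (rule ring_free_algebra)
  show "0 \<in> nc_span X" "1 \<in> nc_span X"
    using R.zero_closed R.one_closed by simp_all
  show "scal c \<in> nc_span X"
    by (simp add: mem_nc_span scal_def)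
  show add: "p \<in> nc_span X \<Longrightarrow> q \<in> nc_span X \<Longrightarrow> p + q \<in> nc_span X" for p q
    using R.a_closed[of p q] by simp
  show "p \<in> nc_span X \<Longrightarrow> q \<in> nc_span X \<Longrightarrow> p * q \<in> nc_span X"
    using R.m_closed[of p q] by simp
  show minus: "p \<in> nc_span X \<Longrightarrow> - p \<in> nc_span X" for p
    by (simp add: mem_nc_span)
  show "p \<in> nc_span X \<Longrightarrow> q \<in> nc_span X \<Longrightarrow> p - q \<in> nc_span X"
    using add[of p "- q"] minus[of q] by simp
  show "x \<in> X \<Longrightarrow> gen x \<in> nc_span X"
    by (simp add: mem_nc_span gen_def)
qed

lemma nc_span_sum: "(\<And>a. a \<in> A \<Longrightarrow> g a \<in> nc_span X) \<Longrightarrow> sum g A \<in> nc_span X"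
proof (induction A rule: infinite_finite_induct)
  case (insert a A)
  then show ?case by (simp add: nc_span_closed(4))
qed (simp_all add: nc_span_closed(1))

text \<open>A word is a product of generators, so the carrier is generated by scalars and generators
  under sums and products. Membership in the carrier is available in both inductive cases because
  the congruence is multiplicative only there.\<close>

lemma nc_span_induct [consumes 1, case_names scal gen add mult]:
  assumes "p \<in> nc_span X"
    and scal: "\<And>c. P (scal c)" and gen: "\<And>x. x \<in> X \<Longrightarrow> P (gen x)"
    and add: "\<And>p q. p \<in> nc_span X \<Longrightarrow> q \<in> nc_span X \<Longrightarrow> P p \<Longrightarrow> P q \<Longrightarrow> P (p + q)"
    and mult: "\<And>p q. p \<in> nc_span X \<Longrightarrow> q \<in> nc_span X \<Longrightarrow> P p \<Longrightarrow> P q \<Longrightarrow> P (p * q)"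
  shows "P p"
proof -
  have w: "prod_list (map gen w) \<in> nc_span X \<and> P (prod_list (map gen w))" if "set w \<subseteq> X" for w
    using that
  proof (induction w)
    case Nil
    then show ?case using scal[of 1] by (simp add: nc_span_closed(2))
  next
    case (Cons x w)
    then have *: "gen x \<in> nc_span X" "prod_list (map gen w) \<in> nc_span X" "P (gen x)"
        "P (prod_list (map gen w))"
      by (simp_all add: nc_span_closed(8) gen)
    show ?case using nc_span_closed(5)[OF *(1,2)] mult[OF *] by simp
  qed
  have s: "Poly_Mapping.single w c \<in> nc_span X \<and> P (Poly_Mapping.single w c)" if "set w \<subseteq> X" for w c
    unfolding single_eq_scal_mult[of w c] single_eq_prod_list_gen
    using w[OF that] scal[of c] nc_span_closed(3)[of c X]
      nc_span_closed(5)[of "scal c" X "prod_list (map gen w)"] mult[of "scal c" "prod_list (map gen w)"]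
    by blast
  have sum: "sum g A \<in> nc_span X \<and> P (sum g A)"
    if "finite A" "\<And>a. a \<in> A \<Longrightarrow> g a \<in> nc_span X \<and> P (g a)" for g and A :: "'a list set"
    using that
  proof (induction A)
    case empty
    then show ?case using scal[of 0] by (simp add: nc_span_closed(1))
  next
    case (insert a A)
    then show ?case by (simp add: nc_span_closed(4) add)
  qed
  have "P (\<Sum>w\<in>Poly_Mapping.keys p. Poly_Mapping.single w (Poly_Mapping.lookup p w))"
    using sum[of "Poly_Mapping.keys p"] s \<open>p \<in> nc_span X\<close>[unfolded mem_nc_span] by simp
  then show ?thesis
    by (simp flip: nc_poly_eq_sum_single)
qed

lemma subst_closed:
  assumes "p \<in> nc_span X" "\<And>x. x \<in> X \<Longrightarrow> f x \<in> nc_span Y"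
  shows "subst f p \<in> nc_span Y"
  using assms(1)
proof (induction p rule: nc_span_induct)
  case (scal c)
  show ?case by (simp add: nc_span_closed(3))
next
  case (add p q)
  then show ?case by (simp add: subst_add nc_span_closed(4))
next
  case (mult p q)
  then show ?case by (simp add: subst_mult nc_span_closed(5))
qed (simp add: assms(2))

section \<open>Congruence modulo the ideal of relations\<close>

locale presentation =
  fixes X :: "'g set" and rels :: "('g nc_poly \<times> 'g nc_poly) set"
  assumes rels_closed: "(a, b) \<in> rels \<Longrightarrow> a \<in> nc_span X \<and> b \<in> nc_span X"
begin

definition J :: "'g nc_poly set" where "J = relation_ideal X rels"

sublocale R: ring "free_algebra X"
  by (rule ring_free_algebra)

lemma rels_diff_closed: "{a - b |a b. (a, b) \<in> rels} \<subseteq> carrier (free_algebra X)"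
  using rels_closed by (force simp: nc_span_closed(7))

sublocale I: ideal J "free_algebra X"
  unfolding J_def relation_ideal_def by (rule R.genideal_ideal) (rule rels_diff_closed)

lemma J_rels: "(a, b) \<in> rels \<Longrightarrow> a - b \<in> J"
  unfolding J_def relation_ideal_def
  by (rule subsetD[OF R.genideal_self[OF rels_diff_closed]]) blast

lemma J_minimal: "ideal K (free_algebra X) \<Longrightarrow> (\<And>a b. (a, b) \<in> rels \<Longrightarrow> a - b \<in> K) \<Longrightarrow> J \<subseteq> K"
  unfolding J_def relation_ideal_def by (rule R.genideal_minimal) auto

lemma J_subset: "J \<subseteq> nc_span X"
  using I.a_subset by simp

lemma J_0: "0 \<in> J"
  using I.zero_closed by simp

lemma J_add: "a \<in> J \<Longrightarrow> b \<in> J \<Longrightarrow> a + b \<in> J"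
  using I.a_closed by simp

lemma J_mult_left: "a \<in> J \<Longrightarrow> p \<in> nc_span X \<Longrightarrow> p * a \<in> J"
  using I.I_l_closed by simp

lemma J_mult_right: "a \<in> J \<Longrightarrow> p \<in> nc_span X \<Longrightarrow> a * p \<in> J"
  using I.I_r_closed by simp

lemma J_uminus: "a \<in> J \<Longrightarrow> - a \<in> J"
  using J_mult_left[of a "- 1"] by (simp add: nc_span_closed)

definition eqv :: "'g nc_poly \<Rightarrow> 'g nc_poly \<Rightarrow> bool"  (infix \<open>\<doteq>\<close> 50) where
  "p \<doteq> q \<longleftrightarrow> p - q \<in> J"

lemma eqv_refl [simp]: "p \<doteq> p"
  by (simp add: eqv_def J_0)

lemma eqv_sym: "p \<doteq> q \<Longrightarrow> q \<doteq> p"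
  using J_uminus[of "p - q"] by (simp add: eqv_def)

lemma eqv_trans [trans]: "p \<doteq> q \<Longrightarrow> q \<doteq> r \<Longrightarrow> p \<doteq> r"
  using J_add[of "p - q" "q - r"] by (simp add: eqv_def)

lemma eqv_add: "p \<doteq> p' \<Longrightarrow> q \<doteq> q' \<Longrightarrow> p + q \<doteq> p' + q'"
  using J_add[of "p - p'" "q - q'"] by (simp add: eqv_def algebra_simps)

text \<open>The splitting \<open>p * q - p' * q' = (p - p') * q + p' * (q - q')\<close> decides
  which two of the four factors have to lie in the carrier.\<close>

lemma eqv_mult:
  assumes "p \<doteq> p'" "q \<doteq> q'" "p' \<in> nc_span X" "q \<in> nc_span X"
  shows "p * q \<doteq> p' * q'"
  using J_add[OF J_mult_right[of "p - p'" q] J_mult_left[of "q - q'" p']] assms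
  by (simp add: eqv_def algebra_simps)

lemma eqv_rels: "(a, b) \<in> rels \<Longrightarrow> a \<doteq> b"
  by (simp add: eqv_def J_rels)

definition cls :: "'g nc_poly \<Rightarrow> 'g nc_poly set" where
  "cls p = J +>\<^bsub>free_algebra X\<^esub> p"

lemma mem_cls: "q \<in> cls p \<longleftrightarrow> q \<doteq> p"
  by (force simp: cls_def a_r_coset_def' eqv_def)

lemma cls_eq_iff: "cls p = cls q \<longleftrightarrow> p \<doteq> q"
proof
  assume "cls p = cls q"
  then show "p \<doteq> q" using mem_cls[of p p] by (simp add: mem_cls)
next
  assume "p \<doteq> q"
  then show "cls p = cls q"
    unfolding set_eq_iff mem_cls by (blast intro: eqv_trans eqv_sym)
qed

lemma carrier_presented: "carrier (presented_algebra X rels) = cls ` nc_span X"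
  by (auto simp: presented_algebra_def Let_def ring.defs module.defs FactRing_def
      A_RCOSETS_def' cls_def J_def)

lemma cls_mult:
  "p \<in> nc_span X \<Longrightarrow> q \<in> nc_span X \<Longrightarrow>
    cls p \<otimes>\<^bsub>presented_algebra X rels\<^esub> cls q = cls (p * q)"
  using I.rcoset_mult_add[of p q]
  by (simp add: presented_algebra_def Let_def ring.defs FactRing_def cls_def flip: J_def)

lemma cls_add:
  "p \<in> nc_span X \<Longrightarrow> q \<in> nc_span X \<Longrightarrow>
    cls p \<oplus>\<^bsub>presented_algebra X rels\<^esub> cls q = cls (p + q)"
  using I.a_rcos_sum[of p q]
  by (simp add: presented_algebra_def Let_def ring.defs FactRing_def cls_def flip: J_def)

lemma cls_one: "\<one>\<^bsub>presented_algebra X rels\<^esub> = cls 1"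
  by (simp add: presented_algebra_def Let_def ring.defs FactRing_def cls_def flip: J_def)

text \<open>Scalar multiplication on cosets, and later the induced maps, are unions over all
  representatives. Such a union collapses once every representative contributes the same set; the
  representatives lie in the carrier because the ideal does.\<close>

lemma UN_cls:
  assumes "p \<in> nc_span X" "\<And>a. a \<doteq> p \<Longrightarrow> a \<in> nc_span X \<Longrightarrow> F a = F p"
  shows "(\<Union>a\<in>cls p. F a) = F p"
proof -
  have "F a = F p" if "a \<in> cls p" for a
    using that subsetD[OF J_subset, of "a - p"] assms(1) nc_span_closed(4)[of "a - p" X p]
    by (intro assms(2)) (simp_all add: mem_cls eqv_def)
  then show ?thesis
    using mem_cls[of p p] eqv_refl[of p] by blast
qed

lemma cls_smult:
  assumes "p \<in> nc_span X"
  shows "c \<odot>\<^bsub>presented_algebra X rels\<^esub> cls p = cls (scal c * p)"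
proof -
  have "(\<Union>a\<in>cls p. cls (scal c * a)) = cls (scal c * p)"
    by (rule UN_cls[where F = "\<lambda>a. cls (scal c * a)", OF assms])
      (simp add: cls_eq_iff eqv_mult nc_span_closed(3))
  then show ?thesis
    by (simp add: presented_algebra_def Let_def ring.defs module.defs cls_def flip: J_def)
qed

end

section \<open>Maps between presented algebras\<close>

locale presentation_pair =
  P: presentation X rels + Q: presentation Y rels'
  for X :: "'g set" and rels and Y :: "'h set" and rels'
begin

definition compat :: "('g \<Rightarrow> 'h nc_poly) \<Rightarrow> bool" where
  "compat f \<longleftrightarrow> (\<forall>x\<in>X. f x \<in> nc_span Y) \<and> (\<forall>(a, b)\<in>rels. Q.eqv (subst f a) (subst f b))"

lemma compat_closed: "compat f \<Longrightarrow> p \<in> nc_span X \<Longrightarrow> subst f p \<in> nc_span Y"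
  by (rule subst_closed[where X = X]) (simp_all add: compat_def)

text \<open>The preimage of the target ideal under substitution is an ideal. It contains the
  defining relations, hence the whole ideal that they generate.\<close>

lemma compat_eqv:
  assumes f: "compat f" and "P.eqv p q"
  shows "Q.eqv (subst f p) (subst f q)"
proof -
  let ?K = "{p \<in> nc_span X. subst f p \<in> Q.J}"
  have sub: "subgroup ?K (add_monoid (free_algebra X))"
  proof (rule P.R.add.subgroupI)
    show "?K \<subseteq> carrier (free_algebra X)" by auto
    have "0 \<in> ?K"
      by (simp add: nc_span_closed Q.J_0)
    then show "?K \<noteq> {}" by blast
  next
    fix a assume a: "a \<in> ?K"
    then have "\<ominus>\<^bsub>free_algebra X\<^esub> a = - a"
      using P.R.minus_equality[of "- a" a] by (simp add: nc_span_closed)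
    moreover have "- a \<in> ?K"
      using a by (simp add: subst_uminus nc_span_closed Q.J_uminus)
    ultimately show "\<ominus>\<^bsub>free_algebra X\<^esub> a \<in> ?K"
      by simp
  next
    fix a b assume "a \<in> ?K" "b \<in> ?K"
    then show "a \<oplus>\<^bsub>free_algebra X\<^esub> b \<in> ?K"
      by (simp add: subst_add nc_span_closed Q.J_add)
  qed
  have "ideal ?K (free_algebra X)"
  proof (rule idealI[OF ring_free_algebra sub])
    fix a x assume "a \<in> ?K" "x \<in> carrier (free_algebra X)"
    then show "x \<otimes>\<^bsub>free_algebra X\<^esub> a \<in> ?K" "a \<otimes>\<^bsub>free_algebra X\<^esub> x \<in> ?K"
      using compat_closed[OF f]
      by (simp_all add: subst_mult nc_span_closed Q.J_mult_left Q.J_mult_right)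
  qed
  then have K: "P.J \<subseteq> ?K"
  proof (rule P.J_minimal)
    fix a b assume ab: "(a, b) \<in> rels"
    with f have "Q.eqv (subst f a) (subst f b)"
      by (auto simp: compat_def)
    with P.rels_closed[OF ab] show "a - b \<in> ?K"
      by (simp add: Q.eqv_def subst_diff nc_span_closed)
  qed
  then show ?thesis
    using assms(2) subsetD[OF K, of "p - q"] by (simp add: P.eqv_def Q.eqv_def subst_diff)
qed

text \<open>Taking the union over all representatives avoids choosing one; for compatible
  \<open>f\<close> all the cosets in the union coincide.\<close>

definition induced :: "('g \<Rightarrow> 'h nc_poly) \<Rightarrow> 'g nc_poly set \<Rightarrow> 'h nc_poly set" where
  "induced f A = (\<Union>a\<in>A. Q.cls (subst f a))"

lemma induced_cls:
  assumes "compat f" "p \<in> nc_span X"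
  shows "induced f (P.cls p) = Q.cls (subst f p)"
  unfolding induced_def
  by (rule P.UN_cls[where F = "\<lambda>a. Q.cls (subst f a)", OF assms(2)])
    (simp add: Q.cls_eq_iff compat_eqv[OF assms(1)])

lemma induced_hom:
  assumes "compat f"
  shows "induced f \<in> ring_hom (presented_algebra X rels) (presented_algebra Y rels')"
proof (rule ring_hom_memI)
  fix A B assume "A \<in> carrier (presented_algebra X rels)" "B \<in> carrier (presented_algebra X rels)"
  then obtain p q where *: "p \<in> nc_span X" "q \<in> nc_span X" "A = P.cls p" "B = P.cls q"
    by (auto simp: P.carrier_presented)
  note closed = compat_closed[OF assms *(1)] compat_closed[OF assms *(2)]
  show "induced f (A \<otimes>\<^bsub>presented_algebra X rels\<^esub> B)
      = induced f A \<otimes>\<^bsub>presented_algebra Y rels'\<^esub> induced f B"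
    by (simp add: * closed P.cls_mult Q.cls_mult induced_cls[OF assms] subst_mult nc_span_closed)
  show "induced f (A \<oplus>\<^bsub>presented_algebra X rels\<^esub> B)
      = induced f A \<oplus>\<^bsub>presented_algebra Y rels'\<^esub> induced f B"
    by (simp add: * closed P.cls_add Q.cls_add induced_cls[OF assms] subst_add nc_span_closed)
next
  fix A assume "A \<in> carrier (presented_algebra X rels)"
  then obtain p where *: "p \<in> nc_span X" "A = P.cls p"
    by (auto simp: P.carrier_presented)
  show "induced f A \<in> carrier (presented_algebra Y rels')"
    unfolding *(2) induced_cls[OF assms *(1)] Q.carrier_presented
    using compat_closed[OF assms *(1)] by (rule imageI)
next
  show "induced f \<one>\<^bsub>presented_algebra X rels\<^esub> = \<one>\<^bsub>presented_algebra Y rels'\<^esub>"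
    unfolding P.cls_one Q.cls_one induced_cls[OF assms nc_span_closed(2)] by simp
qed

end

text \<open>A composite of substitutions is determined by its values on generators, so it is the
  identity modulo the relations if it fixes each generator modulo the relations. Closure is carried
  through the induction because products of congruences require it.\<close>

lemma eqv_subst_subst:
  assumes "presentation X rels" "p \<in> nc_span X"
    and "\<And>x. x \<in> X \<Longrightarrow> presentation.eqv X rels (subst g (f x)) (gen x)"
    and "\<And>x. x \<in> X \<Longrightarrow> subst g (f x) \<in> nc_span X"
  shows "presentation.eqv X rels (subst g (subst f p)) p"
proof -
  interpret P: presentation X rels by fact
  have "subst g (subst f p) \<in> nc_span X \<and> P.eqv (subst g (subst f p)) p"
    using assms(2)
  proof (induction p rule: nc_span_induct)
    case (scal c)
    show ?case by (simp add: nc_span_closed(3))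
  next
    case (gen x)
    then show ?case using assms(3,4) by simp
  next
    case (add p q)
    then show ?case
      unfolding subst_add by (blast intro: nc_span_closed(4) P.eqv_add)
  next
    case (mult p q)
    then show ?case
      unfolding subst_mult by (blast intro: nc_span_closed(5) P.eqv_mult)
  qed
  then show ?thesis by blast
qed

lemma presented_algebra_iso:
  assumes "presentation_pair X rels Y rels'"
    and f: "presentation_pair.compat X rels Y rels' f"
    and g: "presentation_pair.compat Y rels' X rels g"
    and gf: "\<And>x. x \<in> X \<Longrightarrow> presentation.eqv X rels (subst g (f x)) (gen x)"
    and fg: "\<And>y. y \<in> Y \<Longrightarrow> presentation.eqv Y rels' (subst f (g y)) (gen y)"
  shows "presented_algebra X rels \<cong>\<^sub>a\<^sub>l\<^sub>g presented_algebra Y rels'"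
proof -
  interpret PQ: presentation_pair X rels Y rels' by fact
  interpret QP: presentation_pair Y rels' X rels ..
  let ?A = "presented_algebra X rels" and ?B = "presented_algebra Y rels'"
  have "bij_betw (PQ.induced f) (carrier ?A) (carrier ?B)"
  proof (rule bij_betw_byWitness[where f' = "QP.induced g"])
    have "PQ.P.eqv (subst g (subst f p)) p" if "p \<in> nc_span X" for p
      by (rule eqv_subst_subst[OF PQ.P.presentation_axioms that gf])
        (use f g in \<open>auto simp: PQ.compat_def QP.compat_def intro: subst_closed\<close>)
    then show "\<forall>a\<in>carrier ?A. QP.induced g (PQ.induced f a) = a"
      by (auto simp: PQ.P.carrier_presented PQ.induced_cls[OF f] QP.induced_cls[OF g]
          PQ.compat_closed[OF f] PQ.P.cls_eq_iff)
    have "PQ.Q.eqv (subst f (subst g q)) q" if "q \<in> nc_span Y" for q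
      by (rule eqv_subst_subst[OF PQ.Q.presentation_axioms that fg])
        (use f g in \<open>auto simp: PQ.compat_def QP.compat_def intro: subst_closed\<close>)
    then show "\<forall>b\<in>carrier ?B. PQ.induced f (QP.induced g b) = b"
      by (auto simp: PQ.Q.carrier_presented PQ.induced_cls[OF f] QP.induced_cls[OF g]
          QP.compat_closed[OF g] PQ.Q.cls_eq_iff)
    show "PQ.induced f ` carrier ?A \<subseteq> carrier ?B" "QP.induced g ` carrier ?B \<subseteq> carrier ?A"
      using PQ.induced_hom[OF f] QP.induced_hom[OF g] by (auto simp: ring_hom_def)
  qed
  then have "PQ.induced f \<in> ring_iso ?A ?B"
    using PQ.induced_hom[OF f] by (simp add: ring_iso_def)
  moreover have "PQ.induced f (c \<odot>\<^bsub>?A\<^esub> x) = c \<odot>\<^bsub>?B\<^esub> PQ.induced f x" if "x \<in> carrier ?A" for c x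
    using that
    by (auto simp: PQ.P.carrier_presented PQ.P.cls_smult PQ.Q.cls_smult PQ.induced_cls[OF f]
        PQ.compat_closed[OF f] subst_mult nc_span_closed)
  ultimately show ?thesis
    unfolding algebra_isomorphic_def by blast
qed

lemma algebra_isomorphic_trans:
  assumes "A \<cong>\<^sub>a\<^sub>l\<^sub>g B" "B \<cong>\<^sub>a\<^sub>l\<^sub>g C"
  shows "A \<cong>\<^sub>a\<^sub>l\<^sub>g C"
proof -
  from assms obtain f g where f: "f \<in> ring_iso A B" "\<forall>c. \<forall>x\<in>carrier A. f (c \<odot>\<^bsub>A\<^esub> x) = c \<odot>\<^bsub>B\<^esub> f x"
    and g: "g \<in> ring_iso B C" "\<forall>c. \<forall>x\<in>carrier B. g (c \<odot>\<^bsub>B\<^esub> x) = c \<odot>\<^bsub>C\<^esub> g x"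
    unfolding algebra_isomorphic_def by blast
  have "g \<circ> f \<in> ring_iso A C"
    using ring_iso_set_trans f(1) g(1) by blast
  moreover have "f x \<in> carrier B" if "x \<in> carrier A" for x
    using ring_iso_memE(1)[OF f(1)] that by blast
  ultimately show ?thesis
    unfolding algebra_isomorphic_def using f(2) g(2) by (intro bexI[of _ "g \<circ> f"]) auto
qed

section \<open>The root system of a positive definite simply-laced diagram\<close>

text \<open>Twice the Gram matrix of \<open>geom_form\<close>: the entries become integers and
  simple roots get square length 2.\<close>

definition cartan :: "('i \<Rightarrow> 'i \<Rightarrow> bool) \<Rightarrow> 'i \<Rightarrow> 'i \<Rightarrow> int" where
  "cartan adj i j = (if i = j then 2 else if adj i j then - 1 else 0)"

definition root_form :: "('i::finite \<Rightarrow> 'i \<Rightarrow> bool) \<Rightarrow> int^'i \<Rightarrow> int^'i \<Rightarrow> int" where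
  "root_form adj u v = (\<Sum>i\<in>UNIV. \<Sum>j\<in>UNIV. u $ i * cartan adj i j * v $ j)"

text \<open>Definiteness is stated on the integer lattice, where the form takes even values on the
  diagonal, so strict positivity means a value of at least 2.\<close>

locale simply_laced =
  fixes adj :: "'i::finite \<Rightarrow> 'i \<Rightarrow> bool"
  assumes adj_sym: "adj i j \<Longrightarrow> adj j i"
    and adj_irrefl: "\<not> adj i i"
    and form_pos: "v \<noteq> 0 \<Longrightarrow> root_form adj v v > 0"
begin

abbreviation B :: "int^'i \<Rightarrow> int^'i \<Rightarrow> int" where "B \<equiv> root_form adj"

abbreviation simple :: "'i \<Rightarrow> int^'i"  (\<open>\<alpha>\<close>) where "\<alpha> i \<equiv> axis i 1"

lemma cartan_sym: "cartan adj i j = cartan adj j i"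
  using adj_sym by (auto simp: cartan_def)

lemma B_sym: "B u v = B v u"
  unfolding root_form_def
  by (subst sum.swap) (simp add: cartan_sym mult.commute mult.left_commute)

lemma B_add_left: "B (u + v) w = B u w + B v w"
  by (simp add: root_form_def algebra_simps sum.distrib)

lemma B_smult_left: "B (c *s u) v = c * B u v"
  by (simp add: root_form_def algebra_simps sum_distrib_left)

lemma B_uminus_left: "B (- u) v = - B u v"
  by (simp add: root_form_def sum_negf)

lemma B_diff_left: "B (u - v) w = B u w - B v w"
  using B_add_left[of u "- v" w] by (simp add: B_uminus_left)

lemma B_add_right: "B w (u + v) = B w u + B w v"
  by (simp add: B_sym[of w] B_add_left)

lemma B_smult_right: "B v (c *s u) = c * B v u"
  by (simp add: B_sym[of v] B_smult_left)

lemma B_uminus_right: "B v (- u) = - B v u"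
  by (simp add: B_sym[of v] B_uminus_left)

lemma B_diff_right: "B w (u - v) = B w u - B w v"
  by (simp add: B_sym[of w] B_diff_left)

lemmas B_linear = B_add_left B_smult_left B_uminus_left B_diff_left
  B_add_right B_smult_right B_uminus_right B_diff_right

lemma B_0 [simp]: "B 0 v = 0" "B v 0 = 0"
  by (simp_all add: root_form_def)

lemma B_simple_left: "B (\<alpha> i) v = (\<Sum>j\<in>UNIV. cartan adj i j * v $ j)"
proof -
  have "(\<Sum>j\<in>UNIV. \<alpha> i $ k * cartan adj k j * v $ j)
      = (if k = i then \<Sum>j\<in>UNIV. cartan adj i j * v $ j else 0)" for k
    by (simp add: axis_def)
  then show ?thesis by (simp add: root_form_def)
qed

lemma B_simple: "B (\<alpha> i) (\<alpha> j) = cartan adj i j"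
  unfolding B_simple_left by (simp add: axis_def if_distrib[of "\<lambda>x. _ * x"] cong: if_cong)

lemma B_expand: "B u v = (\<Sum>i\<in>UNIV. u $ i * B (\<alpha> i) v)"
  unfolding B_simple_left by (simp add: root_form_def sum_distrib_left mult.assoc)

text \<open>Building \<open>v\<close> up one simple root at a time, each new multiple contributes
  twice its squared coefficient and twice a cross term.\<close>

lemma B_even: "even (B v v)"
proof -
  have "even (B (\<Sum>i\<in>A. (v $ i) *s \<alpha> i) (\<Sum>i\<in>A. (v $ i) *s \<alpha> i))" for A
  proof (induction A rule: infinite_finite_induct)
    case (insert a A)
    let ?s = "\<Sum>i\<in>A. (v $ i) *s \<alpha> i"
    have "B ((v $ a) *s \<alpha> a + ?s) ((v $ a) *s \<alpha> a + ?s)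
        = 2 * (v $ a * v $ a + v $ a * B (\<alpha> a) ?s) + B ?s ?s"
      by (simp add: B_linear B_simple cartan_def B_sym[of ?s "\<alpha> a"] algebra_simps)
    with insert show ?case by simp
  qed simp_all
  from this[of UNIV] show ?thesis by (simp add: basis_expansion)
qed

definition root :: "int^'i \<Rightarrow> bool" where "root b \<longleftrightarrow> B b b = 2"

lemma root_simple [simp]: "root (\<alpha> i)"
  by (simp add: root_def B_simple cartan_def)

lemma root_uminus [simp]: "root (- b) \<longleftrightarrow> root b"
  by (simp add: root_def B_linear)

lemma root_nonzero: "root b \<Longrightarrow> b \<noteq> 0"
  by (auto simp: root_def)

text \<open>An integral Cauchy-Schwarz inequality: positivity of the form on \<open>c - b\<close>
  and on \<open>c + b\<close> gives \<open>\<bar>B b c\<bar> < 2\<close> unless one of these vectors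
  vanishes.\<close>

lemma root_cases_form:
  assumes "root b" "root c"
  obtains "c = b" | "c = - b" | "B b c = 0" | "B b c = 1" | "B b c = - 1"
proof -
  have "c = b \<or> B (c - b) (c - b) > 0" "c = - b \<or> B (c + b) (c + b) > 0"
    using form_pos[of "c - b"] form_pos[of "c + b"] by (auto simp: eq_neg_iff_add_eq_0)
  then have "c = b \<or> c = - b \<or> \<bar>B b c\<bar> < 2"
    using assms by (auto simp: root_def B_linear B_sym[of c b])
  moreover have "x = 0 \<or> x = 1 \<or> x = - 1" if "\<bar>x\<bar> < 2" for x :: int
    using that by arith
  ultimately show ?thesis using that by blast
qed

definition nonneg :: "int^'i \<Rightarrow> bool" where "nonneg v \<longleftrightarrow> (\<forall>i. 0 \<le> v $ i)"

lemma nonneg_simple [simp]: "nonneg (\<alpha> i)"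
  by (simp add: nonneg_def axis_def)

text \<open>The positive and negative parts of a root have nonpositive inner product, and each
  nonzero part has even, hence at least \<open>2\<close>, square length.\<close>

lemma root_sign:
  assumes "root b"
  shows "nonneg b \<or> nonneg (- b)"
proof -
  define p q where "p = (\<chi> i. max (b $ i) 0)" and "q = (\<chi> i. max (- b $ i) 0)"
  have b: "b = p - q"
    by (auto simp: p_def q_def vec_eq_iff)
  have "p $ i * cartan adj i j * q $ j \<le> 0" for i j
  proof (cases "i = j")
    case True
    then show ?thesis by (simp add: p_def q_def max_def)
  next
    case False
    then have "cartan adj i j \<le> 0" "p $ i * q $ j \<ge> 0"
      by (simp_all add: cartan_def p_def q_def)
    then show ?thesis
      using mult_nonneg_nonpos[of "p $ i * q $ j" "cartan adj i j"] by (simp add: ac_simps)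
  qed
  then have "B p q \<le> 0"
    unfolding root_form_def by (intro sum_nonpos) auto
  have "B b b = B p p - 2 * B p q + B q q"
    by (simp add: b B_linear B_sym[of q p])
  with \<open>B p q \<le> 0\<close> assms have "B p p + B q q \<le> 2"
    by (simp add: root_def)
  moreover have ge: "B v v \<ge> 2" if "v \<noteq> 0" for v
    using form_pos[OF that] B_even[of v] by presburger
  ultimately have "p = 0 \<or> q = 0"
    using ge[of p] ge[of q] by linarith
  moreover have "nonneg p" "nonneg q"
    by (simp_all add: nonneg_def p_def q_def)
  ultimately show ?thesis
    using b by auto
qed

lemma nonneg_root_not_uminus:
  assumes "root b" "nonneg b"
  shows "\<not> nonneg (- b)"
proof
  assume "nonneg (- b)"
  with assms have "b = 0"
    by (simp add: nonneg_def vec_eq_iff order_antisym)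
  with assms show False
    using root_nonzero by blast
qed

section \<open>Reflections of the lattice and heights of roots\<close>

definition refl :: "int^'i \<Rightarrow> int^'i \<Rightarrow> int^'i" where "refl b v = v - B b v *s b"

lemma refl_linear:
  "refl b (u + v) = refl b u + refl b v" "refl b (c *s v) = c *s refl b v"
  "refl b (- v) = - refl b v" "refl b (u - v) = refl b u - refl b v"
  by (simp_all add: refl_def B_linear vec_eq_iff algebra_simps)

lemma refl_uminus: "refl (- b) = refl b"
  by (simp add: refl_def B_linear fun_eq_iff vec_eq_iff)

lemma refl_self: "root b \<Longrightarrow> refl b b = - b"
  by (simp add: refl_def root_def vec_eq_iff)

lemma refl_orth: "B b v = 0 \<Longrightarrow> refl b v = v"
  by (simp add: refl_def vec_eq_iff)

lemma refl_refl: "root b \<Longrightarrow> refl b (refl b v) = v"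
  by (simp add: refl_def root_def B_linear vec_eq_iff algebra_simps)

lemma B_refl: "root b \<Longrightarrow> B (refl b u) (refl b v) = B u v"
  by (simp add: refl_def root_def B_linear B_sym[of u b] algebra_simps)

lemma root_refl [simp]: "root b \<Longrightarrow> root (refl b c) \<longleftrightarrow> root c"
  by (simp add: root_def[of "refl b c"] B_refl root_def[of c])

lemma refl_simple_nth: "j \<noteq> i \<Longrightarrow> refl (\<alpha> i) v $ j = v $ j"
  by (simp add: refl_def axis_def)

text \<open>A positive root other than \<open>\<alpha> i\<close> has a positive coefficient at some
  other node, since a multiple of \<open>\<alpha> i\<close> of square length 2 is
  \<open>\<alpha> i\<close> up to sign. The reflection leaves that coefficient alone, so the image
  cannot be a negative root.\<close>

lemma simple_reflection_nonneg:
  assumes "root b" "nonneg b" "b \<noteq> \<alpha> i"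
  shows "nonneg (refl (\<alpha> i) b)"
proof -
  have "\<exists>j. j \<noteq> i \<and> b $ j \<noteq> 0"
  proof (rule ccontr)
    assume "\<not> ?thesis"
    then have b: "b = (b $ i) *s \<alpha> i"
      by (auto simp: vec_eq_iff axis_def)
    then have "B b b = 2 * (b $ i)\<^sup>2"
      by (metis B_simple B_smult_left B_smult_right cartan_def mult.commute mult.left_commute
          power2_eq_square)
    with assms(1) have "(b $ i)\<^sup>2 = 1"
      by (simp add: root_def)
    with assms(2) have "b $ i = 1"
      by (auto simp: nonneg_def power2_eq_1_iff dest: spec[of _ i])
    with b assms(3) show False
      by (auto simp: vec_eq_iff)
  qed
  then obtain j where j: "j \<noteq> i" "b $ j \<noteq> 0" by blast
  then have "refl (\<alpha> i) b $ j > 0"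
    using assms(2) by (auto simp: refl_simple_nth nonneg_def order.not_eq_order_implies_strict)
  then have "\<not> nonneg (- refl (\<alpha> i) b)"
    by (auto simp: nonneg_def not_le intro!: exI[of _ j])
  then show ?thesis
    using root_sign[of "refl (\<alpha> i) b"] assms(1) by simp
qed

text \<open>Expanding \<open>B b b = 2\<close> in the coefficients of \<open>b\<close> produces a
  term with \<open>B (\<alpha> k) b > 0\<close>. As \<open>b\<close> is neither
  \<open>\<alpha> k\<close> nor its negative, the value must be 1.\<close>

lemma root_descent:
  assumes "root b" "nonneg b" "\<forall>i. b \<noteq> \<alpha> i"
  obtains k where "B (\<alpha> k) b = 1"
proof -
  have "(\<Sum>i\<in>UNIV. b $ i * B (\<alpha> i) b) > 0"
    using assms(1) B_expand[of b b] by (simp add: root_def)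
  then obtain k where "b $ k * B (\<alpha> k) b > 0"
    by (meson not_less sum_nonpos)
  then have k: "B (\<alpha> k) b > 0"
    using assms(2)[unfolded nonneg_def, rule_format, of k] by (simp add: zero_less_mult_iff)
  have "b \<noteq> - \<alpha> k"
    using assms nonneg_root_not_uminus[of b] by auto
  with k assms(3) show thesis
    using that[of k] root_cases_form[of "\<alpha> k" b] assms(1) by auto
qed

definition height :: "int^'i \<Rightarrow> int" where "height v = (\<Sum>i\<in>UNIV. v $ i)"

lemma height_diff_simple: "height (v - \<alpha> k) = height v - 1"
  by (simp add: height_def sum_subtractf axis_def)

lemma height_nonneg: "nonneg v \<Longrightarrow> height v \<ge> 0"
  by (simp add: height_def nonneg_def sum_nonneg)

text \<open>The step behind all inductions on height: here subtracting \<open>\<alpha> k\<close> is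
  the same as reflecting in it, so the result is again a positive root, one lower in height.\<close>

lemma diff_simple_root:
  assumes "root b" "nonneg b" "B (\<alpha> k) b = 1"
  shows "root (b - \<alpha> k)" "nonneg (b - \<alpha> k)" "refl (\<alpha> k) b = b - \<alpha> k" "refl (\<alpha> k) (b - \<alpha> k) = b"
    "nat (height (b - \<alpha> k)) < nat (height b)"
proof -
  have ne: "b \<noteq> \<alpha> k"
    using assms(3) by (auto simp: B_simple cartan_def)
  show r: "refl (\<alpha> k) b = b - \<alpha> k"
    using assms(3) by (simp add: refl_def vec_eq_iff)
  show "root (b - \<alpha> k)" "nonneg (b - \<alpha> k)" "refl (\<alpha> k) (b - \<alpha> k) = b"
    using assms simple_reflection_nonneg[OF assms(1,2) ne] refl_refl[of "\<alpha> k" b]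
      root_refl[of "\<alpha> k" b] r by simp_all
  then show "nat (height (b - \<alpha> k)) < nat (height b)"
    using height_nonneg[of "b - \<alpha> k"] by (simp add: height_diff_simple)
qed

section \<open>Words in the simple reflections and the exchange property\<close>

definition act :: "'i list \<Rightarrow> int^'i \<Rightarrow> int^'i" where "act u v = foldr (\<lambda>i. refl (\<alpha> i)) u v"

lemma act_simps [simp]:
  "act [] v = v" "act (i # u) v = refl (\<alpha> i) (act u v)" "act (u @ w) v = act u (act w v)"
  by (simp_all add: act_def)

lemma act_linear:
  "act u (v + w) = act u v + act u w" "act u (c *s v) = c *s act u v"
  "act u (- v) = - act u v" "act u (v - w) = act u v - act u w"
  by (induction u) (simp_all add: refl_linear)

lemma act_rev [simp]: "act (rev u) (act u v) = v" "act u (act (rev u) v) = v"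
proof -
  show *: "act (rev u) (act u v) = v" for u
    by (induction u) (simp_all add: refl_refl)
  show "act u (act (rev u) v) = v"
    using *[of "rev u"] by simp
qed

lemma B_act [simp]: "B (act u v) (act u w) = B v w"
  by (induction u) (simp_all add: B_refl)

lemma root_act [simp]: "root (act u b) \<longleftrightarrow> root b"
  by (simp add: root_def)

lemma act_refl: "act u (refl b v) = refl (act u b) (act u v)"
  by (simp add: refl_def act_linear)

text \<open>Simple roots are peeled off a positive root until a simple root remains. For a negative
  root the word of its opposite is extended by one letter, which turns the simple root into its
  negative.\<close>

lemma root_exists_word:
  assumes "root b"
  obtains u i where "act u (\<alpha> i) = b"
proof -
  have pos: "\<exists>u i. act u (\<alpha> i) = b" if "root b" "nonneg b" for b
    using that
  proof (induction "nat (height b)" arbitrary: b rule: less_induct)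
    case less
    show ?case
    proof (cases "\<exists>i. b = \<alpha> i")
      case True
      then show ?thesis by (metis act_simps(1))
    next
      case False
      then obtain k where k: "B (\<alpha> k) b = 1"
        using root_descent less.prems by blast
      note d = diff_simple_root[OF less.prems k]
      from less.hyps[OF d(5,1,2)] obtain u i where "act u (\<alpha> i) = b - \<alpha> k"
        by blast
      then have "act (k # u) (\<alpha> i) = b"
        using d(4) by simp
      then show ?thesis by blast
    qed
  qed
  show thesis
  proof (cases "nonneg b")
    case True
    then show ?thesis using pos assms that by blast
  next
    case False
    then have "nonneg (- b)" using root_sign assms by blast
    then obtain u i where "act u (\<alpha> i) = - b" using pos[of "- b"] assms by auto
    then have "act (u @ [i]) (\<alpha> i) = b"
      by (simp add: refl_self act_linear)
    then show ?thesis using that by blast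
  qed
qed

text \<open>Read \<open>u\<close> from the right: the image of \<open>\<alpha> i\<close> starts
  positive and ends negative. At the letter \<open>j\<close> where the sign changes, the image must
  be \<open>\<alpha> j\<close> itself; there \<open>conj\<close> turns \<open>S i\<close> into
  \<open>S j\<close>, which cancels the letter. The hypothesis \<open>conj\<close> is restricted to
  words shorter than \<open>u\<close> so that the lemma can be applied inside an induction that is
  still establishing \<open>conj\<close>.\<close>

lemma exchange_operators:
  fixes S :: "'i \<Rightarrow> 'b \<Rightarrow> 'b"
  assumes inv: "\<And>i x. S i (S i x) = x"
    and conj: "\<And>q j x. length q < length u \<Longrightarrow> act q (\<alpha> i) = \<alpha> j \<Longrightarrow>
      foldr S q (S i x) = S j (foldr S q x)"
    and "nonneg (- act u (\<alpha> i))"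
  obtains u' where "length u = Suc (length u')"
    "\<And>v. act u' v = act u (refl (\<alpha> i) v)" "\<And>x. foldr S u' x = foldr S u (S i x)"
proof -
  have "\<exists>u'. length u = Suc (length u') \<and> (\<forall>v. act u' v = act u (refl (\<alpha> i) v))
      \<and> (\<forall>x. foldr S u' x = foldr S u (S i x))"
    using conj assms(3)
  proof (induction u)
    case Nil
    then show ?case
      using nonneg_root_not_uminus[of "\<alpha> i"] by simp
  next
    case (Cons j q)
    show ?case
    proof (cases "nonneg (- act q (\<alpha> i))")
      case True
      with Cons.IH Cons.prems(1) obtain q' where "length q = Suc (length q')"
        "\<forall>v. act q' v = act q (refl (\<alpha> i) v)" "\<forall>x. foldr S q' x = foldr S q (S i x)"
        by (metis length_Cons less_Suc_eq)
      then show ?thesis by (intro exI[of _ "j # q'"]) simp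
    next
      case False
      then have pos: "nonneg (act q (\<alpha> i))"
        using root_sign[of "act q (\<alpha> i)"] by simp
      have "act q (\<alpha> i) = \<alpha> j"
      proof (rule ccontr)
        assume "act q (\<alpha> i) \<noteq> \<alpha> j"
        then have "nonneg (act (j # q) (\<alpha> i))"
          using simple_reflection_nonneg[OF _ pos] by simp
        with Cons.prems(2) show False
          using nonneg_root_not_uminus[of "act (j # q) (\<alpha> i)"] by simp
      qed
      then show ?thesis
        using Cons.prems(1)[of q j]
        by (intro exI[of _ q]) (simp add: inv act_refl[of q] refl_refl)
    qed
  qed
  then show thesis using that by blast
qed

text \<open>With the reflections themselves as operators, \<open>conj\<close> is just the
  equivariance \<open>act_refl\<close>.\<close>

lemma exchange:
  assumes "nonneg (- act u (\<alpha> i))"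
  obtains u' where "length u = Suc (length u')" "\<And>v. act u' v = act u (refl (\<alpha> i) v)"
proof (rule exchange_operators[of "\<lambda>i. refl (\<alpha> i)" u i])
  show "refl (\<alpha> j) (refl (\<alpha> j) x) = x" for j x
    by (simp add: refl_refl)
  show "foldr (\<lambda>i. refl (\<alpha> i)) q (refl (\<alpha> i) x) = refl (\<alpha> j) (foldr (\<lambda>i. refl (\<alpha> i)) q x)"
    if "act q (\<alpha> i) = \<alpha> j" for q j x
    using act_refl[of q "\<alpha> i" x] that by (simp add: act_def)
next
  show "nonneg (- act u (\<alpha> i))" by fact
next
  fix u' assume "length u = Suc (length u')" "\<And>v. act u' v = act u (refl (\<alpha> i) v)"
  then show thesis by (rule that)
qed

end

section \<open>Operators satisfying the Brauer relations\<close>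

text \<open>\<open>T\<close> stands for multiplication by the scalar \<tau>. All identities derived
  below compare monomials, so functions on an arbitrary type are enough and no addition on that type
  is needed.\<close>

locale brauer_operators = simply_laced adj for adj :: "'i::finite \<Rightarrow> 'i \<Rightarrow> bool" +
  fixes S E :: "'i \<Rightarrow> 'b \<Rightarrow> 'b" and T :: "'b \<Rightarrow> 'b"
  assumes S_S [simp]: "S i (S i x) = x"
    and braid: "adj i j \<Longrightarrow> S i (S j (S i x)) = S j (S i (S j x))"
    and S_comm: "i \<noteq> j \<Longrightarrow> \<not> adj i j \<Longrightarrow> S i (S j x) = S j (S i x)"
    and S_E [simp]: "S i (E i x) = E i x"
    and E_S [simp]: "E i (S i x) = E i x"
    and E_E: "E i (E i x) = T (E i x)"
    and S_S_E: "adj i j \<Longrightarrow> S i (S j (E i x)) = E j (S i (S j x))"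
    and E_S_E: "adj i j \<Longrightarrow> E i (S j (E i x)) = E i x"
    and S_E_comm: "i \<noteq> j \<Longrightarrow> \<not> adj i j \<Longrightarrow> S i (E j x) = E j (S i x)"
    and E_E_comm: "i \<noteq> j \<Longrightarrow> \<not> adj i j \<Longrightarrow> E i (E j x) = E j (E i x)"
    and T_S: "T (S i x) = S i (T x)"
begin

section \<open>Words of operators depend only on the lattice action\<close>

definition F :: "'i list \<Rightarrow> 'b \<Rightarrow> 'b" where "F u x = foldr S u x"

lemma F_simps [simp]: "F [] x = x" "F (i # u) x = S i (F u x)" "F (u @ w) x = F u (F w x)"
  by (simp_all add: F_def)

lemma F_rev [simp]: "F (rev u) (F u x) = x" "F u (F (rev u) x) = x"
proof -
  show *: "F (rev u) (F u x) = x" for u x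
    by (induction u arbitrary: x) simp_all
  show "F u (F (rev u) x) = x"
    using *[of "rev u"] by simp
qed

lemma T_F: "T (F u x) = F u (T x)"
  by (induction u) (simp_all add: T_S)

text \<open>Split off the last letter, \<open>u = q @ [k]\<close>, and compare \<open>k\<close> with
  \<open>i\<close>. If they are distinct and not joined, \<open>k\<close> commutes past
  \<open>i\<close>. Otherwise, according to the signs of the images of \<open>\<alpha> k\<close> and
  \<open>\<alpha> i\<close> under \<open>q\<close>, either exchange produces a shorter word for
  which the claim is known, or the situation is impossible.\<close>

lemma F_conj_aux:
  "length u \<le> n \<Longrightarrow> act u (\<alpha> i) = \<alpha> j \<Longrightarrow>
    (\<forall>x. F u (S i x) = S j (F u x)) \<and> (\<forall>x. F u (E i x) = E j (F u x))"
proof (induction n arbitrary: u i j rule: less_induct)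
  case (less n)
  \<comment> \<open>Exchange for words of length below \<open>n\<close>; the conjugation rule that
    it needs concerns still shorter words and is the induction hypothesis.\<close>
  have ex: "\<exists>q'. length q = Suc (length q') \<and> (\<forall>v. act q' v = act q (refl (\<alpha> k) v))
      \<and> (\<forall>x. F q' x = F q (S k x))"
    if "length q < n" "nonneg (- act q (\<alpha> k))" for q k
  proof (rule exchange_operators[of S q k])
    show "foldr S p (S k x) = S j (foldr S p x)" if "length p < length q" "act p (\<alpha> k) = \<alpha> j" for p j x
      using less.IH[of "length p" p k j] that \<open>length q < n\<close> by (auto simp: F_def)
  qed (use that in \<open>auto simp: F_def\<close>)
  show ?case
  proof (cases u rule: rev_cases)
    case Nil
    with less.prems have "\<alpha> i = \<alpha> j" by simp
    then have "i = j" by (metis axis_eq_axis zero_neq_one)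
    with Nil show ?thesis by simp
  next
    case (snoc q k)
    with less.prems have q: "length q < n" "act q (refl (\<alpha> k) (\<alpha> i)) = \<alpha> j" by simp_all
    consider "k = i" | "k \<noteq> i" "\<not> adj k i" | "adj k i" "nonneg (- act q (\<alpha> k))"
      | "adj k i" "nonneg (- act q (\<alpha> i))" | "adj k i" "nonneg (act q (\<alpha> k))" "nonneg (act q (\<alpha> i))"
      using root_sign[of "act q (\<alpha> i)"] root_sign[of "act q (\<alpha> k)"] by auto
    then show ?thesis
    proof cases
      case 1
      then have "nonneg (- act q (\<alpha> k))"
        using q(2) by (simp add: refl_self act_linear)
      from ex[OF q(1) this] obtain q' where q': "length q = Suc (length q')"
        "\<forall>v. act q' v = act q (refl (\<alpha> k) v)" "\<forall>x. F q' x = F q (S k x)" by blast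
      with q show ?thesis
        using less.IH[of "length q'" q' i j] by (simp add: snoc)
    next
      case 2
      then have "act q (\<alpha> i) = \<alpha> j"
        using q(2) by (simp add: refl_orth B_simple cartan_def)
      with q 2 show ?thesis
        using less.IH[of "length q" q i j] by (simp add: snoc S_comm[of k i] S_E_comm[of k i])
    next
      case 3
      from ex[OF q(1) this(2)] obtain q' where q': "length q = Suc (length q')"
        "\<forall>v. act q' v = act q (refl (\<alpha> k) v)" "\<forall>x. F q' x = F q (S k x)" by blast
      with q show ?thesis
        using less.IH[of "length q'" q' i j] by (simp add: snoc)
    next
      \<comment> \<open>Now \<open>u\<close> acts as \<open>q'\<close> followed on the right by the
        letters \<open>i\<close>, \<open>k\<close>. The braid relation moves \<open>S i\<close>, and
        its analogue moves \<open>E i\<close>, across these two letters to index \<open>k\<close>,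
        and \<open>q'\<close> carries \<open>\<alpha> k\<close> to
        \<open>\<alpha> j\<close>.\<close>
      case 4
      from ex[OF q(1) this(2)] obtain q' where q': "length q = Suc (length q')"
        "\<forall>v. act q' v = act q (refl (\<alpha> i) v)" "\<forall>x. F q' x = F q (S i x)" by blast
      have k: "k \<noteq> i" "adj i k" using 4 adj_sym adj_irrefl by auto
      have F_q: "F q x = F q' (S i x)" for x
        using q'(3) by simp
      have "refl (\<alpha> k) (\<alpha> i) = refl (\<alpha> i) (\<alpha> k)"
        using k 4(1) by (simp add: refl_def B_simple cartan_def vec_eq_iff)
      then have "act q' (\<alpha> k) = \<alpha> j"
        using q(2) q'(2) by simp
      with q(1) q'(1) have IH: "F q' (S k x) = S j (F q' x)" "F q' (E k x) = E j (F q' x)" for x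
        using less.IH[of "length q'" q' k j] by simp_all
      show ?thesis
        using k by (simp add: snoc F_q braid[of i k] S_S_E[of i k] IH)
    next
      \<comment> \<open>Impossible: \<open>\<alpha> j\<close> would be a sum of two positive roots
        and have height at least 2.\<close>
      case 5
      have "refl (\<alpha> k) (\<alpha> i) = \<alpha> k + \<alpha> i"
        using 5(1) adj_irrefl by (auto simp: refl_def B_simple cartan_def vec_eq_iff)
      then have "act q (\<alpha> k) + act q (\<alpha> i) = \<alpha> j"
        using q(2) by (simp add: act_linear)
      moreover have "height v \<ge> 1" if "root v" "nonneg v" for v
      proof (rule ccontr)
        assume "\<not> height v \<ge> 1"
        with height_nonneg[OF that(2)] have "height v = 0" by simp
        with that(2) have "v = 0"
          by (auto simp: height_def nonneg_def vec_eq_iff sum_nonneg_eq_0_iff)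
        with that(1) root_nonzero show False by blast
      qed
      then have "height (act q (\<alpha> k)) \<ge> 1" "height (act q (\<alpha> i)) \<ge> 1"
        using 5 by simp_all
      moreover have "height (v + w) = height v + height w" for v w
        by (simp add: height_def sum.distrib)
      moreover have "height (\<alpha> j) = 1"
        by (simp add: height_def axis_def)
      ultimately show ?thesis by (smt (verit))
    qed
  qed
qed

lemma F_S: "act u (\<alpha> i) = \<alpha> j \<Longrightarrow> F u (S i x) = S j (F u x)"
  and F_E: "act u (\<alpha> i) = \<alpha> j \<Longrightarrow> F u (E i x) = E j (F u x)"
  using F_conj_aux[of u "length u" i j] by auto

text \<open>If \<open>q @ [k]\<close> acts trivially, then \<open>q\<close> sends
  \<open>\<alpha> k\<close> to its negative. Exchange removes one letter from \<open>q\<close> and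
  absorbs \<open>k\<close>, leaving a trivially acting word that is two letters shorter and has the
  same operator. In effect this derives the Coxeter presentation of the group.\<close>

lemma F_eq_id:
  assumes "\<And>v. act u v = v"
  shows "F u x = x"
  using assms
proof (induction "length u" arbitrary: u x rule: less_induct)
  case less
  show ?case
  proof (cases u rule: rev_cases)
    case (snoc q k)
    have "act q (refl (\<alpha> k) (\<alpha> k)) = \<alpha> k"
      using less.prems[of "\<alpha> k"] by (simp add: snoc)
    then have "nonneg (- act q (\<alpha> k))"
      by (simp add: refl_self act_linear)
    show ?thesis
    proof (rule exchange_operators[of S q k, folded F_def])
      show "F p (S k x) = S j (F p x)" if "act p (\<alpha> k) = \<alpha> j" for p j x
        using that by (rule F_S)
    next
      fix q' assume q': "length q = Suc (length q')"
        "\<And>v. act q' v = act q (refl (\<alpha> k) v)" "\<And>x. F q' x = F q (S k x)"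
      have "F q' x = x"
        using less.prems q'(1,2) by (intro less.hyps) (simp_all add: snoc)
      then show ?thesis
        by (simp add: snoc q'(3))
    qed (simp_all add: \<open>nonneg (- act q (\<alpha> k))\<close>)
  qed simp
qed

lemma F_cong:
  assumes "\<And>v. act u v = act w v"
  shows "F u x = F w x"
proof -
  have "F (u @ rev w) (F w x) = F w x"
    using assms by (intro F_eq_id) simp
  then show ?thesis by simp
qed

section \<open>Operators attached to arbitrary roots\<close>

definition EE :: "int^'i \<Rightarrow> 'b \<Rightarrow> 'b" where
  "EE b x = (let (u, i) = SOME (u, i). act u (\<alpha> i) = b in F u (E i (F (rev u) x)))"

definition SS :: "int^'i \<Rightarrow> 'b \<Rightarrow> 'b" where
  "SS b x = (let (u, i) = SOME (u, i). act u (\<alpha> i) = b in F u (S i (F (rev u) x)))"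

text \<open>Independence of the chosen word: if \<open>u\<close> and \<open>w\<close> carry
  \<open>\<alpha> i\<close> and \<open>\<alpha> j\<close> to the same root, then
  \<open>rev w @ u\<close> carries \<open>\<alpha> i\<close> to \<open>\<alpha> j\<close>, and the
  conjugation rules apply to it.\<close>

lemma EE_eq: "act u (\<alpha> i) = b \<Longrightarrow> EE b x = F u (E i (F (rev u) x))"
  and SS_eq: "act u (\<alpha> i) = b \<Longrightarrow> SS b x = F u (S i (F (rev u) x))"
proof -
  assume *: "act u (\<alpha> i) = b"
  obtain w j where w: "(SOME (u, i). act u (\<alpha> i) = b) = (w, j)" by fastforce
  have "case (w, j) of (u, i) \<Rightarrow> act u (\<alpha> i) = b"
    unfolding w[symmetric] by (rule someI[of _ "(u, i)"]) (simp add: *)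
  then have "act (rev w @ u) (\<alpha> i) = \<alpha> j"
    using * act_rev(1)[of w "\<alpha> j"] by simp
  from F_E[OF this, of "F (rev u) x"] F_S[OF this, of "F (rev u) x"]
  have "F w (F (rev w) (F u (E i (F (rev u) x)))) = F w (E j (F (rev w) x))"
    "F w (F (rev w) (F u (S i (F (rev u) x)))) = F w (S j (F (rev w) x))"
    by simp_all
  then show "EE b x = F u (E i (F (rev u) x))" "SS b x = F u (S i (F (rev u) x))"
    by (simp_all add: EE_def SS_def w)
qed

lemma EE_simple [simp]: "EE (\<alpha> i) x = E i x" and SS_simple [simp]: "SS (\<alpha> i) x = S i x"
  using EE_eq[of "[]" i "\<alpha> i" x] SS_eq[of "[]" i "\<alpha> i" x] by simp_all

lemma SS_eq_F:
  assumes "root b"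
  obtains w where "\<And>x. SS b x = F w x" "\<And>v. act w v = refl b v"
proof -
  from root_exists_word[OF assms] obtain u i where u: "act u (\<alpha> i) = b" .
  show thesis
  proof
    show "SS b x = F (u @ [i] @ rev u) x" for x
      by (simp add: SS_eq[OF u])
    show "act (u @ [i] @ rev u) v = refl b v" for v
      by (simp add: act_refl u)
  qed
qed

text \<open>Appending \<open>i\<close> to a word for \<open>b\<close> gives a word for
  \<open>- b\<close>; the two extra factors \<open>S i\<close> cancel, or are absorbed by
  \<open>E i\<close>.\<close>

lemma SS_uminus [simp]: "root b \<Longrightarrow> SS (- b) x = SS b x"
  and EE_uminus [simp]: "root b \<Longrightarrow> EE (- b) x = EE b x"
proof -
  assume "root b"
  from root_exists_word[OF this] obtain u i where u: "act u (\<alpha> i) = b" .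
  then have "act (u @ [i]) (\<alpha> i) = - b"
    by (simp add: refl_self act_linear)
  from SS_eq[OF this, of x] EE_eq[OF this, of x]
  show "SS (- b) x = SS b x" "EE (- b) x = EE b x"
    by (simp_all add: SS_eq[OF u] EE_eq[OF u])
qed

lemma F_EE: "root b \<Longrightarrow> F w (EE b x) = EE (act w b) (F w x)"
  and F_SS: "root b \<Longrightarrow> F w (SS b x) = SS (act w b) (F w x)"
proof -
  assume "root b"
  from root_exists_word[OF this] obtain u i where u: "act u (\<alpha> i) = b" .
  then have "act (w @ u) (\<alpha> i) = act w b" by simp
  from EE_eq[OF this, of "F w x"] SS_eq[OF this, of "F w x"]
  show "F w (EE b x) = EE (act w b) (F w x)" "F w (SS b x) = SS (act w b) (F w x)"
    by (simp_all add: EE_eq[OF u] SS_eq[OF u])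
qed

lemma SS_EE: "root b \<Longrightarrow> root c \<Longrightarrow> SS b (EE c x) = EE (refl b c) (SS b x)"
  and SS_SS: "root b \<Longrightarrow> root c \<Longrightarrow> SS b (SS c x) = SS (refl b c) (SS b x)"
proof -
  assume "root b" "root c"
  from SS_eq_F[OF \<open>root b\<close>] obtain w where "\<And>x. SS b x = F w x" "\<And>v. act w v = refl b v"
    by blast
  then show "SS b (EE c x) = EE (refl b c) (SS b x)" "SS b (SS c x) = SS (refl b c) (SS b x)"
    using F_EE[OF \<open>root c\<close>, of w x] F_SS[OF \<open>root c\<close>, of w x] by simp_all
qed

lemma S_EE: "root c \<Longrightarrow> S i (EE c x) = EE (refl (\<alpha> i) c) (S i x)"
  and S_SS: "root c \<Longrightarrow> S i (SS c x) = SS (refl (\<alpha> i) c) (S i x)"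
  using SS_EE[of "\<alpha> i" c x] SS_SS[of "\<alpha> i" c x] by simp_all

lemma SS_self:
  assumes "root b"
  shows "SS b (SS b x) = x" "SS b (EE b x) = EE b x" "EE b (SS b x) = EE b x"
    "EE b (EE b x) = T (EE b x)"
proof -
  from root_exists_word[OF assms] obtain u i where u: "act u (\<alpha> i) = b" .
  show "SS b (SS b x) = x" "SS b (EE b x) = EE b x" "EE b (SS b x) = EE b x"
    "EE b (EE b x) = T (EE b x)"
    by (simp_all add: SS_eq[OF u] EE_eq[OF u] E_E T_F)
qed

text \<open>Peel a simple root \<open>\<alpha> k\<close> off \<open>c\<close>. If \<open>k\<close>
  is not joined to \<open>i\<close>, then \<open>S k\<close> commutes with \<open>E i\<close> and
  the induction hypothesis applies to \<open>c - \<alpha> k\<close>. If it is joined,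
  \<open>\<alpha> i\<close> can be peeled off as well, and the problem is conjugate to one for
  \<open>\<alpha> k\<close> and a root lower by 2.\<close>

lemma E_EE_comm:
  assumes "root c" "nonneg c" "B (\<alpha> i) c = 0"
  shows "E i (EE c x) = EE c (E i x)"
  using assms
proof (induction "nat (height c)" arbitrary: c i x rule: less_induct)
  case less
  show ?case
  proof (cases "\<exists>j. c = \<alpha> j")
    case True
    with less.prems show ?thesis
      using E_E_comm[of i] by (auto simp: B_simple cartan_def split: if_splits)
  next
    case False
    then obtain k where k: "B (\<alpha> k) c = 1"
      using root_descent less.prems by blast
    note d = diff_simple_root[OF less.prems(1,2) k]
    have c: "EE c y = S k (EE (c - \<alpha> k) (S k y))" for y
      using S_EE[OF d(1), of k "S k y"] by (simp add: d(4))
    have "k \<noteq> i" using k less.prems(3) by auto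
    show ?thesis
    proof (cases "adj k i")
      case False
      with \<open>k \<noteq> i\<close> have "cartan adj i k = 0"
        using adj_sym by (auto simp: cartan_def)
      with less.prems(3) have "B (\<alpha> i) (c - \<alpha> k) = 0"
        by (simp add: B_linear B_simple)
      note IH = less.hyps[OF d(5,1,2) this]
      show ?thesis
        using IH \<open>k \<noteq> i\<close> False by (simp add: c flip: S_E_comm[of k i])
    next
      case True
      with less.prems(3) have i: "B (\<alpha> i) (c - \<alpha> k) = 1"
        using adj_sym \<open>k \<noteq> i\<close> by (auto simp: B_linear B_simple cartan_def)
      note d' = diff_simple_root[OF d(1,2) i]
      let ?c = "c - \<alpha> k - \<alpha> i"
      have "B (\<alpha> k) ?c = 0"
        using k True \<open>k \<noteq> i\<close> by (simp add: B_linear B_simple cartan_def)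
      note IH = less.hyps[OF less_trans[OF d'(5) d(5)] d'(1,2) this]
      \<comment> \<open>The product of the reflections in \<open>\<alpha> k\<close> and
        \<open>\<alpha> i\<close> carries the orthogonal pair \<open>\<alpha> k\<close>,
        \<open>?c\<close> to the pair \<open>\<alpha> i\<close>, \<open>c\<close>.\<close>
      have conj: "S k (S i (EE ?c z)) = EE c (S k (S i z))" "S k (S i (E k z)) = E i (S k (S i z))" for z
        using True by (simp_all add: S_EE d' d S_S_E)
      define z where "z = S i (S k x)"
      have "E i (EE c (S k (S i z))) = EE c (E i (S k (S i z)))"
        by (simp add: IH flip: conj)
      then show ?thesis by (simp add: z_def)
    qed
  qed
qed

text \<open>Conjugation by a word makes \<open>b\<close> simple. If the other root then comes out
  negative, its opposite has the same operator.\<close>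

lemma EE_comm:
  assumes "root b" "root c" "B b c = 0"
  shows "EE b (EE c x) = EE c (EE b x)"
proof -
  from root_exists_word[OF assms(1)] obtain u i where u: "act u (\<alpha> i) = b" .
  define c' where "c' = act (rev u) c"
  have c: "act u c' = c" "root c'"
    using assms(2) by (simp_all add: c'_def)
  have "B (\<alpha> i) c' = 0"
    using B_act[of u "\<alpha> i" c'] assms(3) by (simp add: u c)
  then have "E i (EE c' y) = EE c' (E i y)" for y
    using E_EE_comm[of c' i y] E_EE_comm[of "- c'" i y] root_sign[of c'] c by (auto simp: B_linear)
  then have "F u (EE (\<alpha> i) (EE c' (F (rev u) x))) = F u (EE c' (EE (\<alpha> i) (F (rev u) x)))"
    by simp
  then show ?thesis
    unfolding F_EE[OF c(2)] F_EE[OF root_simple] by (simp add: u c)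
qed

text \<open>If \<open>B (\<alpha> i) r = 1\<close>, peeling off \<open>\<alpha> i\<close> conjugates
  the middle factor by \<open>S i\<close>, which both outer \<open>E i\<close> absorb. If the value
  is -1, another \<open>\<alpha> k\<close> is peeled off: an unjoined \<open>k\<close> commutes with
  \<open>E i\<close>, while a joined one reduces the claim to the defining relation for
  \<open>i\<close> and \<open>k\<close>.\<close>

lemma E_SS_E:
  assumes "root r" "nonneg r" "\<bar>B (\<alpha> i) r\<bar> = 1"
  shows "E i (SS r (E i x)) = E i x"
  using assms
proof (induction "nat (height r)" arbitrary: r x rule: less_induct)
  case less
  have peel: "SS r y = S k (SS (r - \<alpha> k) (S k y))" if "B (\<alpha> k) r = 1" for k y
    using S_SS[OF diff_simple_root(1)[OF less.prems(1,2) that], of k "S k y"]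
    by (simp add: diff_simple_root(4)[OF less.prems(1,2) that])
  show ?case
  proof (cases "\<exists>j. r = \<alpha> j")
    case True
    with less.prems show ?thesis
      using E_S_E[of i] by (auto simp: B_simple cartan_def split: if_splits)
  next
    case False
    show ?thesis
    proof (cases "B (\<alpha> i) r = 1")
      case True
      note d = diff_simple_root[OF less.prems(1,2) this]
      have "\<bar>B (\<alpha> i) (r - \<alpha> i)\<bar> = 1"
        by (simp add: B_linear True B_simple cartan_def)
      from less.hyps[OF d(5,1,2) this] show ?thesis
        by (simp add: peel[OF True])
    next
      case neg: False
      from False obtain k where k: "B (\<alpha> k) r = 1"
        using root_descent less.prems by blast
      note d = diff_simple_root[OF less.prems(1,2) k]
      have "k \<noteq> i" using k neg by auto
      show ?thesis
      proof (cases "adj k i")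
        case False
        with \<open>k \<noteq> i\<close> have "\<bar>B (\<alpha> i) (r - \<alpha> k)\<bar> = 1"
          using less.prems(3) adj_sym by (auto simp: B_linear B_simple cartan_def)
        note IH = less.hyps[OF d(5,1,2) this]
        note comm = S_E_comm[OF \<open>k \<noteq> i\<close> False]
        have "E i (SS r (E i x)) = S k (E i (SS (r - \<alpha> k) (E i (S k x))))"
          by (simp only: peel[OF k] comm)
        also have "\<dots> = E i x"
          by (simp add: IH comm)
        finally show ?thesis .
      next
        case True
        \<comment> \<open>Here \<open>?r\<close> is orthogonal to \<open>\<alpha> i\<close>, and its
          reflection carries \<open>\<alpha> k\<close> to \<open>r\<close>. Conjugation by
          \<open>SS ?r\<close> thus fixes \<open>E i\<close> and turns \<open>S k\<close> into
          \<open>SS r\<close>.\<close>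
        let ?r = "r - \<alpha> k"
        have "B (\<alpha> i) ?r = 0"
          using less.prems(3) neg True adj_sym \<open>k \<noteq> i\<close> by (auto simp: B_linear B_simple cartan_def)
        then have i: "refl ?r (\<alpha> i) = \<alpha> i"
          by (intro refl_orth) (simp add: B_sym)
        have "B ?r (\<alpha> k) = - 1"
          using k by (simp add: B_linear B_sym[of r "\<alpha> k"] B_simple cartan_def)
        then have "refl ?r (\<alpha> k) = r"
          by (simp add: refl_def vec_eq_iff)
        then have r: "SS r y = SS ?r (S k (SS ?r y))" for y
          using SS_SS[OF d(1) root_simple, of k "SS ?r y"] by (simp add: SS_self(1)[OF d(1)])
        have comm: "SS ?r (E i y) = E i (SS ?r y)" for y
          using SS_EE[OF d(1) root_simple, of i y] by (simp add: i)
        have "E i (SS r (E i x)) = SS ?r (E i (S k (E i (SS ?r x))))"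
          by (simp add: r comm)
        also have "\<dots> = E i x"
          using True adj_sym by (simp add: E_S_E comm SS_self(1)[OF d(1)])
        finally show ?thesis .
      qed
    qed
  qed
qed

lemma EE_SS_EE:
  assumes "root b" "root c" "\<bar>B b c\<bar> = 1"
  shows "EE b (SS c (EE b x)) = EE b x"
proof -
  from root_exists_word[OF assms(1)] obtain u i where u: "act u (\<alpha> i) = b" .
  define c' where "c' = act (rev u) c"
  have c: "act u c' = c" "root c'"
    using assms(2) by (simp_all add: c'_def)
  have "\<bar>B (\<alpha> i) c'\<bar> = 1"
    using B_act[of u "\<alpha> i" c'] assms(3) by (simp add: u c)
  then have "E i (SS c' (E i y)) = E i y" for y
    using E_SS_E[of c' i y] E_SS_E[of "- c'" i y] root_sign[of c'] c by (auto simp: B_linear)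
  then have "F u (EE (\<alpha> i) (SS c' (EE (\<alpha> i) (F (rev u) x)))) = F u (EE (\<alpha> i) (F (rev u) x))"
    by simp
  then show ?thesis
    unfolding F_EE[OF root_simple] F_SS[OF c(2)] by (simp add: u c)
qed

text \<open>Conjugation by \<open>SS d\<close> turns \<open>EE c\<close> into \<open>EE b\<close>.
  Hence the left side contains \<open>EE b\<close>, \<open>SS d\<close>, \<open>EE b\<close> in a
  row, which contracts to \<open>EE b\<close>; moving the remaining \<open>SS d\<close> to the front
  turns \<open>EE b\<close> back into \<open>EE c\<close>.\<close>

lemma EE_EE_adjacent:
  assumes "root b" "root c" "root d" "\<bar>B b d\<bar> = 1" "refl d c = b \<or> refl d c = - b"
  shows "EE b (EE c x) = SS d (EE c x)"
proof -
  have "SS d (EE c y) = EE b (SS d y)" for y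
    using SS_EE[OF assms(3,2), of y] assms(1,5) by auto
  moreover from this have "EE c y = SS d (EE b (SS d y))" for y
    using SS_self(1)[OF assms(3)] by metis
  ultimately show ?thesis
    using EE_SS_EE[OF assms(1,3,4)] by simp
qed

end

section \<open>Positive definiteness and connectedness of the Dynkin diagrams\<close>

text \<open>Successive completion of squares along a path whose end value \<open>y l\<close> is held
  fixed. The coefficient is a ratio of consecutive determinants of Cartan matrices of type A, the
  one for \<open>l\<close> nodes being \<open>l + 1\<close>.\<close>

lemma path_form_lower_bound:
  fixes y :: "nat \<Rightarrow> real"
  shows "- (real l / (real l + 1)) * (y l)\<^sup>2 \<le> 2 * (\<Sum>k<l. (y k)\<^sup>2) - 2 * (\<Sum>k<l. y k * y (Suc k))"
proof (induction l)
  case (Suc l)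
  \<comment> \<open>The coefficient of \<open>(y l)\<^sup>2\<close> left after eliminating the first
    \<open>l\<close> variables, namely \<open>2 - l / (l + 1)\<close>; its inverse is the constant
    for the next step.\<close>
  define c where "c = (real l + 2) / (real l + 1)"
  have c: "c > 0" "real l / (real l + 1) = 2 - c" "real (Suc l) / (real (Suc l) + 1) = 1 / c"
    by (simp_all add: c_def field_simps)
  have "0 \<le> c * (y l - y (Suc l) / c)\<^sup>2"
    using c(1) by simp
  also have "\<dots> = c * (y l)\<^sup>2 - 2 * (y l * y (Suc l)) + (1 / c) * (y (Suc l))\<^sup>2"
    using c(1) by (simp add: power2_eq_square field_simps)
  finally have "2 * (y l * y (Suc l)) \<le> c * (y l)\<^sup>2 + (1 / c) * (y (Suc l))\<^sup>2"
    by simp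
  moreover have "c * (y l)\<^sup>2 - 2 * (y l)\<^sup>2 \<le> 2 * (\<Sum>k<l. (y k)\<^sup>2) - 2 * (\<Sum>k<l. y k * y (Suc k))"
    using Suc unfolding c(2) by (simp add: left_diff_distrib)
  ultimately show ?case
    unfolding c(3) sum.lessThan_Suc by (simp add: distrib_left)
qed simp

text \<open>Zeros propagate from the end of the path: once an end value vanishes, the term
  \<open>2 * (y l)\<^sup>2\<close> of its neighbour outweighs the at most
  \<open>(y l)\<^sup>2\<close> by which the rest of the path can be negative, so the neighbour
  vanishes too.\<close>

lemma path_form_eq_0:
  fixes y :: "nat \<Rightarrow> real"
  assumes "y l = 0" "2 * (\<Sum>k<l. (y k)\<^sup>2) - 2 * (\<Sum>k<l. y k * y (Suc k)) \<le> 0" "k \<le> l"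
  shows "y k = 0"
  using assms
proof (induction l arbitrary: k)
  case (Suc l)
  let ?A = "2 * (\<Sum>k<l. (y k)\<^sup>2) - 2 * (\<Sum>k<l. y k * y (Suc k))"
  have A: "?A + 2 * (y l)\<^sup>2 \<le> 0"
    using Suc.prems(1,2) by simp
  moreover have "(real l / (real l + 1)) * (y l)\<^sup>2 \<le> 1 * (y l)\<^sup>2"
    by (intro mult_right_mono) simp_all
  ultimately have "(y l)\<^sup>2 \<le> 0"
    using path_form_lower_bound[of l y] by (simp only: mult_minus_left mult_1)
  then have "y l = 0" by simp
  then have "?A \<le> 0" using A by simp
  show ?case
  proof (cases "k = Suc l")
    case True
    then show ?thesis using Suc.prems(1) by simp
  next
    case False
    with Suc.prems(3) have "k \<le> l" by simp
    with \<open>y l = 0\<close> \<open>?A \<le> 0\<close> show ?thesis by (rule Suc.IH)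
  qed
qed simp

text \<open>A tree with a node from which three arms with \<open>p\<close>, \<open>q\<close> and \<open>1\<close> further nodes emanate.\<close>

lemma branched_form_eq_0:
  fixes y :: "nat \<Rightarrow> real"
  assumes pq: "1 / (real p + 1) + 1 / (real q + 1) > 1 / 2"
    and le: "2 * (\<Sum>k<Suc (p + q). (y k)\<^sup>2) + 2 * z\<^sup>2
      - 2 * ((\<Sum>k<p + q. y k * y (Suc k)) + y p * z) \<le> 0"
  shows "z = 0" "k \<le> p + q \<Longrightarrow> y k = 0"
proof -
  \<comment> \<open>The arm beyond the branch node is read backwards, so that both long arms are
    paths ending at node \<open>p\<close>.\<close>
  define y' where "y' k = y (p + q - k)" for k
  let ?P = "2 * (\<Sum>k<p. (y k)\<^sup>2) - 2 * (\<Sum>k<p. y k * y (Suc k))"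
  let ?Q = "2 * (\<Sum>k<q. (y' k)\<^sup>2) - 2 * (\<Sum>k<q. y' k * y' (Suc k))"
  have shift: "(\<Sum>k<m + q. f k) = (\<Sum>k<m. f k) + (\<Sum>k<q. f (m + q - Suc k))" for m and f :: "nat \<Rightarrow> real"
  proof -
    have "(\<Sum>k<m + q. f k) = (\<Sum>k<m. f k) + (\<Sum>k<q. f (m + k))"
      by (induction q) (simp_all add: add.assoc)
    also have "(\<Sum>k<q. f (m + k)) = (\<Sum>k<q. f (m + (q - Suc k)))"
      by (rule sum.nat_diff_reindex[symmetric])
    finally show ?thesis by simp
  qed
  have "(\<Sum>k<Suc (p + q). (y k)\<^sup>2) = (\<Sum>k<p. (y k)\<^sup>2) + (y p)\<^sup>2 + (\<Sum>k<q. (y' k)\<^sup>2)"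
    using shift[of "\<lambda>k. (y k)\<^sup>2" "Suc p"] by (simp add: y'_def)
  moreover have "(\<Sum>k<p + q. y k * y (Suc k)) = (\<Sum>k<p. y k * y (Suc k)) + (\<Sum>k<q. y' k * y' (Suc k))"
  proof -
    have "(\<Sum>k<q. y (p + q - Suc k) * y (Suc (p + q - Suc k))) = (\<Sum>k<q. y' k * y' (Suc k))"
      by (intro sum.cong) (auto simp: y'_def Suc_diff_Suc mult.commute)
    then show ?thesis
      using shift[of "\<lambda>k. y k * y (Suc k)" p] by simp
  qed
  ultimately have eq: "?P + ?Q + 2 * (y p)\<^sup>2 + 2 * z\<^sup>2 - 2 * (y p * z) \<le> 0"
    using le by simp
  have y'q: "y' q = y p"
    by (simp add: y'_def)
  \<comment> \<open>What remains of the coefficient 2 of \<open>(y p)\<^sup>2\<close> after each arm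
    has taken its share: \<open>p / (p + 1)\<close>, \<open>q / (q + 1)\<close>, and
    \<open>1 / 2\<close> from completing the square in \<open>z\<close>.\<close>
  let ?r = "1 / (real p + 1) + 1 / (real q + 1) - 1 / 2"
  have "real n / (real n + 1) = 1 - 1 / (real n + 1)" for n
    by (simp add: field_simps)
  then have "?P \<ge> - (1 - 1 / (real p + 1)) * (y p)\<^sup>2" "?Q \<ge> - (1 - 1 / (real q + 1)) * (y p)\<^sup>2"
    using path_form_lower_bound[of p y] path_form_lower_bound[of q y'] by (simp_all add: y'q)
  moreover have "2 * (z - y p / 2)\<^sup>2 = 2 * z\<^sup>2 - 2 * (y p * z) + (y p)\<^sup>2 / 2"
    by (simp add: power2_eq_square algebra_simps)
  ultimately have "?r * (y p)\<^sup>2 + 2 * (z - y p / 2)\<^sup>2 \<le> 0"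
    using eq by (simp add: algebra_simps)
  moreover have "?r * (y p)\<^sup>2 \<ge> 0" "(z - y p / 2)\<^sup>2 \<ge> 0"
    using pq by simp_all
  ultimately have "?r * (y p)\<^sup>2 = 0" "(z - y p / 2)\<^sup>2 = 0"
    by linarith+
  then have yp: "y p = 0" and z: "z = 0"
    using pq by simp_all
  show "z = 0" by (fact z)
  have "y' q = 0"
    using y'q yp by simp
  have "?P + ?Q \<le> 0"
    using eq by (simp add: yp z)
  moreover have "?P \<ge> 0" "?Q \<ge> 0"
    using path_form_lower_bound[of p y] path_form_lower_bound[of q y']
    unfolding yp \<open>y' q = 0\<close> by simp_all
  ultimately have "?P \<le> 0" "?Q \<le> 0"
    by linarith+
  note P = path_form_eq_0[OF yp \<open>?P \<le> 0\<close>] and Q = path_form_eq_0[OF \<open>y' q = 0\<close> \<open>?Q \<le> 0\<close>]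
  show "y k = 0" if "k \<le> p + q"
  proof (cases "k \<le> p")
    case True
    then show ?thesis by (rule P)
  next
    case False
    then have "p + q - k \<le> q" by simp
    from Q[OF this] show ?thesis
      using that by (simp add: y'_def)
  qed
qed

text \<open>Types D and E are treated together: a path with branch node \<open>p\<close>, an arm of
  \<open>q\<close> nodes beyond it, and one extra node. Type D has \<open>q = 1\<close>; type E has
  \<open>p = 2\<close> and \<open>q = n - 4\<close>, where the inequality is equivalent to
  \<open>n < 9\<close>.\<close>

lemma simply_laced_DynkinE:
  assumes "simply_laced_Dynkin (adj :: 'i::finite \<Rightarrow> 'i \<Rightarrow> bool)"
  obtains (path) v n where "n = CARD('i)" "bij_betw v {..<n} (UNIV :: 'i set)"
    "\<And>i j. i < n \<Longrightarrow> j < n \<Longrightarrow> adj (v i) (v j) \<longleftrightarrow> edge_A n i j \<or> edge_A n j i"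
  | (branched) v p q n where "n = CARD('i)" "bij_betw v {..<n} (UNIV :: 'i set)"
    "n = p + q + 2" "1 / (real p + 1) + 1 / (real q + 1) > 1 / 2"
    "\<And>i j. i < n \<Longrightarrow> j < n \<Longrightarrow> adj (v i) (v j) \<longleftrightarrow>
      edge_A (n - 1) i j \<or> edge_A (n - 1) j i \<or> (i = p \<and> j = n - 1) \<or> (j = p \<and> i = n - 1)"
proof -
  let ?n = "CARD('i)"
  from assms obtain E v where
    E: "E = edge_A ?n \<or> (?n \<ge> 4 \<and> E = edge_D ?n) \<or> (?n \<in> {6, 7, 8} \<and> E = edge_E ?n)"
    and v: "bij_betw v {..<?n} (UNIV :: 'i set)"
    and adj: "\<forall>i<?n. \<forall>j<?n. adj (v i) (v j) \<longleftrightarrow> E i j \<or> E j i"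
    unfolding simply_laced_Dynkin_def by blast
  from E consider "E = edge_A ?n" | "?n \<ge> 4" "E = edge_D ?n" | "?n \<in> {6, 7, 8}" "E = edge_E ?n"
    by blast
  then show thesis
  proof cases
    case 1
    show thesis
      by (rule path[OF refl v]) (use adj 1 in blast)
  next
    case 2
    show thesis
    proof (rule branched[OF refl v, of "?n - 3" 1])
      show "adj (v i) (v j) \<longleftrightarrow> edge_A (?n - 1) i j \<or> edge_A (?n - 1) j i
          \<or> (i = ?n - 3 \<and> j = ?n - 1) \<or> (j = ?n - 3 \<and> i = ?n - 1)"
        if "i < ?n" "j < ?n" for i j
        unfolding adj[rule_format, OF that] 2(2) edge_D_def edge_A_def by blast
    qed (use 2(1) in simp_all)
  next
    case 3
    show thesis
    proof (rule branched[OF refl v, of 2 "?n - 4"])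
      show "adj (v i) (v j) \<longleftrightarrow> edge_A (?n - 1) i j \<or> edge_A (?n - 1) j i
          \<or> (i = 2 \<and> j = ?n - 1) \<or> (j = 2 \<and> i = ?n - 1)"
        if "i < ?n" "j < ?n" for i j
        unfolding adj[rule_format, OF that] 3(2) edge_E_def edge_A_def by blast
    qed (use 3(1) in auto)
  qed
qed

lemma sum_edge_A:
  fixes f :: "nat \<Rightarrow> nat \<Rightarrow> real"
  assumes "m \<le> n"
  shows "(\<Sum>i<n. \<Sum>j<n. if edge_A m i j then f i j else 0) = (\<Sum>k<m - 1. f k (Suc k))"
proof -
  have "(\<Sum>j<n. if edge_A m i j then f i j else 0) = (if i < m - 1 then f i (Suc i) else 0)" for i
  proof -
    have "(\<Sum>j<n. if edge_A m i j then f i j else 0)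
        = (\<Sum>j<n. if j = Suc i then if Suc i < m then f i (Suc i) else 0 else 0)"
      by (intro sum.cong) (auto simp: edge_A_def)
    then show ?thesis using assms by (auto simp: sum.delta)
  qed
  then have "(\<Sum>i<n. \<Sum>j<n. if edge_A m i j then f i j else 0)
      = (\<Sum>i<n. if i \<in> {..<m - 1} then f i (Suc i) else 0)"
    by simp
  also have "\<dots> = (\<Sum>i\<in>{..<n} \<inter> {..<m - 1}. f i (Suc i))"
    by (rule sum.inter_restrict[symmetric]) simp
  also have "{..<n} \<inter> {..<m - 1} = {..<m - 1}"
    using assms by auto
  finally show ?thesis .
qed

text \<open>The relation \<open>D\<close> orients every edge from the smaller to the larger number,
  so that each edge is counted once and the symmetric form contributes it twice.\<close>

lemma root_form_reindex:
  fixes adj :: "'i::finite \<Rightarrow> 'i \<Rightarrow> bool" and u :: "int^'i" and n :: nat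
  assumes v: "bij_betw v {..<n} (UNIV :: 'i set)"
    and adj: "\<And>i j. i < n \<Longrightarrow> j < n \<Longrightarrow> adj (v i) (v j) \<longleftrightarrow> D i j \<or> D j i"
    and D: "\<And>i j. D i j \<Longrightarrow> i < j"
  shows "of_int (root_form adj u u) = 2 * (\<Sum>i<n. (real_of_int (u $ v i))\<^sup>2)
    - 2 * (\<Sum>i<n. \<Sum>j<n. if D i j then real_of_int (u $ v i) * u $ v j else 0)"
proof -
  define x where "x i = real_of_int (u $ v i)" for i
  have "of_int (root_form adj u u)
      = (\<Sum>i<n. \<Sum>j<n. x i * of_int (cartan adj (v i) (v j)) * x j)"
    unfolding root_form_def x_def
    by (simp flip: sum.reindex_bij_betw[OF v])
  also have "\<dots> = (\<Sum>i<n. \<Sum>j<n. (if i = j then 2 * (x i)\<^sup>2 else 0)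
      - (if D i j then x i * x j else 0) - (if D j i then x j * x i else 0))"
  proof (intro sum.cong refl)
    fix i j assume "i \<in> {..<n}" "j \<in> {..<n}"
    moreover from this have "v i = v j \<longleftrightarrow> i = j"
      using v by (auto simp: bij_betw_def inj_on_def)
    moreover have "\<not> (D i j \<and> D j i)" "\<not> D i i"
      using D[of i j] D[of j i] D[of i i] by auto
    ultimately show "x i * of_int (cartan adj (v i) (v j)) * x j = (if i = j then 2 * (x i)\<^sup>2 else 0)
      - (if D i j then x i * x j else 0) - (if D j i then x j * x i else 0)"
      by (auto simp: cartan_def adj power2_eq_square)
  qed
  also have "\<dots> = 2 * (\<Sum>i<n. (x i)\<^sup>2) - (\<Sum>i<n. \<Sum>j<n. if D i j then x i * x j else 0)
      - (\<Sum>i<n. \<Sum>j<n. if D j i then x j * x i else 0)"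
    by (simp add: sum_subtractf sum_distrib_left)
  also have "(\<Sum>i<n. \<Sum>j<n. if D j i then x j * x i else 0)
      = (\<Sum>i<n. \<Sum>j<n. if D i j then x i * x j else 0)"
    by (rule sum.swap)
  finally show ?thesis unfolding x_def by simp
qed

lemma simply_laced_if_Dynkin:
  assumes "simply_laced_Dynkin (adj :: 'i::finite \<Rightarrow> 'i \<Rightarrow> bool)"
  shows "simply_laced adj"
  using assms
proof (cases rule: simply_laced_DynkinE)
  case (path v n)
  have surj: "\<exists>k<n. i = v k" for i
    using path(2) by (auto simp: bij_betw_def image_iff set_eq_iff)
  show ?thesis
  proof
    show "adj j i" if "adj i j" for i j
      using surj[of i] surj[of j] path(3) that by auto
    show "\<not> adj i i" for i
      using surj[of i] path(3) by (auto simp: edge_A_def)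
    show "root_form adj u u > 0" if "u \<noteq> 0" for u
    proof (rule ccontr)
      assume neg: "\<not> root_form adj u u > 0"
      \<comment> \<open>The default 0 beyond the last vertex supplies the vanishing end value for
        \<open>path_form_eq_0\<close> and makes the sum over \<open>n - 1\<close> edges extendable
        by a zero term.\<close>
      define x where "x k = (if k < n then real_of_int (u $ v k) else 0)" for k
      have "n > 0" using path(1) by simp
      then obtain m where m: "n = Suc m" using gr0_implies_Suc by blast
      have "edge_A n i j \<Longrightarrow> i < j" for i j
        by (simp add: edge_A_def)
      from root_form_reindex[where D = "edge_A n", OF path(2,3) this, of u]
      have "of_int (root_form adj u u) = 2 * (\<Sum>k<n. (real_of_int (u $ v k))\<^sup>2)
          - 2 * (\<Sum>k<n - 1. real_of_int (u $ v k) * real_of_int (u $ v (Suc k)))"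
        using sum_edge_A[of n n "\<lambda>i j. real_of_int (u $ v i) * real_of_int (u $ v j)"] by simp
      also have "(\<Sum>k<n. (real_of_int (u $ v k))\<^sup>2) = (\<Sum>k<n. (x k)\<^sup>2)"
        by (simp add: x_def)
      also have "(\<Sum>k<n - 1. real_of_int (u $ v k) * real_of_int (u $ v (Suc k)))
          = (\<Sum>k<n - 1. x k * x (Suc k))"
        by (intro sum.cong) (auto simp: x_def)
      also have "(\<Sum>k<n - 1. x k * x (Suc k)) = (\<Sum>k<n. x k * x (Suc k))"
        by (simp add: m x_def)
      finally have le: "2 * (\<Sum>k<n. (x k)\<^sup>2) - 2 * (\<Sum>k<n. x k * x (Suc k)) \<le> 0"
        using neg by linarith
      have "x n = 0" by (simp add: x_def)
      note x0 = path_form_eq_0[OF this le]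
      have "u $ i = 0" for i
      proof -
        obtain k where "k < n" "i = v k" using surj by blast
        then show ?thesis using x0[of k] by (simp add: x_def)
      qed
      then have "u = 0"
        by (simp add: vec_eq_iff)
      with that show False by simp
    qed
  qed
next
  case (branched v p q n)
  have surj: "\<exists>k<n. i = v k" for i
    using branched(2) by (auto simp: bij_betw_def image_iff set_eq_iff)
  let ?D = "\<lambda>i j. edge_A (n - 1) i j \<or> (i = p \<and> j = n - 1)"
  show ?thesis
  proof
    show "adj j i" if "adj i j" for i j
      using surj[of i] surj[of j] branched(5) that by auto
    show "\<not> adj i i" for i
      using surj[of i] branched(3,5) by (auto simp: edge_A_def)
    show "root_form adj u u > 0" if "u \<noteq> 0" for u
    proof (rule ccontr)
      assume neg: "\<not> root_form adj u u > 0"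
      define x where "x k = real_of_int (u $ v k)" for k
      have adj: "adj (v i) (v j) \<longleftrightarrow> ?D i j \<or> ?D j i" if "i < n" "j < n" for i j
        using branched(5)[OF that] by blast
      have "?D i j \<Longrightarrow> i < j" for i j
        using branched(3) by (auto simp: edge_A_def)
      from root_form_reindex[where D = ?D, OF branched(2) adj this]
      have "of_int (root_form adj u u) = 2 * (\<Sum>k<n. (x k)\<^sup>2)
          - 2 * (\<Sum>i<n. \<Sum>j<n. if ?D i j then x i * x j else 0)"
        unfolding x_def by simp
      also have "(\<Sum>i<n. \<Sum>j<n. if ?D i j then x i * x j else 0)
          = (\<Sum>i<n. \<Sum>j<n. (if edge_A (n - 1) i j then x i * x j else 0)
              + (if i = p then if j = n - 1 then x p * x (n - 1) else 0 else 0))"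
        by (intro sum.cong refl) (auto simp: edge_A_def)
      also have "\<dots> = (\<Sum>i<n. \<Sum>j<n. if edge_A (n - 1) i j then x i * x j else 0) + x p * x (n - 1)"
        using branched(3) by (simp add: sum.distrib if_distrib[of "sum _"] cong: if_cong)
      also have "\<dots> = (\<Sum>k<p + q. x k * x (Suc k)) + x p * x (n - 1)"
        by (subst sum_edge_A) (use branched(3) in simp_all)
      also have "(\<Sum>k<n. (x k)\<^sup>2) = (\<Sum>k<Suc (p + q). (x k)\<^sup>2) + (x (n - 1))\<^sup>2"
        using branched(3) by simp
      finally have *: "2 * (\<Sum>k<Suc (p + q). (x k)\<^sup>2) + 2 * (x (n - 1))\<^sup>2
          - 2 * ((\<Sum>k<p + q. x k * x (Suc k)) + x p * x (n - 1)) \<le> 0"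
        using neg by (simp add: not_less)
      have x0: "x k = 0" if "k < n" for k
      proof (cases "k = n - 1")
        case True
        then show ?thesis using branched_form_eq_0(1)[OF branched(4) *] by simp
      next
        case False
        then have "k \<le> p + q" using that branched(3) by linarith
        then show ?thesis by (rule branched_form_eq_0(2)[OF branched(4) *])
      qed
      have "u $ i = 0" for i
      proof -
        obtain k where "k < n" "i = v k" using surj by blast
        then show ?thesis using x0[of k] by (simp add: x_def)
      qed
      then have "u = 0"
        by (simp add: vec_eq_iff)
      with that show False by simp
    qed
  qed
qed

lemma Dynkin_connected:
  assumes "simply_laced_Dynkin (adj :: 'i::finite \<Rightarrow> 'i \<Rightarrow> bool)"
  shows "adj\<^sup>*\<^sup>* i j"
proof -
  interpret simply_laced adj
    using assms by (rule simply_laced_if_Dynkin)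
  have "\<exists>r. \<forall>i. adj\<^sup>*\<^sup>* r i"
    using assms
  proof (cases rule: simply_laced_DynkinE)
    case (path v n)
    have reach: "k < n \<Longrightarrow> adj\<^sup>*\<^sup>* (v 0) (v k)" for k
    proof (induction k)
      case (Suc k)
      then have "adj (v k) (v (Suc k))"
        using path(3)[of k "Suc k"] by (simp add: edge_A_def)
      with Suc show ?case by (auto intro: rtranclp.rtrancl_into_rtrancl)
    qed simp
    show ?thesis
    proof (intro exI allI)
      fix i
      obtain k where "k < n" "i = v k"
        using path(2) by (auto simp: bij_betw_def image_iff set_eq_iff)
      then show "adj\<^sup>*\<^sup>* (v 0) i"
        by (simp add: reach)
    qed
  next
    case (branched v p q n)
    have *: "k < n - 1 \<Longrightarrow> adj\<^sup>*\<^sup>* (v 0) (v k)" for k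
    proof (induction k)
      case (Suc k)
      then have "adj (v k) (v (Suc k))"
        using branched(5)[of k "Suc k"] by (simp add: edge_A_def)
      with Suc show ?case by (auto intro: rtranclp.rtrancl_into_rtrancl)
    qed simp
    have "adj (v p) (v (n - 1))"
      using branched(3) branched(5)[of p "n - 1"] by simp
    with *[of p] have "adj\<^sup>*\<^sup>* (v 0) (v (n - 1))"
      using branched(3) by (auto intro: rtranclp.rtrancl_into_rtrancl)
    with * have reach: "adj\<^sup>*\<^sup>* (v 0) (v k)" if "k < n" for k
      using that by (cases "k = n - 1") auto
    show ?thesis
    proof (intro exI allI)
      fix i
      obtain k where "k < n" "i = v k"
        using branched(2) by (auto simp: bij_betw_def image_iff set_eq_iff)
      then show "adj\<^sup>*\<^sup>* (v 0) i"
        by (simp add: reach)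
    qed
  qed
  moreover have "adj\<^sup>*\<^sup>* i j \<Longrightarrow> adj\<^sup>*\<^sup>* j i" for i j
    by (induction rule: rtranclp_induct) (auto intro: converse_rtranclp_into_rtranclp adj_sym)
  ultimately show ?thesis by (metis rtranclp_trans)
qed

section \<open>Reflections of the geometric representation\<close>

context simply_laced
begin

definition emb :: "int^'i \<Rightarrow> complex^'i" where "emb v = (\<chi> i. of_int (v $ i))"

lemma emb_nth [simp]: "emb v $ i = of_int (v $ i)"
  by (simp add: emb_def)

lemma emb_simple [simp]: "emb (\<alpha> i) = axis i 1"
  by (simp add: vec_eq_iff axis_def)

lemma emb_eq_iff [simp]: "emb u = emb v \<longleftrightarrow> u = v"
  by (simp add: vec_eq_iff)

lemma emb_linear: "emb (u + v) = emb u + emb v" "emb (u - v) = emb u - emb v"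
  "emb (c *s u) = of_int c *s emb u" "emb (- u) = - emb u"
  by (simp_all add: vec_eq_iff)

text \<open>The complex-linear extension of \<open>B b\<close>; its kernel is the reflecting
  hyperplane when \<open>b\<close> is a root.\<close>

definition cform :: "int^'i \<Rightarrow> complex^'i \<Rightarrow> complex" where
  "cform b v = (\<Sum>j\<in>UNIV. of_int (B b (\<alpha> j)) * v $ j)"

lemma cform_emb [simp]: "cform b (emb v) = of_int (B b v)"
  unfolding B_sym[of b v] B_expand[of v b] by (simp add: cform_def B_sym[of b "\<alpha> j" for j] mult.commute)

lemma cform_linear: "cform b (u + v) = cform b u + cform b v" "cform b (c *s v) = c * cform b v"
  by (simp_all add: cform_def algebra_simps sum.distrib sum_distrib_left)

lemma cform_diff_left: "cform (b - c) v = cform b v - cform c v"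
  and cform_smult_left: "cform (k *s b) v = of_int k * cform b v"
  by (simp_all add: cform_def B_linear algebra_simps sum_subtractf sum_distrib_left)

definition R :: "int^'i \<Rightarrow> complex^'i^'i" where
  "R b = matrix (\<lambda>v. v - cform b v *s emb b)"

lemma R_mult: "R b *v v = v - cform b v *s emb b"
  unfolding R_def
  by (rule matrix_works, unfold_locales) (simp_all add: cform_linear vec_eq_iff algebra_simps)

lemma R_emb: "R b *v emb v = emb (refl b v)"
  by (simp add: R_mult refl_def emb_linear)

text \<open>Doubling the values of minus cosine at \<open>pi\<close>, \<open>pi / 3\<close> and
  \<open>pi / 2\<close> gives the Cartan entries 2, -1 and 0.\<close>

lemma simple_reflection_eq: "simple_reflection adj i = R (\<alpha> i)"
proof -
  have "2 * geom_form adj (axis i 1) v = cform (\<alpha> i) v" for v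
  proof -
    have eq: "2 * complex_of_real (- cos (pi / real (coxeter_matrix adj i j))) = of_int (cartan adj i j)" for j
      by (simp add: coxeter_matrix_def cartan_def cos_60)
    define c where "c k j = complex_of_real (- cos (pi / real (coxeter_matrix adj k j)))" for k j
    have "(\<Sum>j\<in>UNIV. (axis i 1 :: complex^'i) $ k * c k j * v $ j)
        = (if k = i then \<Sum>j\<in>UNIV. c i j * v $ j else 0)" for k
      by (simp add: axis_def)
    moreover have "geom_form adj (axis i 1) v = (\<Sum>k\<in>UNIV. \<Sum>j\<in>UNIV. axis i 1 $ k * c k j * v $ j)"
      by (simp only: geom_form_def c_def)
    ultimately have "geom_form adj (axis i 1) v = (\<Sum>j\<in>UNIV. c i j * v $ j)"
      by simp
    then have "2 * geom_form adj (axis i 1) v = (\<Sum>j\<in>UNIV. (2 * c i j) * v $ j)"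
      by (simp add: sum_distrib_left mult.assoc)
    then show ?thesis
      by (simp only: eq c_def cform_def B_simple)
  qed
  then show ?thesis
    by (simp add: simple_reflection_def R_def)
qed

text \<open>The lattice contains the standard basis, so matrix identities can be checked on lattice
  vectors.\<close>

lemma matrix_eqI_emb:
  fixes A A' :: "complex^'i^'i"
  assumes "\<And>v. A *v emb v = A' *v emb v"
  shows "A = A'"
proof -
  have "(C *v axis j 1) $ k = C $ k $ j" for C :: "complex^'i^'i" and j k
    by (simp add: matrix_vector_mult_def axis_def if_distrib cong: if_cong)
  with assms[of "\<alpha> j" for j] show ?thesis
    by (simp add: vec_eq_iff)
qed

section \<open>The Coxeter group as the set of words\<close>

definition M :: "'i list \<Rightarrow> complex^'i^'i" where
  "M u = foldr (\<lambda>i A. R (\<alpha> i) ** A) u (mat 1)"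

lemma M_emb: "M u *v emb v = emb (act u v)"
  by (induction u) (simp_all add: M_def R_emb flip: matrix_vector_mul_assoc)

lemma M_eq_iff: "M u = M w \<longleftrightarrow> (\<forall>v. act u v = act w v)"
  by (metis M_emb emb_eq_iff matrix_eqI_emb)

lemma M_mult: "M u ** M w = M (u @ w)"
  by (rule matrix_eqI_emb) (simp add: M_emb flip: matrix_vector_mul_assoc)

lemma M_Nil: "M [] = mat 1"
  by (simp add: M_def)

lemma M_rev: "M u ** M (rev u) = mat 1" "M (rev u) ** M u = mat 1"
  by (rule matrix_eqI_emb; simp add: M_emb flip: matrix_vector_mul_assoc)+

lemma matrix_inv_M: "matrix_inv (M u) = M (rev u)"
proof -
  have "(SOME A'. M u ** A' = mat 1 \<and> A' ** M u = mat 1) = M (rev u)"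
    by (rule some_equality) (metis M_rev matrix_mul_assoc matrix_mul_lid matrix_mul_rid)+
  then show ?thesis by (simp add: matrix_inv_def)
qed

lemma R_simple: "R (\<alpha> i) = M [i]"
  by (simp add: M_def)

text \<open>Simple reflections are their own inverses, so inverses of generators add nothing to the
  products of generators.\<close>

lemma coxeter_group_eq: "coxeter_group adj = range M"
proof
  show "coxeter_group adj \<subseteq> range M"
  proof
    fix A assume "A \<in> coxeter_group adj"
    then have "A \<in> generate GL (range (simple_reflection adj))"
      by (simp add: coxeter_group_def)
    then show "A \<in> range M"
    proof induction
      case one
      have "\<one>\<^bsub>GL\<^esub> = M []"
        by (simp add: GL_def M_Nil)
      then show ?case by blast
    next
      case (incl h)
      then show ?case by (auto simp: simple_reflection_eq R_simple)
    next
      case (inv h)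
      then obtain i where h: "h = M [i]"
        by (auto simp: simple_reflection_eq R_simple)
      have hh: "h ** h = mat 1"
        using M_rev[of "[i]"] by (simp add: h)
      have "inv\<^bsub>GL\<^esub> h = h"
        unfolding m_inv_def
      proof (rule the_equality)
        show "h \<in> carrier GL \<and> h \<otimes>\<^bsub>GL\<^esub> h = \<one>\<^bsub>GL\<^esub> \<and> h \<otimes>\<^bsub>GL\<^esub> h = \<one>\<^bsub>GL\<^esub>"
          using hh by (auto simp: GL_def invertible_def)
        show "y = h" if "y \<in> carrier GL \<and> h \<otimes>\<^bsub>GL\<^esub> y = \<one>\<^bsub>GL\<^esub> \<and> y \<otimes>\<^bsub>GL\<^esub> h = \<one>\<^bsub>GL\<^esub>" for y
        proof -
          have "h ** y = mat 1" using that by (simp add: GL_def)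
          then have "h ** (h ** y) = h" by simp
          then show ?thesis by (simp add: matrix_mul_assoc hh)
        qed
      qed
      with h show ?case by simp
    next
      case (eng h1 h2)
      then show ?case by (auto simp: GL_def M_mult)
    qed
  qed
  have "M u \<in> generate GL (range (simple_reflection adj))" for u
  proof (induction u)
    case Nil
    show ?case using generate.one[of GL] by (simp add: GL_def M_Nil)
  next
    case (Cons i u)
    have "simple_reflection adj i \<in> generate GL (range (simple_reflection adj))"
      by (intro generate.incl) simp
    from generate.eng[OF this Cons] show ?case
      by (simp add: GL_def simple_reflection_eq R_simple M_mult)
  qed
  then show "range M \<subseteq> coxeter_group adj"
    by (auto simp: coxeter_group_def)
qed

section \<open>The reflections of the group and their roots\<close>

lemma R_mem_coxeter_group:
  assumes "root b"
  obtains u where "R b = M u" "\<And>v. act u v = refl b v"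
proof -
  from root_exists_word[OF assms] obtain u i where u: "act u (\<alpha> i) = b" .
  have "act (u @ [i] @ rev u) v = refl b v" for v
    by (simp add: act_refl u)
  moreover from this have "R b = M (u @ [i] @ rev u)"
    by (intro matrix_eqI_emb) (simp only: R_emb M_emb)
  ultimately show thesis using that by blast
qed

lemma fixed_space_R: "root b \<Longrightarrow> fixed_space (R b) = {v. cform b v = 0}"
  using root_nonzero[of b] by (auto simp: fixed_space_def R_mult vec_eq_iff)

lemma subspace_fixed_space: "vec.subspace (fixed_space A)"
  unfolding fixed_space_def by (rule vec.subspaceI)
    (simp_all add: matrix_vector_right_distrib vector_scalar_commute)

text \<open>The root spans a complement of its hyperplane: the component along it has coefficient
  \<open>cform b v / 2\<close>, because the form takes the value 2 at the root itself.\<close>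

lemma dim_fixed_space_R:
  assumes "root b"
  shows "vec.dim (fixed_space (R b)) = CARD('i) - 1"
proof -
  let ?V = "fixed_space (R b)"
  have span: "vec.span ?V = ?V"
    using subspace_fixed_space vec.span_eq_iff by blast
  have "emb b \<notin> ?V"
    using assms by (simp add: fixed_space_R root_def)
  then have "vec.dim (insert (emb b) ?V) = vec.dim ?V + 1"
    by (simp add: vec.dim_insert span)
  moreover have "v \<in> vec.span (insert (emb b) ?V)" for v
    unfolding vec.span_breakdown_eq span
    using assms cform_linear(1)[of b "v - (cform b v / 2) *s emb b" "(cform b v / 2) *s emb b"]
    by (intro exI[of _ "cform b v / 2"]) (simp add: fixed_space_R cform_linear root_def)
  then have "vec.span (insert (emb b) ?V) = UNIV" by blast
  then have "vec.dim (insert (emb b) ?V) = CARD('i)"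
    by (metis vec.dim_span vec_dim_card)
  ultimately show ?thesis by simp
qed

text \<open>A word acting as an orthogonal reflection in some lattice vector \<open>a\<close> acts as the reflection
  in a root: conjugating by a right descent shortens the word by two letters unless the descent
  itself is the reflection.\<close>

lemma act_eq_refl:
  assumes "a \<noteq> 0" "\<And>v. B a a *s (v - act u v) = (2 * B v a) *s a"
  shows "\<exists>b. root b \<and> (\<forall>v. act u v = refl b v)"
  using assms
proof (induction "length u" arbitrary: u a rule: less_induct)
  case less
  have pos: "B a a > 0"
    using form_pos less.prems(1) by simp
  have cancel: "v = w" if "B a a *s v = B a a *s w" for v w
    using that pos by (simp add: vec_eq_iff)
  have "B a a *s (a - act u a) = B a a *s (2 *s a)"
    using less.prems(2)[of a] by (simp add: vec_eq_iff)
  then have "a - act u a = 2 *s a"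
    by (rule cancel)
  then have ua: "act u a = - a"
    by (simp add: vec_eq_iff) (metis add.commute add_diff_cancel_left' diff_add_cancel
        diff_minus_eq_add minus_diff_eq mult_2)
  have Ba: "B (act u v) a = - B v a" for v
    using B_act[of u v a] by (simp add: ua B_linear)
  have "B a a *s act u (act u v) = B a a *s v" for v
  proof -
    have "B a a *s (v - act u (act u v)) = B a a *s (v - act u v) + B a a *s (act u v - act u (act u v))"
      by (simp add: vec_eq_iff right_diff_distrib)
    also have "\<dots> = 0"
      unfolding less.prems(2) Ba by (simp add: vec_eq_iff)
    finally show ?thesis
      by (auto simp: vec_eq_iff right_diff_distrib)
  qed
  then have invol: "act u (act u v) = v" for v
    using cancel by blast
  show ?case
  proof (cases u rule: rev_cases)
    case Nil
    with ua have "a = - a" by simp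
    with less.prems(1) show ?thesis by (simp add: vec_eq_iff)
  next
    case (snoc q i)
    define c where "c = act u (\<alpha> i)"
    have "root c" by (simp add: c_def)
    then consider "nonneg c" | "nonneg (- c)" "c = - \<alpha> i" | "nonneg (- c)" "c \<noteq> - \<alpha> i"
      using root_sign by blast
    then show ?thesis
    proof cases
      case 1
      then have "nonneg (- act q (\<alpha> i))"
        by (simp add: c_def snoc refl_self act_linear)
      then obtain q' where "length q = Suc (length q')" "\<And>v. act q' v = act u v"
        using exchange[of q i] by (auto simp: snoc)
      then show ?thesis
        using less.hyps[of q' a] less.prems by (simp add: snoc)
    next
      case 2
      define m where "m = B (\<alpha> i) a"
      have "B a a *s (2 *s \<alpha> i) = (2 * m) *s a"
        using less.prems(2)[of "\<alpha> i"] 2(2) by (simp add: c_def m_def vec_eq_iff)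
      then have ai: "B a a *s \<alpha> i = m *s a"
        by (simp add: vec_eq_iff)
      have "B (B a a *s \<alpha> i) (B a a *s \<alpha> i) = B (m *s a) (m *s a)"
        by (simp only: ai)
      then have "B a a * (B a a * 2) = m * (m * B a a)"
        by (simp add: B_linear B_simple cartan_def)
      with pos have m2: "m * m = 2 * B a a"
        by simp
      have "act u v = refl (\<alpha> i) v" for v
      proof -
        have "B (B a a *s \<alpha> i) v = B (m *s a) v"
          by (simp only: ai)
        then have Bv: "B a a * B (\<alpha> i) v = m * B v a"
          by (simp add: B_linear B_sym[of a v])
        have "v - act u v = B (\<alpha> i) v *s \<alpha> i"
        proof -
          have "(v - act u v) $ j = B (\<alpha> i) v * \<alpha> i $ j" for j
          proof -
            have 1: "B a a * (v - act u v) $ j = 2 * B v a * a $ j"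
              using less.prems(2)[of v] by (simp add: vec_eq_iff right_diff_distrib)
            have 2: "B a a * \<alpha> i $ j = m * a $ j"
              using ai by (simp add: vec_eq_iff)
            have "B a a * (B a a * (2 * (v - act u v) $ j)) = m * m * (B a a * (v - act u v) $ j)"
              by (simp add: m2)
            also have "\<dots> = 2 * (m * B v a) * (m * a $ j)"
              unfolding 1 by (simp add: ac_simps)
            also have "\<dots> = B a a * (B a a * (2 * (B (\<alpha> i) v * \<alpha> i $ j)))"
              unfolding Bv[symmetric] 2[symmetric] by (simp add: ac_simps)
            finally show ?thesis using pos by simp
          qed
          then show ?thesis by (simp add: vec_eq_iff)
        qed
        then show ?thesis
          by (simp add: refl_def algebra_simps)
      qed
      then show ?thesis using root_simple by blast
    next
      case 3
      \<comment> \<open>Since \<open>u\<close> is an involution, the reverse of \<open>u1\<close>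
        acts as \<open>u\<close> followed by the reflection in \<open>\<alpha> i\<close>. It still
        makes \<open>\<alpha> i\<close> negative, so a second exchange yields the conjugate of
        \<open>u\<close> by that reflection, two letters shorter than \<open>u\<close>.\<close>
      from exchange[of u i] 3(1) obtain u1 where u1: "length u = Suc (length u1)"
        "\<And>v. act u1 v = act u (refl (\<alpha> i) v)" unfolding c_def by blast
      have "act u1 (refl (\<alpha> i) (act u v)) = v" for v
        by (simp add: u1(2) refl_refl invol)
      then have rev: "act (rev u1) v = refl (\<alpha> i) (act u v)" for v
        by (metis act_rev(1))
      have "nonneg (refl (\<alpha> i) (- c))"
        using simple_reflection_nonneg[of "- c" i] 3 \<open>root c\<close> minus_equation_iff[of c "\<alpha> i"] by auto
      then have "nonneg (- act (rev u1) (\<alpha> i))"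
        by (simp add: rev c_def refl_linear)
      from exchange[OF this] obtain u2 where "length (rev u1) = Suc (length u2)"
        "\<And>v. act u2 v = act (rev u1) (refl (\<alpha> i) v)" by blast
      then have u2: "length u2 < length u" "\<And>v. act u2 v = refl (\<alpha> i) (act u (refl (\<alpha> i) v))"
        using u1(1) by (simp_all add: rev)
      let ?a = "refl (\<alpha> i) a"
      have "?a \<noteq> 0"
        using less.prems(1) refl_refl[of "\<alpha> i" a] by (auto simp: refl_def)
      moreover have "B ?a ?a *s (v - act u2 v) = (2 * B v ?a) *s ?a" for v
      proof -
        let ?w = "refl (\<alpha> i) v"
        have "B ?a ?a *s (v - act u2 v) = refl (\<alpha> i) (B a a *s (?w - act u ?w))"
          by (simp add: u2(2) refl_linear refl_refl B_refl)
        also have "\<dots> = (2 * B v ?a) *s ?a"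
          unfolding less.prems(2) refl_linear(2)
          using B_refl[of "\<alpha> i" ?w a] by (simp add: refl_refl)
        finally show ?thesis .
      qed
      ultimately obtain b where b: "root b" "\<And>v. act u2 v = refl b v"
        using less.hyps[OF u2(1)] by blast
      have "act u v = refl (refl (\<alpha> i) b) v" for v
      proof -
        have "act u v = refl (\<alpha> i) (refl b (refl (\<alpha> i) v))"
          unfolding b(2)[symmetric] u2(2) by (simp add: refl_refl)
        also have "\<dots> = refl (refl (\<alpha> i) b) v"
          using act_refl[of "[i]" b "refl (\<alpha> i) v"] by (simp add: refl_refl)
        finally show ?thesis .
      qed
      moreover have "root (refl (\<alpha> i) b)"
        using b(1) by simp
      ultimately show ?thesis by blast
    qed
  qed
qed

text \<open>For the harder inclusion: an element fixing a hyperplane moves all vectors along one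
  direction, which a lattice vector \<open>a\<close> can represent. Invariance of the form forces
  the element to be the orthogonal reflection in \<open>a\<close>, and \<open>act_eq_refl\<close>
  replaces \<open>a\<close> by a root.\<close>

lemma reflections_eq: "reflections adj = R ` Collect root"
proof
  show "R ` Collect root \<subseteq> reflections adj"
  proof safe
    fix b assume b: "root b"
    then obtain u where "R b = M u"
      using R_mem_coxeter_group by blast
    then show "R b \<in> reflections adj"
      using dim_fixed_space_R[OF b] unfolding reflections_def coxeter_group_eq by auto
  qed
  show "reflections adj \<subseteq> R ` Collect root"
  proof
    fix s assume s: "s \<in> reflections adj"
    then obtain u where u: "s = M u"
      by (auto simp: reflections_def coxeter_group_eq)
    let ?V = "fixed_space s"
    have dim: "vec.dim ?V = CARD('i) - 1"
      using s by (simp add: reflections_def)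
    have span: "vec.span ?V = ?V"
      using subspace_fixed_space vec.span_eq_iff by blast
    have "\<exists>v. act u v \<noteq> v"
    proof (rule ccontr)
      assume "\<not> ?thesis"
      then have "M u = M []" by (simp add: M_eq_iff)
      then have "?V = UNIV" by (simp add: u M_Nil fixed_space_def)
      with dim have "CARD('i) = CARD('i) - 1" by (metis vec_dim_card)
      moreover have "CARD('i) > 0" by simp
      ultimately show False by linarith
    qed
    then obtain v0 where v0: "act u v0 \<noteq> v0" by blast
    define a where "a = act u v0 - v0"
    have "emb v0 \<notin> ?V"
      using v0 by (simp add: fixed_space_def u M_emb)
    then have "vec.dim (insert (emb v0) ?V) = CARD('i)"
      using zero_less_card_finite[where 'a = 'i] by (simp add: vec.dim_insert span dim)
    then have "vec.span (insert (emb v0) ?V) = UNIV"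
      by (simp add: vec.dim_eq_full[symmetric] vec.dimension_def card_cart_basis)
    then have "\<exists>k. emb v - k *s emb v0 \<in> ?V" for v
      using vec.span_breakdown_eq[of "emb v" "emb v0" ?V] span by auto
    moreover have "emb (act u v - v) = k *s emb a" if "emb v - k *s emb v0 \<in> ?V" for v k
    proof -
      have "M u *v (emb v - k *s emb v0) = emb v - k *s emb v0"
        using that by (simp add: fixed_space_def u)
      then have "emb (act u v) - k *s emb (act u v0) = emb v - k *s emb v0"
        by (simp add: matrix_vector_mult_diff_distrib vector_scalar_commute M_emb)
      then show ?thesis
        by (simp add: a_def emb_linear vec_eq_iff algebra_simps)
    qed
    ultimately have ex: "\<exists>k. emb (act u v - v) = k *s emb a" for v by blast
    \<comment> \<open>This compares the square lengths of \<open>v0\<close> and of its image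
      \<open>v0 + a\<close>.\<close>
    have B0: "2 * B a v0 = - B a a"
    proof -
      have "B (v0 + a) (v0 + a) = B v0 v0"
        using B_act[of u v0 v0] by (simp add: a_def)
      then show ?thesis by (simp add: B_linear B_sym[of v0 a])
    qed
    \<comment> \<open>The displacement of \<open>v\<close> is a complex multiple \<open>k\<close> of
      \<open>a\<close>. Invariance of the inner product with \<open>v0\<close> together with
      \<open>B0\<close> gives \<open>k * B a a = - 2 * B v a\<close>, so the multiple of
      \<open>a\<close> is that of the orthogonal reflection.\<close>
    have "B a a *s (v - act u v) = (2 * B v a) *s a" for v
    proof -
      from ex obtain k where k: "emb (act u v - v) = k *s emb a" by blast
      define d where "d = act u v - v"
      have dk: "of_int (d $ i) = k * of_int (a $ i)" for i
        using k by (simp add: d_def vec_eq_iff)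
      have Bd: "of_int (B d x) = k * of_int (B a x)" for x
        by (simp add: B_expand[of d x] B_expand[of a x] dk sum_distrib_left mult.assoc)
      have "B (v + d) (v0 + a) = B v v0"
        using B_act[of u v v0] by (simp add: a_def d_def)
      then have "B d v0 + B v a + B d a = 0"
        by (simp add: B_linear)
      then have "of_int (B d v0) + of_int (B v a) + of_int (B d a) = (0::complex)"
        by (metis of_int_0 of_int_add)
      then have "2 * (of_int (B d v0) + of_int (B v a) + of_int (B d a)) = (0::complex)"
        by simp
      then have "k * of_int (2 * B a v0) + 2 * of_int (B v a) + 2 * (k * of_int (B a a)) = (0::complex)"
        by (simp add: Bd algebra_simps)
      then have kB: "k * of_int (B a a) = - 2 * (of_int (B v a) :: complex)"
        unfolding B0 by (simp add: algebra_simps eq_neg_iff_add_eq_0)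
      have "of_int (B a a * (- d $ i)) = (of_int (2 * B v a * a $ i) :: complex)" for i
      proof -
        have "of_int (B a a * (- d $ i)) = - (k * of_int (B a a)) * (of_int (a $ i) :: complex)"
          by (simp add: dk)
        then show ?thesis by (simp add: kB)
      qed
      then have "B a a * (- d $ i) = 2 * B v a * a $ i" for i
        using of_int_eq_iff by blast
      then show ?thesis
        by (simp add: vec_eq_iff d_def right_diff_distrib)
    qed
    moreover have "a \<noteq> 0" using v0 by (simp add: a_def)
    ultimately obtain b where b: "root b" "\<And>v. act u v = refl b v"
      using act_eq_refl[of a u] by blast
    then have "s = R b"
      unfolding u by (intro matrix_eqI_emb) (simp add: M_emb R_emb)
    with b(1) show "s \<in> R ` Collect root" by blast
  qed
qed

lemma R_uminus [simp]: "R (- b) = R b"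
  by (rule matrix_eqI_emb) (simp add: R_emb refl_uminus)

lemma R_eq_iff:
  assumes "root b" "root c"
  shows "R b = R c \<longleftrightarrow> c = b \<or> c = - b"
proof
  assume "R b = R c"
  then have "refl b c = refl c c"
    by (metis R_emb emb_eq_iff)
  then have *: "B b c *s b = 2 *s c"
    using assms(2) by (simp add: refl_def root_def)
  from root_cases_form[OF assms] show "c = b \<or> c = - b"
  proof cases
    case 3
    with * have "c = 0" by (simp add: vec_eq_iff)
    with root_nonzero[OF assms(2)] show ?thesis by blast
  next
    case 4
    have "B c (B b c *s b) = B c (2 *s c)" by (simp only: *)
    with 4 assms show ?thesis by (simp add: B_linear root_def B_sym[of c b])
  next
    case 5
    have "B c (B b c *s b) = B c (2 *s c)" by (simp only: *)
    with 5 assms show ?thesis by (simp add: B_linear root_def B_sym[of c b])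
  qed auto
qed auto

section \<open>Conjugation and pairs of reflections\<close>

lemma M_conj_R: "M u ** R b ** matrix_inv (M u) = R (act u b)"
  unfolding matrix_inv_M
  by (rule matrix_eqI_emb) (simp add: M_emb R_emb act_refl flip: matrix_vector_mul_assoc)

lemma R_conj_R: "root d \<Longrightarrow> R d ** R c ** R d = R (refl d c)"
proof (rule matrix_eqI_emb)
  fix v assume d: "root d"
  from R_mem_coxeter_group[OF d] obtain u where "\<And>v. act u v = refl d v" by metis
  then show "R d ** R c ** R d *v emb v = R (refl d c) *v emb v"
    using act_refl[of u c "refl d v"] d
    by (simp add: R_emb refl_refl flip: matrix_vector_mul_assoc)
qed

text \<open>If the roots are not orthogonal, reflecting \<open>b\<close> in \<open>c\<close> gives a
  third root in their span. If they are orthogonal, a root \<open>d\<close> in their span satisfies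
  \<open>(B d b)\<^sup>2 + (B d c)\<^sup>2 = 4\<close>, which is impossible unless \<open>d\<close>
  is one of the two up to sign.\<close>

lemma reflections_containing_eq_iff:
  assumes b: "root b" and c: "root c" and ne: "R b \<noteq> R c"
  shows "reflections_containing adj (fixed_space (R b) \<inter> fixed_space (R c)) = {R b, R c}
    \<longleftrightarrow> B b c = 0"
proof
  assume eq: "reflections_containing adj (fixed_space (R b) \<inter> fixed_space (R c)) = {R b, R c}"
  show "B b c = 0"
  proof (rule ccontr)
    assume "B b c \<noteq> 0"
    with root_cases_form[OF b c] ne R_eq_iff[OF b c] have B1: "B b c = 1 \<or> B b c = - 1"
      by blast
    define d where "d = refl c b"
    have d: "root d" "d = b - B c b *s c"
      using b c by (simp_all add: d_def) (simp add: refl_def)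
    have "R d \<in> reflections_containing adj (fixed_space (R b) \<inter> fixed_space (R c))"
      using d(1) unfolding reflections_containing_def reflections_eq
      by (auto simp: fixed_space_R b c d(1)) (simp add: d(2) cform_diff_left cform_smult_left)
    then have "b = d \<or> b = - d \<or> c = d \<or> c = - d"
      using eq R_eq_iff[OF d(1) b] R_eq_iff[OF d(1) c] by auto
    then have "B d b = 2 \<or> B d b = - 2 \<or> B d c = 2 \<or> B d c = - 2"
      using d(1) by (elim disjE) (simp_all add: B_linear root_def)
    moreover have "B d b = 2 - B b c * B b c" "B d c = - B b c"
      using b c by (simp_all add: d(2) B_linear root_def B_sym[of c b])
    ultimately show False
      using B1 by auto
  qed
next
  assume bc: "B b c = 0"
  have "r = R b \<or> r = R c"
    if "r \<in> reflections_containing adj (fixed_space (R b) \<inter> fixed_space (R c))" for r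
  proof -
    from that obtain d where d: "root d" "r = R d"
      and "fixed_space (R b) \<inter> fixed_space (R c) \<subseteq> fixed_space (R d)"
      by (auto simp: reflections_containing_def reflections_eq)
    then have sub: "cform d v = 0" if "cform b v = 0" "cform c v = 0" for v
      using that b c by (auto simp: fixed_space_R)
    \<comment> \<open>Twice the component of \<open>d\<close> orthogonal to \<open>b\<close> and
      \<open>c\<close>. It lies in both hyperplanes, hence in that of \<open>d\<close>.\<close>
    let ?v = "2 *s d - B d b *s b - B d c *s c"
    have "B b ?v = 0" "B c ?v = 0"
      using b c bc by (simp_all add: B_linear root_def B_sym[of c b] B_sym[of b d] B_sym[of c d])
    then have "B d ?v = 0"
      using sub[of "emb ?v"] by simp
    then have "B d b * B d b + B d c * B d c = 4"
      using d(1) by (simp add: B_linear root_def)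
    moreover have "x = d \<or> x = - d \<or> B d x * B d x \<le> 1" if "root x" for x
      by (rule root_cases_form[OF d(1) that]) auto
    from this[OF b] this[OF c] have "b = d \<or> b = - d \<or> c = d \<or> c = - d
        \<or> B d b * B d b + B d c * B d c \<le> 2" by auto
    ultimately have "b = d \<or> b = - d \<or> c = d \<or> c = - d" by simp
    then show ?thesis
      using R_eq_iff[OF d(1) b] R_eq_iff[OF d(1) c] d(2) by auto
  qed
  moreover have "R b \<in> reflections_containing adj (fixed_space (R b) \<inter> fixed_space (R c))"
    "R c \<in> reflections_containing adj (fixed_space (R b) \<inter> fixed_space (R c))"
    using b c by (auto simp: reflections_containing_def reflections_eq)
  ultimately show "reflections_containing adj (fixed_space (R b) \<inter> fixed_space (R c)) = {R b, R c}"
    by blast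
qed

text \<open>The root \<open>d\<close> is the reflection of \<open>b\<close> in \<open>c\<close>, the
  third positive or negative root of the rank two system spanned by \<open>b\<close> and
  \<open>c\<close>. For uniqueness, a root \<open>e\<close> whose reflection takes \<open>c\<close>
  to \<open>h *s b\<close>, where \<open>h\<close> is a sign, is proportional to
  \<open>c - h *s b\<close>; comparing square lengths fixes \<open>h\<close> and the factor up to
  sign.\<close>

lemma transporters_eq:
  assumes b: "root b" and c: "root c" and B1: "\<bar>B b c\<bar> = 1"
  defines "d \<equiv> b - B b c *s c"
  shows "root d" "\<bar>B b d\<bar> = 1" "refl d c = b \<or> refl d c = - b"
    "transporters adj (R b) (R c) = {R d}"
proof -
  have sq: "B b c * B b c = 1"
    using B1 by (auto simp: abs_eq_iff')
  show d: "root d"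
    using b c sq by (simp add: d_def root_def B_linear B_sym[of c b])
  show "\<bar>B b d\<bar> = 1"
    using b sq by (simp add: d_def root_def B_linear)
  have "B d c = - B b c"
    using c by (simp add: d_def root_def B_linear)
  then have "refl d c = B b c *s b"
    using sq by (simp add: refl_def d_def vec_eq_iff algebra_simps)
  then show dc: "refl d c = b \<or> refl d c = - b"
    using B1 by (auto simp: abs_eq_iff' vec_eq_iff)
  have "R e = R d" if e: "root e" "R e ** R c ** R e = R b" for e
  proof -
    have "R b = R (refl e c)"
      using e by (simp add: R_conj_R)
    then have "refl e c = b \<or> refl e c = - b"
      using R_eq_iff[OF b, of "refl e c"] e(1) c by simp
    then obtain h where h: "h = 1 \<or> h = - 1" "refl e c = h *s b"
      by (metis vector_smult_lid vector_smult_lneg)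
    define x y where "x = B e c" and "y = x * x"
    have xe: "x *s e = c - h *s b"
      using h(2) by (simp add: refl_def x_def algebra_simps)
    have "B (x *s e) (x *s e) = B (c - h *s b) (c - h *s b)"
      by (simp only: xe)
    \<comment> \<open>As \<open>h * B b c\<close> is a sign, \<open>y\<close> is 1 or 3; as the
      square of an inner product of roots it is 0, 1 or 4. Only 1 survives.\<close>
    then have "2 * y = 4 - 2 * (h * B b c)"
      using h(1) e(1) b c by (auto simp: B_linear root_def B_sym[of c b] y_def)
    moreover have "y = 0 \<or> y = 1 \<or> y = 4"
      by (rule root_cases_form[OF e(1) c])
        (use e(1) in \<open>simp_all add: x_def y_def root_def B_linear\<close>)
    moreover have \<epsilon>: "B b c = 1 \<or> B b c = - 1"
      using B1 by auto
    ultimately have y: "y = 1" "h = B b c"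
      using h(1) by auto
    have "- B b c *s d = (B b c * B b c) *s c - B b c *s b"
      by (simp add: d_def vec_eq_iff algebra_simps)
    then have xd: "x *s e = - B b c *s d"
      using xe y(2) sq by simp
    have "e = (x * x) *s e"
      using y(1) by (simp add: y_def)
    also have "\<dots> = (x * - B b c) *s d"
      unfolding vector_smult_assoc[symmetric] xd by simp
    finally have "e = (x * - B b c) *s d" .
    moreover have "x = 1 \<or> x = - 1"
      using y(1) by (simp add: y_def square_eq_1_iff)
    then have "x * - B b c = 1 \<or> x * - B b c = - 1"
      using \<epsilon> by auto
    ultimately have "e = d \<or> e = - d"
      by (metis vector_smult_lid vector_smult_lneg)
    then show ?thesis by auto
  qed
  moreover have "R d ** R c ** R d = R b"
    using dc by (auto simp: R_conj_R[OF d])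
  ultimately show "transporters adj (R b) (R c) = {R d}"
    using d unfolding transporters_def reflections_eq by blast
qed

text \<open>For joined nodes \<open>j\<close> and \<open>k\<close>, reflecting
  \<open>\<alpha> j\<close> in \<open>\<alpha> k\<close> and then in \<open>\<alpha> j\<close> gives
  \<open>\<alpha> k\<close>. By connectedness all simple roots form one orbit, and every root lies
  in the orbit of a simple one.\<close>

lemma reflections_conjugate:
  assumes "\<And>i j. adj\<^sup>*\<^sup>* i j" "s \<in> reflections adj" "t \<in> reflections adj"
  shows "\<exists>w\<in>coxeter_group adj. w ** t ** matrix_inv w = s"
proof -
  have simple: "\<exists>w. act w (\<alpha> i) = \<alpha> j" for i j
    using assms(1)[of i j]
  proof (induction rule: rtranclp_induct)
    case base
    show ?case by (metis act_simps(1))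
  next
    case (step j k)
    then obtain w where w: "act w (\<alpha> i) = \<alpha> j" by blast
    have "refl (\<alpha> k) (\<alpha> j) = \<alpha> j + \<alpha> k" "refl (\<alpha> j) (\<alpha> k) = \<alpha> k + \<alpha> j"
      using step(2) adj_sym adj_irrefl by (auto simp: refl_def B_simple cartan_def vec_eq_iff)
    then have "refl (\<alpha> j) (refl (\<alpha> k) (\<alpha> j)) = \<alpha> k"
      by (metis add.commute refl_refl root_simple)
    then have "act (j # k # w) (\<alpha> i) = \<alpha> k" by (simp add: w)
    then show ?case by blast
  qed
  from assms(2,3) obtain b c where bc: "root b" "root c" "s = R b" "t = R c"
    by (auto simp: reflections_eq)
  from root_exists_word[OF bc(1)] root_exists_word[OF bc(2)] obtain u i v j
    where "act u (\<alpha> i) = b" "act v (\<alpha> j) = c" by metis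
  moreover obtain w where "act w (\<alpha> j) = \<alpha> i" using simple by blast
  ultimately have "act (u @ w @ rev v) c = b"
    using act_rev(1)[of v "\<alpha> j"] by auto
  then have "M (u @ w @ rev v) ** t ** matrix_inv (M (u @ w @ rev v)) = s"
    by (simp add: M_conj_R bc)
  then show ?thesis by (auto simp: coxeter_group_eq)
qed

end

section \<open>The two algebras\<close>

context presentation
begin

text \<open>Outside the carrier, left multiplication is the identity, so that identities between these
  operators hold without side conditions on their argument.\<close>

definition lmul :: "'g nc_poly \<Rightarrow> 'g nc_poly set \<Rightarrow> 'g nc_poly set" where
  "lmul p A = (if A \<in> cls ` nc_span X then cls (p * (SOME a. a \<in> nc_span X \<and> A = cls a)) else A)"

lemma lmul_cls:
  assumes "p \<in> nc_span X" "a \<in> nc_span X"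
  shows "lmul p (cls a) = cls (p * a)"
proof -
  let ?b = "SOME b. b \<in> nc_span X \<and> cls a = cls b"
  have "?b \<in> nc_span X \<and> cls a = cls ?b"
    by (rule someI[of _ a]) (simp add: assms)
  then have "p * ?b \<doteq> p * a"
    using assms by (intro eqv_mult) (auto simp: cls_eq_iff intro: eqv_sym)
  then show ?thesis
    using imageI[OF assms(2), of cls] by (simp add: lmul_def cls_eq_iff)
qed

lemma lmul_cong:
  assumes "p \<doteq> q" "p \<in> nc_span X" "q \<in> nc_span X"
  shows "lmul p A = lmul q A"
proof (cases "A \<in> cls ` nc_span X")
  case True
  then obtain a where "a \<in> nc_span X" "A = cls a" by blast
  then show ?thesis
    using assms by (simp add: lmul_cls cls_eq_iff eqv_mult)
qed (simp add: lmul_def)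

lemma lmul_mult:
  assumes "p \<in> nc_span X" "q \<in> nc_span X"
  shows "lmul (p * q) A = lmul p (lmul q A)"
proof (cases "A \<in> cls ` nc_span X")
  case True
  then obtain a where "a \<in> nc_span X" "A = cls a" by blast
  then show ?thesis
    using assms by (simp add: lmul_cls nc_span_closed(5) mult.assoc)
qed (simp add: lmul_def)

lemma lmul_1 [simp]: "lmul 1 A = A"
proof (cases "A \<in> cls ` nc_span X")
  case True
  then obtain a where "a \<in> nc_span X" "A = cls a" by blast
  then show ?thesis by (simp add: lmul_cls nc_span_closed(2))
qed (simp add: lmul_def)

text \<open>Faithfulness of the regular representation, seen on the class of 1. It lets congruences
  be proved as identities of functions.\<close>

lemma eqv_if_lmul:
  assumes "\<And>A. lmul p A = lmul q A" "p \<in> nc_span X" "q \<in> nc_span X"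
  shows "p \<doteq> q"
  using assms(1)[of "cls 1"] assms(2,3) by (simp add: lmul_cls nc_span_closed(2) cls_eq_iff)

end

definition s_word :: "'i list \<Rightarrow> 'i brauer_gen nc_poly" where
  "s_word u = prod_list (map s_gen u)"

lemma scal_left_comm: "p * (scal c * q) = scal c * (p * q)"
  by (metis mult.assoc scal_comm)

locale brauer_pair = simply_laced adj for adj :: "'i::finite \<Rightarrow> 'i \<Rightarrow> bool" +
  fixes \<tau> :: complex
begin

sublocale C: presentation "UNIV :: 'i brauer_gen set" "cgw_relations adj \<tau>"
  by unfold_locales simp

lemma cgw_lmul: "(p, q) \<in> cgw_relations adj \<tau> \<Longrightarrow> C.lmul p A = C.lmul q A"
  by (rule C.lmul_cong) (simp_all add: C.eqv_rels)

sublocale brauer_operators adj "\<lambda>i. C.lmul (s_gen i)" "\<lambda>i. C.lmul (e_gen i)" "C.lmul (scal \<tau>)"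
proof
  note [simp] = C.lmul_mult[symmetric]
  fix i j :: 'i and A
  show "C.lmul (s_gen i) (C.lmul (s_gen i) A) = A"
    using cgw_lmul[OF cgw_relations.intros(1)] by simp
  show "C.lmul (s_gen i) (C.lmul (e_gen i) A) = C.lmul (e_gen i) A"
    using cgw_lmul[OF cgw_relations.intros(4)] by simp
  show "C.lmul (e_gen i) (C.lmul (s_gen i) A) = C.lmul (e_gen i) A"
    using cgw_lmul[OF cgw_relations.intros(5)] by simp
  show "C.lmul (e_gen i) (C.lmul (e_gen i) A) = C.lmul (scal \<tau>) (C.lmul (e_gen i) A)"
    using cgw_lmul[OF cgw_relations.intros(6)] by simp
  show "C.lmul (scal \<tau>) (C.lmul (s_gen i) A) = C.lmul (s_gen i) (C.lmul (scal \<tau>) A)"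
    by (simp add: scal_comm)
  show "C.lmul (s_gen i) (C.lmul (s_gen j) (C.lmul (s_gen i) A))
      = C.lmul (s_gen j) (C.lmul (s_gen i) (C.lmul (s_gen j) A))" if "adj i j"
    using cgw_lmul[OF cgw_relations.intros(2)[where adj = adj, OF that]] by (simp add: mult.assoc)
  show "C.lmul (s_gen i) (C.lmul (s_gen j) (C.lmul (e_gen i) A))
      = C.lmul (e_gen j) (C.lmul (s_gen i) (C.lmul (s_gen j) A))" if "adj i j"
    using cgw_lmul[OF cgw_relations.intros(7)[where adj = adj, OF that]] by (simp add: mult.assoc)
  show "C.lmul (e_gen i) (C.lmul (s_gen j) (C.lmul (e_gen i) A)) = C.lmul (e_gen i) A" if "adj i j"
    using cgw_lmul[OF cgw_relations.intros(8)[where adj = adj, OF that]] by (simp add: mult.assoc)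
  show "C.lmul (s_gen i) (C.lmul (s_gen j) A) = C.lmul (s_gen j) (C.lmul (s_gen i) A)"
    and "C.lmul (s_gen i) (C.lmul (e_gen j) A) = C.lmul (e_gen j) (C.lmul (s_gen i) A)"
    and "C.lmul (e_gen i) (C.lmul (e_gen j) A) = C.lmul (e_gen j) (C.lmul (e_gen i) A)"
    if "i \<noteq> j" "\<not> adj i j"
    using cgw_lmul[OF cgw_relations.intros(3)[where adj = adj, OF that]]
      cgw_lmul[OF cgw_relations.intros(9)[where adj = adj, OF that]]
      cgw_lmul[OF cgw_relations.intros(10)[where adj = adj, OF that]] by simp_all
qed

lemma lmul_s_word: "C.lmul (s_word u) A = F u A"
  by (induction u arbitrary: A) (simp_all add: s_word_def C.lmul_mult)

end

section \<open>Rescaling the parameters\<close>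

context simply_laced
begin

abbreviation group_gens :: "(complex^'i^'i) brauer_gen set" where
  "group_gens \<equiv> GenS ` coxeter_group adj \<union> GenE ` reflections adj"

lemma reflections_subset: "reflections adj \<subseteq> coxeter_group adj"
  by (auto simp: reflections_def)

lemma coxeter_group_closed:
  "mat 1 \<in> coxeter_group adj"
  "w1 \<in> coxeter_group adj \<Longrightarrow> w2 \<in> coxeter_group adj \<Longrightarrow> w1 ** w2 \<in> coxeter_group adj"
  using M_Nil by (auto simp: coxeter_group_eq M_mult) (metis rangeI)

lemma gen_closed:
  "w \<in> coxeter_group adj \<Longrightarrow> s_gen w \<in> nc_span group_gens"
  "s \<in> reflections adj \<Longrightarrow> e_gen s \<in> nc_span group_gens"
  by (simp_all add: nc_span_closed(8))

lemma presentation_group: "presentation group_gens (group_brauer_relations adj \<mu> \<tau>)"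
proof
  fix a b assume "(a, b) \<in> group_brauer_relations adj \<mu> \<tau>"
  then show "a \<in> nc_span group_gens \<and> b \<in> nc_span group_gens"
  proof cases
    case (8 s t)
    have "(\<Sum>r\<in>transporters adj s t. scal (\<mu> r) * s_gen r) \<in> nc_span group_gens"
    proof (rule nc_span_sum)
      fix r assume "r \<in> transporters adj s t"
      then have "r \<in> coxeter_group adj"
        using reflections_subset by (auto simp: transporters_def)
      then show "scal (\<mu> r) * s_gen r \<in> nc_span group_gens"
        by (intro nc_span_closed(5) nc_span_closed(3) gen_closed)
    qed
    with 8 show ?thesis by (auto intro!: nc_span_closed(5) gen_closed)
  qed (use reflections_subset in
      \<open>auto intro!: nc_span_closed(1-5) gen_closed coxeter_group_closed\<close>)
qed

text \<open>Sending each \<open>e_gen s\<close> to its \<open>c\<close>-fold multiple turns every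
  relation for \<open>\<mu>\<close>, \<open>\<tau>\<close> into a scalar multiple of the
  corresponding relation for \<open>\<mu>'\<close>, \<open>\<tau>'\<close>. Products of two such
  generators carry \<open>c * c\<close>; on a side with only one, the missing factor
  \<open>c\<close> comes from the parameter.\<close>

lemma scaled_compat:
  assumes "\<And>s. s \<in> reflections adj \<Longrightarrow> \<mu> s = c * \<mu>' s"
    and "\<And>s. s \<in> reflections adj \<Longrightarrow> \<tau> s = c * \<tau>' s"
  shows "presentation_pair.compat group_gens (group_brauer_relations adj \<mu> \<tau>)
    group_gens (group_brauer_relations adj \<mu>' \<tau>')
    (case_brauer_gen s_gen (\<lambda>s. scal c * e_gen s))"
proof -
  interpret P: presentation group_gens "group_brauer_relations adj \<mu> \<tau>"
    by (rule presentation_group)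
  interpret Q: presentation group_gens "group_brauer_relations adj \<mu>' \<tau>'"
    by (rule presentation_group)
  interpret PQ: presentation_pair group_gens "group_brauer_relations adj \<mu> \<tau>"
    group_gens "group_brauer_relations adj \<mu>' \<tau>'" ..
  let ?f = "case_brauer_gen s_gen (\<lambda>s. scal c * e_gen s)"
  have scale: "Q.eqv (subst ?f a) (subst ?f b)"
    if "(a', b') \<in> group_brauer_relations adj \<mu>' \<tau>'" "subst ?f a = scal k * a'" "subst ?f b = scal k * b'"
    for a b a' b' k
    unfolding that(2,3) using Q.rels_closed[OF that(1)]
    by (intro Q.eqv_mult Q.eqv_refl Q.eqv_rels[OF that(1)]) (simp_all add: nc_span_closed(3))
  show ?thesis
    unfolding PQ.compat_def
  proof safe
    fix w assume "w \<in> coxeter_group adj"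
    then show "?f (GenS w) \<in> nc_span group_gens"
      by (simp add: gen_closed)
  next
    fix s assume "s \<in> reflections adj"
    then show "?f (GenE s) \<in> nc_span group_gens"
      by (simp add: gen_closed nc_span_closed(3,5))
  next
    fix a b assume "(a, b) \<in> group_brauer_relations adj \<mu> \<tau>"
    then show "Q.eqv (subst ?f a) (subst ?f b)"
    proof cases
      case (1 w1 w2 w3)
      show ?thesis
        by (rule scale[OF group_brauer_relations.intros(1)[OF 1(3-6)], of _ 1]) (simp_all add: 1 subst_mult)
    next
      case 2
      show ?thesis
        by (rule scale[OF group_brauer_relations.intros(2), of _ 1]) (simp_all add: 2)
    next
      case (3 s)
      show ?thesis
        by (rule scale[OF group_brauer_relations.intros(3)[OF 3(3)], of _ c])
          (simp_all add: 3 subst_mult scal_left_comm)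
    next
      case (4 s)
      show ?thesis
        by (rule scale[OF group_brauer_relations.intros(4)[OF 4(3)], of _ c])
          (simp_all add: 4 subst_mult mult.assoc)
    next
      case (5 s)
      show ?thesis
        by (rule scale[OF group_brauer_relations.intros(5)[OF 5(3)], of _ "c * c"])
          (simp_all add: 5 subst_mult scal_mult mult.assoc scal_left_comm[of "e_gen s"]
            assms(2)[OF 5(3)] scal_left_comm[of "scal (\<tau>' s)" c])
    next
      case (6 w s t)
      show ?thesis
        by (rule scale[OF group_brauer_relations.intros(6)[OF 6(3-6)], of _ c])
          (simp_all add: 6 subst_mult scal_left_comm mult.assoc)
    next
      case (7 s t)
      show ?thesis
        by (rule scale[OF group_brauer_relations.intros(7)[OF 7(3-6)], of _ "c * c"])
          (simp_all add: 7 subst_mult scal_mult mult.assoc scal_left_comm[of "e_gen _"])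
    next
      case (8 s t)
      have "(\<Sum>r\<in>transporters adj s t. scal (\<mu> r) * s_gen r)
          = scal c * (\<Sum>r\<in>transporters adj s t. scal (\<mu>' r) * s_gen r)"
        by (auto simp: sum_distrib_left transporters_def assms(1) scal_mult mult.assoc intro!: sum.cong)
      moreover have "subst ?f ((\<Sum>r\<in>transporters adj s t. scal (\<mu> r) * s_gen r) * e_gen t)
          = (\<Sum>r\<in>transporters adj s t. scal (\<mu> r) * s_gen r) * (scal c * e_gen t)"
        by (simp add: subst_mult subst_sum)
      ultimately have "subst ?f b
          = scal (c * c) * ((\<Sum>r\<in>transporters adj s t. scal (\<mu>' r) * s_gen r) * e_gen t)"
        by (simp add: 8(2) scal_mult mult.assoc scal_left_comm[of "sum _ _"])
      then show ?thesis
        by (intro scale[OF group_brauer_relations.intros(8)[OF 8(3-7)], of _ "c * c"])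
          (simp_all add: 8(1) subst_mult scal_mult mult.assoc scal_left_comm[of "e_gen _"])
    next
      case (9 s t)
      show ?thesis
        by (rule scale[OF group_brauer_relations.intros(9)[OF 9(3-7)], of _ "c * c"])
          (simp_all add: 9 subst_mult scal_mult mult.assoc scal_left_comm[of "e_gen _"])
    qed
  qed
qed

lemma group_brauer_algebra_rescale:
  assumes "c \<noteq> 0"
    and \<mu>: "\<And>s. s \<in> reflections adj \<Longrightarrow> \<mu> s = c * \<mu>' s"
    and \<tau>: "\<And>s. s \<in> reflections adj \<Longrightarrow> \<tau> s = c * \<tau>' s"
  shows "group_brauer_algebra adj \<mu> \<tau> \<cong>\<^sub>a\<^sub>l\<^sub>g group_brauer_algebra adj \<mu>' \<tau>'"
proof -
  interpret P: presentation group_gens "group_brauer_relations adj \<mu> \<tau>"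
    by (rule presentation_group)
  interpret Q: presentation group_gens "group_brauer_relations adj \<mu>' \<tau>'"
    by (rule presentation_group)
  have inv: "scal c * (scal (1 / c) * p) = p" "scal (1 / c) * (scal c * p) = p"
    for p :: "(complex^'i^'i) brauer_gen nc_poly"
    using \<open>c \<noteq> 0\<close> by (simp_all flip: mult.assoc scal_mult)
  show ?thesis
    unfolding group_brauer_algebra_def
  proof (rule presented_algebra_iso[OF _ scaled_compat[OF \<mu> \<tau>] scaled_compat[of _ "1 / c"]])
    show "presentation_pair group_gens (group_brauer_relations adj \<mu> \<tau>)
        group_gens (group_brauer_relations adj \<mu>' \<tau>')" ..
  qed (use \<open>c \<noteq> 0\<close> \<mu> \<tau> in \<open>auto simp: subst_mult inv\<close>)
qed

end

section \<open>From the group presentation to the diagram presentation\<close>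

context brauer_pair
begin

sublocale G: presentation group_gens "group_brauer_relations adj (\<lambda>_. 1) (\<lambda>_. \<tau>)"
  by (rule presentation_group)

sublocale GC: presentation_pair group_gens "group_brauer_relations adj (\<lambda>_. 1) (\<lambda>_. \<tau>)"
  UNIV "cgw_relations adj \<tau>" ..

sublocale CG: presentation_pair UNIV "cgw_relations adj \<tau>"
  group_gens "group_brauer_relations adj (\<lambda>_. 1) (\<lambda>_. \<tau>)" ..

text \<open>Words and roots representing a matrix are chosen arbitrarily. Different choices give
  congruent elements, which is seen after passing to left multiplications.\<close>

definition to_cgw :: "(complex^'i^'i) brauer_gen \<Rightarrow> 'i brauer_gen nc_poly" where
  "to_cgw x = (case x of
      GenS A \<Rightarrow> s_word (SOME u. A = M u)
    | GenE A \<Rightarrow> (let (u, i) = SOME (u, i). A = R (act u (\<alpha> i)) in s_word u * e_gen i * s_word (rev u)))"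

definition of_cgw :: "'i brauer_gen \<Rightarrow> (complex^'i^'i) brauer_gen nc_poly" where
  "of_cgw x = (case x of GenS i \<Rightarrow> s_gen (R (\<alpha> i)) | GenE i \<Rightarrow> e_gen (R (\<alpha> i)))"

lemma to_cgw_GenS:
  obtains w where "to_cgw (GenS (M u)) = s_word w" "M w = M u"
  using someI[of "\<lambda>w. M u = M w" u] by (auto simp: to_cgw_def)

lemma to_cgw_GenE:
  assumes "root b"
  obtains w i where "to_cgw (GenE (R b)) = s_word w * e_gen i * s_word (rev w)"
    "R (act w (\<alpha> i)) = R b"
proof -
  from root_exists_word[OF assms] obtain u j where u: "act u (\<alpha> j) = b" .
  obtain w i where wi: "(SOME (w, i). R b = R (act w (\<alpha> i))) = (w, i)" by fastforce
  have "case (w, i) of (w, i) \<Rightarrow> R b = R (act w (\<alpha> i))"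
    unfolding wi[symmetric] by (rule someI[of _ "(u, j)"]) (simp add: u)
  then have "R (act w (\<alpha> i)) = R b" by simp
  moreover have "to_cgw (GenE (R b)) = s_word w * e_gen i * s_word (rev w)"
    by (simp add: to_cgw_def wi)
  ultimately show thesis using that by blast
qed

lemma lmul_to_cgw_M: "C.lmul (to_cgw (GenS (M u))) A = F u A"
proof -
  obtain w where w: "to_cgw (GenS (M u)) = s_word w" "M w = M u" by (rule to_cgw_GenS)
  then have "F w A = F u A"
    by (intro F_cong) (simp add: M_eq_iff)
  then show ?thesis by (simp add: w lmul_s_word)
qed

lemma lmul_to_cgw_R:
  assumes "root b"
  shows "C.lmul (to_cgw (GenS (R b))) A = SS b A"
proof -
  from SS_eq_F[OF assms] obtain w where w: "\<And>x. SS b x = F w x" "\<And>v. act w v = refl b v"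
    by blast
  have "R b = M w"
    by (rule matrix_eqI_emb) (simp add: R_emb M_emb w(2))
  then show ?thesis
    by (simp add: lmul_to_cgw_M w(1))
qed

lemma lmul_to_cgw_E:
  assumes "root b"
  shows "C.lmul (to_cgw (GenE (R b))) A = EE b A"
proof -
  obtain w i where w: "to_cgw (GenE (R b)) = s_word w * e_gen i * s_word (rev w)"
    "R (act w (\<alpha> i)) = R b" by (rule to_cgw_GenE[OF assms])
  have "EE (act w (\<alpha> i)) A = EE b A"
    using w(2) R_eq_iff[of "act w (\<alpha> i)" b] assms by auto
  then show ?thesis
    by (simp add: w C.lmul_mult lmul_s_word EE_eq[OF refl])
qed

lemma EE_cong: "R b = R c \<Longrightarrow> root b \<Longrightarrow> root c \<Longrightarrow> EE b A = EE c A"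
  by (auto simp: R_eq_iff)

lemma nonorthogonal:
  assumes "root b" "root c" "R b \<noteq> R c"
    "reflections_containing adj (fixed_space (R b) \<inter> fixed_space (R c)) \<noteq> {R b, R c}"
  shows "\<bar>B b c\<bar> = 1"
proof -
  have "B b c \<noteq> 0"
    using assms(4) reflections_containing_eq_iff[OF assms(1-3)] by simp
  then show ?thesis
    using assms(3) by (cases rule: root_cases_form[OF assms(1,2)]) simp_all
qed

text \<open>Under left multiplication the images of the generators become \<open>F\<close>,
  \<open>SS\<close> and \<open>EE\<close>, so each relation is one of the operator identities, once
  matrices are replaced by words and roots.\<close>

lemma compat_to_cgw: "GC.compat to_cgw"
  unfolding GC.compat_def
proof (intro conjI ballI)
  fix ab assume "ab \<in> group_brauer_relations adj (\<lambda>_. 1) (\<lambda>_. \<tau>)"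
  moreover obtain a b where "ab = (a, b)" by (cases ab)
  moreover have "C.eqv (subst to_cgw a) (subst to_cgw b)"
    if "(a, b) \<in> group_brauer_relations adj (\<lambda>_. 1) (\<lambda>_. \<tau>)" for a b
  proof (rule C.eqv_if_lmul)
    fix A
    show "C.lmul (subst to_cgw a) A = C.lmul (subst to_cgw b) A"
      using that
    proof cases
      case (1 w1 w2 w3)
      then obtain u1 u2 u3 where u: "w1 = M u1" "w2 = M u2" "w3 = M u3"
        by (auto simp: coxeter_group_eq)
      then have "F (u1 @ u2) A = F u3 A"
        using 1(6) by (intro F_cong) (simp only: M_mult M_eq_iff)
      then show ?thesis
        by (simp add: 1(1,2) u subst_mult C.lmul_mult lmul_to_cgw_M)
    next
      case 2
      then show ?thesis
        using lmul_to_cgw_M[of "[]" A] by (simp add: M_Nil)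
    next
      case (3 s)
      then obtain b where "root b" "s = R b" by (auto simp: reflections_eq)
      then show ?thesis
        by (simp add: 3 subst_mult C.lmul_mult lmul_to_cgw_R lmul_to_cgw_E SS_self)
    next
      case (4 s)
      then obtain b where "root b" "s = R b" by (auto simp: reflections_eq)
      then show ?thesis
        by (simp add: 4 subst_mult C.lmul_mult lmul_to_cgw_R lmul_to_cgw_E SS_self)
    next
      case (5 s)
      then obtain b where "root b" "s = R b" by (auto simp: reflections_eq)
      then show ?thesis
        by (simp add: 5 subst_mult C.lmul_mult lmul_to_cgw_R lmul_to_cgw_E SS_self)
    next
      case (6 w s t)
      then obtain u b c where u: "w = M u" and b: "root b" "s = R b" and c: "root c" "t = R c"
        by (auto simp: coxeter_group_eq reflections_eq)
      then have "R (act u c) = R b"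
        using 6(6) by (simp add: M_conj_R)
      then have "EE (act u c) (F u A) = EE b (F u A)"
        using b c by (intro EE_cong) simp_all
      then show ?thesis
        by (simp add: 6(1,2) u b c subst_mult C.lmul_mult lmul_to_cgw_M lmul_to_cgw_E F_EE)
    next
      case (7 s t)
      then obtain b c where b: "root b" "s = R b" and c: "root c" "t = R c"
        by (auto simp: reflections_eq)
      then have "B b c = 0"
        using 7(5,6) reflections_containing_eq_iff[of b c] by simp
      then show ?thesis
        using EE_comm[OF b(1) c(1), of A]
        by (simp add: 7(1,2) b c subst_mult C.lmul_mult lmul_to_cgw_E)
    next
      case (8 s t)
      then obtain b c where b: "root b" "s = R b" and c: "root c" "t = R c"
        by (auto simp: reflections_eq)
      then have "\<bar>B b c\<bar> = 1"
        using 8(5,6) by (simp add: nonorthogonal)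
      \<comment> \<open>The sum over transporters has the single term \<open>R d\<close>, so the
        relation reads as in \<open>EE_EE_adjacent\<close>.\<close>
      from transporters_eq[OF b(1) c(1) this] obtain d where d: "root d" "\<bar>B b d\<bar> = 1"
        "refl d c = b \<or> refl d c = - b" "transporters adj (R b) (R c) = {R d}" by metis
      then show ?thesis
        using EE_EE_adjacent[OF b(1) c(1) d(1-3), of A]
        by (simp add: 8(1,2) b c subst_mult C.lmul_mult lmul_to_cgw_R lmul_to_cgw_E)
    next
      case (9 s t)
      then obtain b c where b: "root b" "s = R b" and c: "root c" "t = R c"
        by (auto simp: reflections_eq)
      then have "\<bar>B b c\<bar> = 1"
        using 9(5,6) by (simp add: nonorthogonal)
      from transporters_eq(4)[OF b(1) c(1) this] 9(7) show ?thesis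
        by (simp add: b c)
    qed
  qed simp_all
  ultimately show "case ab of (a, b) \<Rightarrow> C.eqv (subst to_cgw a) (subst to_cgw b)" by simp
qed simp

section \<open>From the diagram presentation back to the group presentation\<close>

lemma M_closed [simp]: "M u \<in> coxeter_group adj"
  by (simp add: coxeter_group_eq)

lemma R_closed [simp]: "root b \<Longrightarrow> R b \<in> reflections adj" "root b \<Longrightarrow> R b \<in> coxeter_group adj"
  using reflections_subset by (auto simp: reflections_eq)

lemma group_lmul:
  assumes "(p, q) \<in> group_brauer_relations adj (\<lambda>_. 1) (\<lambda>_. \<tau>)"
  shows "G.lmul p A = G.lmul q A"
  using G.rels_closed[OF assms] by (intro G.lmul_cong G.eqv_rels assms) simp_all

abbreviation \<Gamma> :: "'i list \<Rightarrow> (complex^'i^'i) brauer_gen nc_poly set \<Rightarrow> (complex^'i^'i) brauer_gen nc_poly set"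
  where "\<Gamma> u \<equiv> G.lmul (s_gen (M u))"

abbreviation \<E> :: "int^'i \<Rightarrow> (complex^'i^'i) brauer_gen nc_poly set \<Rightarrow> (complex^'i^'i) brauer_gen nc_poly set"
  where "\<E> b \<equiv> G.lmul (e_gen (R b))"

lemma \<Gamma>_\<Gamma>: "\<Gamma> u (\<Gamma> w A) = \<Gamma> (u @ w) A"
  using group_lmul[OF group_brauer_relations.intros(1)[OF _ _ _ refl, of "M u" adj "M w"]]
  by (simp add: G.lmul_mult gen_closed M_mult)

lemma \<Gamma>_Nil [simp]: "\<Gamma> [] A = A"
  using group_lmul[OF group_brauer_relations.intros(2)] by (simp add: M_Nil)

lemma \<Gamma>_\<E>:
  assumes "root b"
  shows "\<Gamma> u (\<E> b A) = \<E> (act u b) (\<Gamma> u A)"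
  using group_lmul[OF group_brauer_relations.intros(6)[OF _ _ _ refl, of "M u" adj "R b"]] assms
  by (simp add: G.lmul_mult gen_closed M_conj_R)

text \<open>Relations among the \<open>s_gen\<close> are equalities of matrices of words, and those
  moving \<open>s_gen\<close> past \<open>e_gen\<close> are instances of conjugation. The
  contraction of \<open>e_gen i * s_gen j * e_gen i\<close> for joined nodes uses the product rule
  for two non-orthogonal reflections.\<close>

lemma compat_of_cgw: "CG.compat of_cgw"
  unfolding CG.compat_def
proof (intro conjI ballI)
  fix x :: "'i brauer_gen"
  show "of_cgw x \<in> nc_span group_gens"
    by (cases x) (simp_all add: of_cgw_def gen_closed)
next
  have closed: "s_gen (R (\<alpha> i)) \<in> nc_span group_gens" "e_gen (R (\<alpha> i)) \<in> nc_span group_gens" for i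
    by (simp_all add: gen_closed)
  note [simp] = closed nc_span_closed subst_mult G.lmul_mult of_cgw_def
  have refl_adj: "refl (\<alpha> i) (\<alpha> j) = \<alpha> i + \<alpha> j" if "adj i j" for i j
    using that adj_irrefl by (auto simp: refl_def B_simple cartan_def vec_eq_iff)
  have refl_nadj: "refl (\<alpha> i) (\<alpha> j) = \<alpha> j" if "i \<noteq> j" "\<not> adj i j" for i j
    using that by (simp add: refl_orth B_simple cartan_def)
  have S: "G.lmul (s_gen (R (\<alpha> i))) A = \<Gamma> [i] A" for i A
    by (simp add: R_simple)
  fix ab assume "ab \<in> cgw_relations adj \<tau>"
  moreover obtain a b where "ab = (a, b)" by (cases ab)
  moreover have "G.eqv (subst of_cgw a) (subst of_cgw b)" if "(a, b) \<in> cgw_relations adj \<tau>" for a b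
  proof (rule G.eqv_if_lmul)
    show cl: "subst of_cgw a \<in> nc_span group_gens" "subst of_cgw b \<in> nc_span group_gens"
      using that by (cases; simp)+
    fix A
    show "G.lmul (subst of_cgw a) A = G.lmul (subst of_cgw b) A"
      using that
    proof cases
      case (1 i)
      have "M [i, i] = M []"
        by (simp add: M_eq_iff refl_refl)
      then show ?thesis by (simp add: 1 S \<Gamma>_\<Gamma>)
    next
      case (2 i j)
      \<comment> \<open>The word \<open>[i, j]\<close> carries \<open>\<alpha> i\<close> to
        \<open>\<alpha> j\<close>, hence conjugates one reflection into the other.\<close>
      have "M [i, j, i] = M [j, i, j]"
        using act_refl[of "[i, j]" "\<alpha> i"] 2(3) refl_adj[of i j] refl_adj[of j i] adj_sym
          refl_refl[of "\<alpha> i" "\<alpha> j"] refl_refl[of "\<alpha> j"]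
        by (simp add: M_eq_iff add.commute)
      then show ?thesis by (simp add: 2(1,2) S \<Gamma>_\<Gamma>)
    next
      case (3 i j)
      have "M [i, j] = M [j, i]"
        using act_refl[of "[i]" "\<alpha> j"] refl_nadj[OF 3(3,4)] by (simp add: M_eq_iff)
      then show ?thesis by (simp add: 3(1,2) S \<Gamma>_\<Gamma>)
    next
      case (4 i)
      show ?thesis
        using group_lmul[OF group_brauer_relations.intros(3), of "R (\<alpha> i)" A] by (simp add: 4)
    next
      case (5 i)
      show ?thesis
        using group_lmul[OF group_brauer_relations.intros(4), of "R (\<alpha> i)" A] by (simp add: 5)
    next
      case (6 i)
      show ?thesis
        using group_lmul[OF group_brauer_relations.intros(5), of "R (\<alpha> i)" A] by (simp add: 6)
    next
      case (7 i j)
      have "act [i, j] (\<alpha> i) = \<alpha> j"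
        using 7(3) adj_sym[of i j] refl_adj[of i j] refl_adj[of j i] refl_refl[of "\<alpha> i" "\<alpha> j"]
        by (simp add: add.commute)
      then show ?thesis
        by (simp add: 7(1,2) S \<Gamma>_\<Gamma> \<Gamma>_\<E>)
    next
      case (8 i j)
      \<comment> \<open>The root of the conjugate of the \<open>i\<close>-th reflection by the
        \<open>j\<close>-th. Moving \<open>\<Gamma> [j]\<close> to the right of the second
        idempotent-like factor replaces \<open>\<alpha> i\<close> by \<open>c\<close>; the only
        transporter between the reflections of \<open>c\<close> and \<open>\<alpha> i\<close> is the
        \<open>j\<close>-th simple one, and the two factors \<open>\<Gamma> [j]\<close>
        cancel.\<close>
      define c where "c = \<alpha> i + \<alpha> j"
      have ji: "adj j i" "i \<noteq> j" using 8(3) adj_sym adj_irrefl by auto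
      have c: "refl (\<alpha> j) (\<alpha> i) = c" "refl (\<alpha> j) c = \<alpha> i" "root c"
        using refl_adj[OF ji(1)] refl_refl[of "\<alpha> j" "\<alpha> i"] root_refl[of "\<alpha> j" "\<alpha> i"]
        by (simp_all add: c_def add.commute)
      have Bc: "B (\<alpha> i) c = 1"
        using 8(3) ji by (simp add: c_def B_linear B_simple cartan_def)
      then have abs: "\<bar>B (\<alpha> i) c\<bar> = 1" by simp
      have "\<alpha> i - B (\<alpha> i) c *s c = - \<alpha> j"
        unfolding Bc by (simp add: c_def vec_eq_iff)
      with transporters_eq(4)[OF root_simple c(3) abs]
      have tr: "transporters adj (R (\<alpha> i)) (R c) = {R (\<alpha> j)}" by simp
      have "c \<noteq> \<alpha> i" "c \<noteq> - \<alpha> i"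
        using Bc by (auto simp: B_linear B_simple cartan_def)
      then have ne: "R (\<alpha> i) \<noteq> R c"
        using R_eq_iff[OF root_simple c(3)] by blast
      then have nc: "reflections_containing adj (fixed_space (R (\<alpha> i)) \<inter> fixed_space (R c))
          \<noteq> {R (\<alpha> i), R c}"
        using reflections_containing_eq_iff[OF root_simple c(3)] Bc by simp
      have "\<E> (\<alpha> i) (\<E> c D) = \<Gamma> [j] (\<E> c D)" for D
        using group_lmul[OF group_brauer_relations.intros(8)[OF _ _ ne nc], of D] c(3)
        by (simp add: tr gen_closed S)
      then have "\<E> (\<alpha> i) (\<Gamma> [j] (\<E> (\<alpha> i) A)) = \<Gamma> [j] (\<Gamma> [j] (\<E> (\<alpha> i) A))"
        by (simp add: \<Gamma>_\<E> c)
      moreover have "M [j, j] = M []"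
        by (simp add: M_eq_iff refl_refl)
      ultimately show ?thesis
        by (simp add: 8(1,2) S \<Gamma>_\<Gamma>)
    next
      case (9 i j)
      then show ?thesis
        by (simp add: S \<Gamma>_\<E> refl_nadj)
    next
      case (10 i j)
      have B: "B (\<alpha> i) (\<alpha> j) = 0"
        using 10(3,4) by (simp add: B_simple cartan_def)
      have "R (\<alpha> i) \<noteq> R (\<alpha> j)"
      proof
        assume "R (\<alpha> i) = R (\<alpha> j)"
        then have "\<alpha> j = \<alpha> i \<or> \<alpha> j = - \<alpha> i"
          by (simp only: R_eq_iff root_simple)
        then have "B (\<alpha> i) (\<alpha> j) = 2 \<or> B (\<alpha> i) (\<alpha> j) = - 2"
          using root_simple[of i] unfolding root_def
          by (elim disjE) (simp_all only: B_uminus_right, simp_all)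
        with B show False by simp
      qed
      moreover from this have "reflections_containing adj
          (fixed_space (R (\<alpha> i)) \<inter> fixed_space (R (\<alpha> j))) = {R (\<alpha> i), R (\<alpha> j)}"
        using reflections_containing_eq_iff[of "\<alpha> i" "\<alpha> j"] B by simp
      ultimately show ?thesis
        using group_lmul[OF group_brauer_relations.intros(7), of "R (\<alpha> i)" "R (\<alpha> j)" A]
        by (simp add: 10(1,2))
    qed
  qed
  ultimately show "case ab of (a, b) \<Rightarrow> G.eqv (subst of_cgw a) (subst of_cgw b)" by simp
qed

lemma lmul_subst_s_word: "G.lmul (subst of_cgw (s_word u)) A = \<Gamma> u A"
proof (induction u arbitrary: A)
  case Nil
  then show ?case by (simp add: s_word_def)
next
  case (Cons i u)
  have "subst of_cgw (s_word u) \<in> nc_span group_gens"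
    by (rule CG.compat_closed[OF compat_of_cgw]) simp
  moreover have "subst of_cgw (s_word (i # u)) = s_gen (M [i]) * subst of_cgw (s_word u)"
    by (simp add: s_word_def subst_mult of_cgw_def R_simple)
  ultimately show ?case
    by (simp add: G.lmul_mult gen_closed Cons \<Gamma>_\<Gamma>)
qed

lemma group_brauer_algebra_iso_cgw:
  "group_brauer_algebra adj (\<lambda>_. 1) (\<lambda>_. \<tau>) \<cong>\<^sub>a\<^sub>l\<^sub>g cgw_brauer_algebra adj \<tau>"
  unfolding group_brauer_algebra_def cgw_brauer_algebra_def
proof (rule presented_algebra_iso[OF _ compat_to_cgw compat_of_cgw])
  show "presentation_pair group_gens (group_brauer_relations adj (\<lambda>_. 1) (\<lambda>_. \<tau>)) UNIV
      (cgw_relations adj \<tau>)" ..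
next
  have closed: "subst of_cgw p \<in> nc_span group_gens" for p
    by (rule CG.compat_closed[OF compat_of_cgw]) simp
  fix x assume x: "x \<in> group_gens"
  show "G.eqv (subst of_cgw (to_cgw x)) (gen x)"
  proof (rule G.eqv_if_lmul[OF _ closed nc_span_closed(8)[OF x]])
    fix A
    from x consider u where "x = GenS (M u)" | b where "root b" "x = GenE (R b)"
      by (auto simp: coxeter_group_eq reflections_eq)
    then show "G.lmul (subst of_cgw (to_cgw x)) A = G.lmul (gen x) A"
    proof cases
      case (1 u)
      obtain w where "to_cgw (GenS (M u)) = s_word w" "M w = M u" by (rule to_cgw_GenS)
      then show ?thesis by (simp add: 1 lmul_subst_s_word)
    next
      case (2 b)
      obtain w i where w: "to_cgw (GenE (R b)) = s_word w * e_gen i * s_word (rev w)"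
        "R (act w (\<alpha> i)) = R b" by (rule to_cgw_GenE[OF 2(1)])
      \<comment> \<open>Moving the middle generator to the front past \<open>w\<close> changes its
        root to \<open>act w (\<alpha> i)\<close> and brings \<open>w\<close> next to its
        inverse.\<close>
      have "M (w @ rev w) = M []"
        by (simp add: M_eq_iff)
      then have "G.lmul (subst of_cgw (to_cgw x)) A = \<E> (act w (\<alpha> i)) A"
        by (simp add: 2(2) w(1) subst_mult G.lmul_mult closed nc_span_closed(5) lmul_subst_s_word
            of_cgw_def gen_closed \<Gamma>_\<E> \<Gamma>_\<Gamma>)
      then show ?thesis
        by (simp add: 2(2) w(2))
    qed
  qed
next
  fix y :: "'i brauer_gen"
  show "C.eqv (subst to_cgw (of_cgw y)) (gen y)"
  proof (rule C.eqv_if_lmul)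
    fix A
    show "C.lmul (subst to_cgw (of_cgw y)) A = C.lmul (gen y) A"
      by (cases y) (simp_all add: of_cgw_def lmul_to_cgw_R lmul_to_cgw_E)
  qed simp_all
qed

end

theorem mainTheorem13:
  fixes adj :: "'i::finite \<Rightarrow> 'i \<Rightarrow> bool"
    and \<mu> \<tau> :: "complex^'i^'i \<Rightarrow> complex"
  assumes "simply_laced_Dynkin adj"
    and "class_function adj \<mu>" and "class_function adj \<tau>"
    and "\<forall>s\<in>reflections adj. \<mu> s \<noteq> 0"
  shows "(\<forall>s\<in>reflections adj. \<forall>t\<in>reflections adj.
            \<exists>w\<in>coxeter_group adj. w ** t ** matrix_inv w = s)
    \<and> (\<exists>m t. m \<noteq> 0 \<and> (\<forall>s\<in>reflections adj. \<mu> s = m \<and> \<tau> s = t)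
        \<and> group_brauer_algebra adj \<mu> \<tau> \<cong>\<^sub>a\<^sub>l\<^sub>g group_brauer_algebra adj (\<lambda>_. 1) (\<lambda>_. t / m)
        \<and> group_brauer_algebra adj \<mu> \<tau> \<cong>\<^sub>a\<^sub>l\<^sub>g cgw_brauer_algebra adj (t / m))"
proof -
  interpret simply_laced adj
    using assms(1) by (rule simply_laced_if_Dynkin)
  have conj: "\<exists>w\<in>coxeter_group adj. w ** t ** matrix_inv w = s"
    if "s \<in> reflections adj" "t \<in> reflections adj" for s t
    using reflections_conjugate[OF Dynkin_connected[OF assms(1)] that] .
  \<comment> \<open>Any reflection serves as base point; the index type is nonempty, so
    \<open>undefined\<close> names some node.\<close>
  define s0 where "s0 = R (axis (undefined :: 'i) 1)"
  have s0: "s0 \<in> reflections adj"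
    by (simp add: s0_def reflections_eq)
  have const: "f s = f s0" if "class_function adj f" "s \<in> reflections adj" for f s
    using that s0 conj[OF that(2) s0] unfolding class_function_def by blast
  define m t where "m = \<mu> s0" and "t = \<tau> s0"
  have m: "m \<noteq> 0"
    using assms(4) s0 by (simp add: m_def)
  have \<mu>\<tau>: "\<mu> s = m" "\<tau> s = t" if "s \<in> reflections adj" for s
    using const[OF assms(2) that] const[OF assms(3) that] by (simp_all add: m_def t_def)
  \<comment> \<open>Rescaling with factor \<open>m\<close>: \<open>m\<close> is \<open>m\<close>
    times 1, and \<open>t\<close> is \<open>m\<close> times \<open>t / m\<close>.\<close>
  have rescale: "group_brauer_algebra adj \<mu> \<tau> \<cong>\<^sub>a\<^sub>l\<^sub>g group_brauer_algebra adj (\<lambda>_. 1) (\<lambda>_. t / m)"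
    by (rule group_brauer_algebra_rescale[OF m]) (simp_all add: \<mu>\<tau> m)
  interpret brauer_pair adj "t / m" ..
  have "group_brauer_algebra adj \<mu> \<tau> \<cong>\<^sub>a\<^sub>l\<^sub>g cgw_brauer_algebra adj (t / m)"
    using rescale group_brauer_algebra_iso_cgw by (rule algebra_isomorphic_trans)
  with conj m \<mu>\<tau> rescale show ?thesis by blast
qed

end
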